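(* Let $F:\mathbb{R}\to\mathbb{R}$ be analytic. The equation $$\ddot u\,u+\tfrac12\dot u^2+F'(u)=0$$ has compact solitary TWS and their associated composite solutions if and only if - $F'(0)=0$ and $F''(0)<0$, and - there exists $m>0$ such that $F(m)=F(0)$, $F(u)<F(0)$ for all $u\in(0,m)$, and $F'(m)\neq0$. These solutions are either compact solitary waves, composite multi-bump solutions with compact support, or composite waves with non-compact support that can be either aperiodic or periodic with arbitrary period (not smaller than the length $t_2-t_1$ of the support of the compact solitary wave, so that supports do not overlap). These solutions are strong singular TWS, they are $C^1(\mathbb{R})$ and piecewise analytic. Furthermore, the compact solitary waves are symmetric with respect to their unique maximum.
   Context: Throughout, only solutions with values in $\{u\ge 0\}$ are considered. Traveling wave solution (TWS): a bounded function $u\in H^1_{loc}(\mathbb{R})$ satisfying the equation $\ddot u\,u+\frac12\dot u^2+F'(u)=0$ in the sense of distributions, i.e. $$\int_{\mathbb{R}}(u^2)_t\phi_t+(u_t)^2\phi-2F'(u)\phi\,dt=0\quad\text{for all }\phi\in C_c^\infty(\mathbb{R}).$$ A non-constant TWS $u$ is a strong singular TWS if, for some constant $h\in\mathbb{R}$, it is a classical solution on $\mathbb{R}$ of $$\frac{u\dot u^2}{2}+F(u)=h;\qquad(\ast)$$ it is a weak singular TWS if, for some constant $h\in\mathbb{R}$, it is a classical solution of $(\ast)$ on $\mathbb{R}\setminus\mathcal{S}$, where $\mathcal{S}$ is a countable set of points $t_k$ at which $\lim_{t\to t_k}\big(\frac{u(t)\dot u(t)^2}{2}+F(u(t))\big)=h$.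 The TWS considered are singular TWS, i.e. they satisfy $(\ast)$ in one of these two senses with one single constant $h$. A TWS $u:\mathbb{R}\to\mathbb{R}$ has compact support if there exist $-\infty<t_1<t_2<\infty$ such that $u$ is constant on $\mathbb{R}\setminus[t_1,t_2]$ and $u$ is non-constant on $[t_1,t_2]$; $[t_1,t_2]$ (chosen minimal) is called the support of $u$. A compact solitary wave (compact solitary TWS) is a continuous TWS which has compact support and a unique extremum (in the interior of its support; points of the constant part are not counted). A TWS $\tilde u$ is a composite wave associated to a compact solitary wave $u$ with support $[t_1,t_2]$ if there is a collection of pairwise disjoint intervals $I_k=(t_1-a_k(t_2-t_1),\,t_2-a_k(t_2-t_1))$, $a_k\in\mathbb{R}$, $k\in K$, where $K$ is either $\mathbb{Z}$ or a finite index set, such that $\tilde u(t)=u(t+a_k(t_2-t_1))$ if $t\in I_k$ for some $k\in K$, and $\tilde u(t)=0$ if $t\in\mathbb{R}\setminus\bigcup_{k\in K}I_k$. "Multi-bump with compact support" means $K$ is finite. *)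

theory Defs
  imports "HOL-Analysis.Analysis"
begin

definition real_analytic_at :: "(real \<Rightarrow> real) \<Rightarrow> real \<Rightarrow> bool" where
  "real_analytic_at f x \<longleftrightarrow> (\<exists>P. (\<lambda>z. f (x + z)) has_fps_expansion P)"

(* The break points S are locally finite, and every analytic piece extends analytically
   across the end points of its interval. *)
definition piecewise_analytic :: "(real \<Rightarrow> real) \<Rightarrow> bool" where
  "piecewise_analytic u \<longleftrightarrow>
     continuous_on UNIV u \<and>
     (\<exists>S. (\<forall>a b. finite (S \<inter> {a..b})) \<and>
          (\<forall>a b. a < b \<longrightarrow> {a<..<b} \<inter> S = {} \<longrightarrow>
             (\<exists>g. (\<forall>x\<in>{a..b}. real_analytic_at g x) \<and> (\<forall>x\<in>{a<..<b}. g x = u x))))"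

definition test_function :: "(real \<Rightarrow> real) \<Rightarrow> bool" where
  "test_function \<phi> \<longleftrightarrow>
     (\<forall>n t. (deriv ^^ n) \<phi> differentiable at t) \<and> (\<exists>a b. \<forall>t. t \<notin> {a..b} \<longrightarrow> \<phi> t = 0)"

definition L1_loc :: "(real \<Rightarrow> real) \<Rightarrow> bool" where
  "L1_loc f \<longleftrightarrow> (\<forall>a b. set_integrable lebesgue {a..b} f)"

definition L2_loc :: "(real \<Rightarrow> real) \<Rightarrow> bool" where
  "L2_loc f \<longleftrightarrow>
     f \<in> borel_measurable lebesgue \<and> (\<forall>a b. set_integrable lebesgue {a..b} (\<lambda>t. (f t)\<^sup>2))"

definition has_weak_derivative :: "(real \<Rightarrow> real) \<Rightarrow> (real \<Rightarrow> real) \<Rightarrow> bool" where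
  "has_weak_derivative u v \<longleftrightarrow>
     L1_loc u \<and> L1_loc v \<and>
     (\<forall>\<phi>. test_function \<phi> \<longrightarrow>
        (LINT t|lebesgue. u t * deriv \<phi> t) = - (LINT t|lebesgue. v t * \<phi> t))"

(* Travelling waves of u'' u + (1/2) u'^2 + F'(u) = 0 in the sense of distributions.
   Here v and w stand for the weak derivatives u_t and (u^2)_t, which are unique up to null sets;
   that u lies in H^1_loc is the condition on u and v. Only values u >= 0 are considered. *)
definition TWS :: "(real \<Rightarrow> real) \<Rightarrow> (real \<Rightarrow> real) \<Rightarrow> bool" where
  "TWS F u \<longleftrightarrow>
     (\<forall>t. 0 \<le> u t) \<and> bounded (range u) \<and> L2_loc u \<and>
     (\<exists>v w. has_weak_derivative u v \<and> L2_loc v \<and> has_weak_derivative (\<lambda>t. (u t)\<^sup>2) w \<and>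
        (\<forall>\<phi>. test_function \<phi> \<longrightarrow>
           has_bochner_integral lebesgue
             (\<lambda>t. w t * deriv \<phi> t + (v t)\<^sup>2 * \<phi> t - 2 * deriv F (u t) * \<phi> t) 0))"

definition energy :: "(real \<Rightarrow> real) \<Rightarrow> (real \<Rightarrow> real) \<Rightarrow> real \<Rightarrow> real" where
  "energy F u t = u t * (deriv u t)\<^sup>2 / 2 + F (u t)"

definition classical_solution_on ::
    "real set \<Rightarrow> (real \<Rightarrow> real) \<Rightarrow> real \<Rightarrow> (real \<Rightarrow> real) \<Rightarrow> bool" where
  "classical_solution_on A F h u \<longleftrightarrow> u C1_differentiable_on A \<and> (\<forall>t\<in>A. energy F u t = h)"

definition strong_singular_TWS :: "(real \<Rightarrow> real) \<Rightarrow> (real \<Rightarrow> real) \<Rightarrow> bool" where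
  "strong_singular_TWS F u \<longleftrightarrow>
     TWS F u \<and> \<not> u constant_on UNIV \<and> (\<exists>h. classical_solution_on UNIV F h u)"

(* The limits are taken through the complement of S, where u' exists. *)
definition weak_singular_TWS :: "(real \<Rightarrow> real) \<Rightarrow> (real \<Rightarrow> real) \<Rightarrow> bool" where
  "weak_singular_TWS F u \<longleftrightarrow>
     TWS F u \<and> \<not> u constant_on UNIV \<and>
     (\<exists>h S. countable S \<and> classical_solution_on (- S) F h u \<and>
        (\<forall>s\<in>S. (energy F u \<longlongrightarrow> h) (at s within - S)))"

definition singular_TWS :: "(real \<Rightarrow> real) \<Rightarrow> (real \<Rightarrow> real) \<Rightarrow> bool" where
  "singular_TWS F u \<longleftrightarrow> strong_singular_TWS F u \<or> weak_singular_TWS F u"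

definition constant_outside :: "(real \<Rightarrow> real) \<Rightarrow> real \<Rightarrow> real \<Rightarrow> bool" where
  "constant_outside u t1 t2 \<longleftrightarrow>
     t1 < t2 \<and> u constant_on (- {t1..t2}) \<and> \<not> u constant_on {t1..t2}"

definition has_compact_support :: "(real \<Rightarrow> real) \<Rightarrow> bool" where
  "has_compact_support u \<longleftrightarrow> (\<exists>t1 t2. constant_outside u t1 t2)"

definition has_support :: "(real \<Rightarrow> real) \<Rightarrow> real \<Rightarrow> real \<Rightarrow> bool" where
  "has_support u t1 t2 \<longleftrightarrow>
     constant_outside u t1 t2 \<and>
     (\<forall>s1 s2. constant_outside u s1 s2 \<longrightarrow> {t1..t2} \<subseteq> {s1..s2})"

definition local_extremum :: "(real \<Rightarrow> real) \<Rightarrow> real \<Rightarrow> bool" where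
  "local_extremum u t \<longleftrightarrow> (\<forall>\<^sub>F s in at t. u s \<le> u t) \<or> (\<forall>\<^sub>F s in at t. u t \<le> u s)"

definition compact_solitary_wave ::
    "(real \<Rightarrow> real) \<Rightarrow> (real \<Rightarrow> real) \<Rightarrow> real \<Rightarrow> real \<Rightarrow> bool" where
  "compact_solitary_wave F u t1 t2 \<longleftrightarrow>
     singular_TWS F u \<and> continuous_on UNIV u \<and> has_support u t1 t2 \<and>
     (\<exists>!t. t \<in> {t1<..<t2} \<and> local_extremum u t)"

definition bump_interval :: "real \<Rightarrow> real \<Rightarrow> real \<Rightarrow> real set" where
  "bump_interval t1 t2 a = {t1 - a * (t2 - t1) <..< t2 - a * (t2 - t1)}"

(* Finite index sets are represented as subsets of the integers. The empty collection would
   give the zero function, which is not a singular TWS. *)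
definition admissible :: "real \<Rightarrow> real \<Rightarrow> int set \<Rightarrow> (int \<Rightarrow> real) \<Rightarrow> bool" where
  "admissible t1 t2 K a \<longleftrightarrow>
     K \<noteq> {} \<and> (finite K \<or> K = UNIV) \<and> disjoint_family_on (\<lambda>k. bump_interval t1 t2 (a k)) K"

definition composite_wave ::
    "(real \<Rightarrow> real) \<Rightarrow> (real \<Rightarrow> real) \<Rightarrow> real \<Rightarrow> real \<Rightarrow> int set \<Rightarrow> (int \<Rightarrow> real) \<Rightarrow> (real \<Rightarrow> real) \<Rightarrow> bool"
  where
  "composite_wave F u t1 t2 K a v \<longleftrightarrow>
     compact_solitary_wave F u t1 t2 \<and> admissible t1 t2 K a \<and> singular_TWS F v \<and>
     (\<forall>k\<in>K. \<forall>t\<in>bump_interval t1 t2 (a k). v t = u (t + a k * (t2 - t1))) \<and>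
     (\<forall>t. t \<notin> (\<Union>k\<in>K. bump_interval t1 t2 (a k)) \<longrightarrow> v t = 0)"

definition has_period :: "(real \<Rightarrow> real) \<Rightarrow> real \<Rightarrow> bool" where
  "has_period v T \<longleftrightarrow> T > 0 \<and> (\<forall>t. v (t + T) = v t)"

definition has_least_period :: "(real \<Rightarrow> real) \<Rightarrow> real \<Rightarrow> bool" where
  "has_least_period v T \<longleftrightarrow> has_period v T \<and> (\<forall>S. has_period v S \<longrightarrow> T \<le> S)"

definition aperiodic :: "(real \<Rightarrow> real) \<Rightarrow> bool" where
  "aperiodic v \<longleftrightarrow> (\<nexists>T. has_period v T)"

end

theory Submission
  imports Defs "HOL-Complex_Analysis.Complex_Analysis"
begin

text \<open>
  The first integral \<open>u * u'\<^sup>2 / 2 + F u = h\<close> is singular at \<open>u = 0\<close>, and this is what allows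
  nonconstant waves to vanish on intervals.

  Suppose a compact solitary wave is given. Outside its support it is a constant \<open>c\<close> with \<open>F c = h\<close>,
  and the distributional equation forces \<open>F' c = 0\<close>. A positive \<open>c\<close> would be an equilibrium that
  cannot be left (\<open>equilibrium_is_isolated\<close>, a Gronwall argument), so \<open>c = 0\<close>, \<open>h = F 0\<close> and
  \<open>F' 0 = 0\<close>. Having only one extremum, the wave rises strictly to a crest of height \<open>m\<close> and falls
  strictly afterwards. On each half monotonicity fixes the sign of \<open>u'\<close>, so the energy identity
  determines \<open>u'\<close> as a continuous function of \<open>u\<close> and the countably many exceptional points are
  removable (\<open>countable_exceptions_DERIV\<close>). A corner at the crest conserves the energy but not the
  momentum \<open>2 * u * u'\<close>; the distributional equation excludes it (\<open>no_corner_at_top\<close>), whence \<open>F m = F 0\<close>.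
  The same Gronwall argument shows that the wave meets no equilibrium on its way up, which gives \<open>F < F 0\<close>
  below the crest and \<open>F' m \<noteq> 0\<close>, and that it could not reach zero in finite time unless \<open>F'' 0 < 0\<close>
  (\<open>hyperbolic_at_zero\<close>).

  Conversely, under these conditions \<open>2 * (F 0 - F x) = x\<^sup>2 * (m - x) * k x\<close> with \<open>k\<close> analytic and
  positive on the closed interval from 0 to \<open>m\<close>. The substitution \<open>u = m * (1 - cos \<theta>) / 2\<close> reduces the
  first integral to \<open>\<theta>' = sqrt (k u)\<close>, which is solved globally by inverting an analytic function with
  positive derivative. This yields an analytic profile with double zeros at both ends of one
  oscillation, symmetric about its crest; cutting it off there gives the solitary wave. It is \<open>C\<^sup>1\<close>,
  and \<open>2 * u * u'\<close> is \<open>C\<^sup>1\<close> too because \<open>F' 0 = 0\<close>, so the equation holds in the sense of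
  distributions (\<open>C1_momentum_balance_imp_TWS\<close>). By \<open>rising_solution_is_profile\<close> every compact solitary wave
  is a translate of this one.

  Since the cut-off profile joins zero smoothly enough at both ends, so does any arrangement of
  disjoint copies (\<open>train_DERIV\<close>). The composite waves are exactly these arrangements, and their
  support and periods are read off from the set of starting points.
\<close>

section \<open>Real-analytic functions\<close>

lemma eval_fps_of_real:
  fixes P :: "real fps"
  assumes "ereal \<bar>t\<bar> < fps_conv_radius P"
  shows "eval_fps (Abs_fps (\<lambda>n. complex_of_real (fps_nth P n))) (of_real t) = of_real (eval_fps P t)"
proof -
  have "(\<lambda>n. fps_nth P n * t ^ n) sums eval_fps P t"
    by (rule sums_eval_fps) (use assms in simp)
  hence "(\<lambda>n. complex_of_real (fps_nth P n * t ^ n)) sums of_real (eval_fps P t)"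
    by (rule sums_of_real)
  thus ?thesis
    by (simp add: eval_fps_def sums_iff)
qed

text \<open>The complex extension of a real power series has the same radius of convergence; conversely
  the real parts of the Taylor coefficients of a complex extension represent the function on the
  real line. Through this equivalence, closure under composition and the inverse function theorem are
  transferred from holomorphic functions.\<close>

theorem real_analytic_at_iff_analytic:
  "real_analytic_at f x \<longleftrightarrow>
     (\<exists>g. g analytic_on {complex_of_real x} \<and>
          (\<forall>\<^sub>F t in nhds x. g (of_real t) = of_real (f t)))"
proof
  assume "real_analytic_at f x"
  then obtain P where P: "(\<lambda>z. f (x + z)) has_fps_expansion P"
    unfolding real_analytic_at_def by blast
  define Q where "Q = Abs_fps (\<lambda>n. complex_of_real (fps_nth P n))"
  have rad: "fps_conv_radius Q = fps_conv_radius P"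
    by (simp add: Q_def fps_conv_radius_def conv_radius_def)
  have pos: "fps_conv_radius P > 0" and ev: "\<forall>\<^sub>F z in nhds 0. eval_fps P z = f (x + z)"
    using P by (auto simp: has_fps_expansion_def)
  define g where "g = (\<lambda>z. eval_fps Q (z - of_real x))"
  have "(\<lambda>z. g (of_real x + z)) has_fps_expansion Q"
    using eval_fps_has_fps_expansion[of Q] pos rad by (simp add: g_def)
  hence "g analytic_on {complex_of_real x}"
    by (rule has_fps_expansion_imp_analytic)
  moreover have "\<forall>\<^sub>F z in nhds 0. z \<in> eball 0 (fps_conv_radius P)"
    by (intro eventually_nhds_in_open) (use pos in \<open>auto simp: zero_ereal_def\<close>)
  with ev have "\<forall>\<^sub>F z in nhds 0. g (of_real (x + z)) = of_real (f (x + z))"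
  proof eventually_elim
    case (elim z)
    thus ?case using eval_fps_of_real[of z P] by (simp add: g_def Q_def)
  qed
  hence "\<forall>\<^sub>F t in nhds x. g (of_real t) = of_real (f t)"
    by (simp add: nhds_to_0[of x] eventually_filtermap add.commute)
  ultimately show "\<exists>g. g analytic_on {complex_of_real x} \<and>
          (\<forall>\<^sub>F t in nhds x. g (of_real t) = of_real (f t))" by blast
next
  assume "\<exists>g. g analytic_on {complex_of_real x} \<and>
          (\<forall>\<^sub>F t in nhds x. g (of_real t) = of_real (f t))"
  then obtain g where g: "g analytic_on {complex_of_real x}"
    and ev: "\<forall>\<^sub>F t in nhds x. g (of_real t) = of_real (f t)" by blast
  define Q where "Q = fps_expansion g (of_real x)"
  have Q: "(\<lambda>z. g (of_real x + z)) has_fps_expansion Q"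
    unfolding Q_def by (rule analytic_at_imp_has_fps_expansion[OF g])
  define P where "P = Abs_fps (\<lambda>n. Re (fps_nth Q n))"
  have pos: "fps_conv_radius Q > 0" and evQ: "\<forall>\<^sub>F z in nhds 0. eval_fps Q z = g (of_real x + z)"
    using Q by (auto simp: has_fps_expansion_def)
  have evQ': "\<forall>\<^sub>F z in nhds 0. z \<in> eball 0 (fps_conv_radius Q) \<and> eval_fps Q z = g (of_real x + z)"
    by (intro eventually_conj evQ eventually_nhds_in_open) (use pos in \<open>auto simp: zero_ereal_def\<close>)
  have "filterlim complex_of_real (nhds (of_real 0)) (nhds 0)"
    by (intro tendsto_of_real filterlim_ident)
  hence ev1: "\<forall>\<^sub>F t in nhds (0::real). complex_of_real t \<in> eball 0 (fps_conv_radius Q) \<and>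
            eval_fps Q (of_real t) = g (of_real x + of_real t)"
    using evQ' unfolding filterlim_iff by auto
  have ev2: "\<forall>\<^sub>F t in nhds 0. g (of_real (x + t)) = of_real (f (x + t))"
    using ev by (simp add: nhds_to_0[of x] eventually_filtermap add.commute)
  have "\<forall>\<^sub>F t in nhds 0. (\<lambda>n. fps_nth P n * t ^ n) sums f (x + t)"
    using ev1 ev2
  proof eventually_elim
    case (elim t)
    have "(\<lambda>n. fps_nth Q n * of_real t ^ n) sums eval_fps Q (of_real t)"
      by (rule sums_eval_fps) (use elim in simp)
    hence "(\<lambda>n. Re (fps_nth Q n * of_real t ^ n)) sums Re (eval_fps Q (of_real t))"
      by (rule sums_Re)
    moreover have "Re (fps_nth Q n * of_real t ^ n) = fps_nth P n * t ^ n" for n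
      by (simp add: P_def flip: of_real_power)
    moreover have "Re (eval_fps Q (of_real t)) = f (x + t)"
      using elim by simp
    ultimately show ?case by (simp only:)
  qed
  thus "real_analytic_at f x"
    unfolding real_analytic_at_def by (blast intro: has_fps_expansionI)
qed

lemma real_analytic_atI:
  assumes "g analytic_on {complex_of_real x}" "\<forall>\<^sub>F t in nhds x. g (of_real t) = of_real (f t)"
  shows "real_analytic_at f x"
  using assms real_analytic_at_iff_analytic by blast

lemma real_analytic_atE:
  assumes "real_analytic_at f x"
  obtains g where "g analytic_on {complex_of_real x}"
    "\<forall>\<^sub>F t in nhds x. g (of_real t) = of_real (f t)"
  using assms real_analytic_at_iff_analytic by blast

lemma real_analytic_at_cong:
  assumes "real_analytic_at f x" "\<forall>\<^sub>F t in nhds x. f t = h t"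
  shows "real_analytic_at h x"
proof -
  obtain g where g: "g analytic_on {complex_of_real x}"
    "\<forall>\<^sub>F t in nhds x. g (of_real t) = of_real (f t)"
    using assms(1) by (rule real_analytic_atE)
  show ?thesis
    by (rule real_analytic_atI[OF g(1)]) (use g(2) assms(2) in \<open>eventually_elim; simp\<close>)
qed

lemma real_analytic_at_const [simp]: "real_analytic_at (\<lambda>_. c) x"
  by (rule real_analytic_atI[of "\<lambda>_. of_real c"]) auto

lemma real_analytic_at_ident [simp]: "real_analytic_at (\<lambda>t. t) x"
  by (rule real_analytic_atI[of "\<lambda>z. z"]) auto

lemma real_analytic_at_cos: "real_analytic_at cos x"
  by (rule real_analytic_atI[of cos]) (auto intro!: analytic_intros simp: cos_of_real)

lemma real_analytic_at_diff:
  "real_analytic_at f x \<Longrightarrow> real_analytic_at h x \<Longrightarrow> real_analytic_at (\<lambda>t. f t - h t) x"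
  unfolding real_analytic_at_def by (elim exE, rule exI, rule has_fps_expansion_diff)

lemma real_analytic_at_mult:
  "real_analytic_at f x \<Longrightarrow> real_analytic_at h x \<Longrightarrow> real_analytic_at (\<lambda>t. f t * h t) x"
  unfolding real_analytic_at_def by (elim exE, rule exI, rule has_fps_expansion_mult)

lemma real_analytic_at_compose:
  assumes "real_analytic_at f x" "real_analytic_at h (f x)"
  shows "real_analytic_at (\<lambda>t. h (f t)) x"
proof -
  obtain g where g: "g analytic_on {complex_of_real x}"
    "\<forall>\<^sub>F t in nhds x. g (of_real t) = of_real (f t)"
    using assms(1) by (rule real_analytic_atE)
  obtain k where k: "k analytic_on {complex_of_real (f x)}"
    "\<forall>\<^sub>F t in nhds (f x). k (of_real t) = of_real (h t)"
    using assms(2) by (rule real_analytic_atE)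
  have gx: "g (of_real x) = of_real (f x)"
    using g(2) by (rule eventually_nhds_x_imp_x)
  have "isCont g (of_real x)"
    using g(1) analytic_at_imp_isCont by blast
  hence "(g \<longlongrightarrow> g (of_real x)) (nhds (of_real x))"
    by (simp add: isCont_def tendsto_at_iff_tendsto_nhds)
  moreover have "(complex_of_real \<longlongrightarrow> of_real x) (nhds x)"
    by (intro tendsto_of_real filterlim_ident)
  ultimately have "((\<lambda>t. g (of_real t)) \<longlongrightarrow> g (of_real x)) (nhds x)"
    by (rule filterlim_compose)
  hence "((\<lambda>t. Re (g (of_real t))) \<longlongrightarrow> f x) (nhds x)"
    using tendsto_Re[of "\<lambda>t. g (of_real t)" "g (of_real x)" "nhds x"] gx by simp
  moreover have "\<forall>\<^sub>F t in nhds x. Re (g (of_real t)) = f t"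
    using g(2) by eventually_elim simp
  ultimately have lim: "(f \<longlongrightarrow> f x) (nhds x)"
    by (rule Lim_transform_eventually)
  have "\<forall>\<^sub>F t in nhds x. k (of_real (f t)) = of_real (h (f t))"
    by (rule eventually_compose_filterlim[OF k(2) lim])
  with g(2) have "\<forall>\<^sub>F t in nhds x. (k \<circ> g) (of_real t) = of_real (h (f t))"
    by eventually_elim simp
  moreover have "(k \<circ> g) analytic_on {complex_of_real x}"
    by (rule analytic_on_compose[OF g(1)]) (use k gx in simp)
  ultimately show ?thesis by (rule real_analytic_atI[rotated])
qed

lemma real_analytic_at_inverse:
  assumes "x \<noteq> 0" shows "real_analytic_at inverse x"
  by (rule real_analytic_atI[of inverse]) (use assms in \<open>auto intro!: analytic_intros\<close>)

lemma real_analytic_at_divide: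
  assumes "real_analytic_at f x" "real_analytic_at h x" "h x \<noteq> 0"
  shows "real_analytic_at (\<lambda>t. f t / h t) x"
  unfolding divide_inverse
  by (intro real_analytic_at_mult assms real_analytic_at_compose[OF assms(2)]
      real_analytic_at_inverse)

lemma real_analytic_at_sqrt:
  assumes "x > 0" shows "real_analytic_at sqrt x"
proof (rule real_analytic_atI[of csqrt])
  show "csqrt analytic_on {complex_of_real x}"
    by (intro analytic_intros) (use assms in \<open>auto simp: complex_nonpos_Reals_iff\<close>)
  have "\<forall>\<^sub>F t in nhds x. t \<in> {0<..}"
    using assms by (intro eventually_nhds_in_open) auto
  thus "\<forall>\<^sub>F t in nhds x. csqrt (of_real t) = of_real (sqrt t)"
    by eventually_elim (rule of_real_sqrt[symmetric], simp)
qed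

lemma real_analytic_at_imp_DERIV:
  assumes "real_analytic_at f x"
  shows "(f has_real_derivative deriv f x) (at x)"
proof -
  obtain P where P: "(\<lambda>z. f (x + z)) has_fps_expansion P"
    using assms unfolding real_analytic_at_def by blast
  have pos: "fps_conv_radius P > 0" and ev: "\<forall>\<^sub>F z in nhds 0. eval_fps P z = f (x + z)"
    using P by (auto simp: has_fps_expansion_def)
  have "(eval_fps P has_field_derivative eval_fps (fps_deriv P) 0) (at 0)"
    by (rule has_field_derivative_eval_fps) (use pos in \<open>simp add: zero_ereal_def\<close>)
  hence "((\<lambda>z. f (x + z)) has_field_derivative eval_fps (fps_deriv P) 0) (at 0)"
    using DERIV_cong_ev[OF refl ev refl] by blast
  hence "(f has_field_derivative eval_fps (fps_deriv P) 0) (at x)"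
    using DERIV_shift[of f _ 0 x] by (simp add: add.commute)
  thus ?thesis by (simp add: DERIV_imp_deriv)
qed

lemma deriv_shift: "deriv (\<lambda>z. f (x + z)) = (\<lambda>z. deriv f (x + z))" for f :: "real \<Rightarrow> real"
proof
  fix z
  have "((\<lambda>z. f (x + z)) has_field_derivative D) (at z) \<longleftrightarrow> (f has_field_derivative D) (at (x + z))" for D
    using DERIV_shift[of f D z x] by (simp add: add.commute)
  thus "deriv (\<lambda>z. f (x + z)) z = deriv f (x + z)"
    by (simp add: deriv_def)
qed

lemma real_analytic_at_deriv:
  assumes "real_analytic_at f x"
  shows "real_analytic_at (deriv f) x"
proof -
  obtain P where "(\<lambda>z. f (x + z)) has_fps_expansion P"
    using assms unfolding real_analytic_at_def by blast
  from has_fps_expansion_deriv[OF this] show ?thesis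
    unfolding real_analytic_at_def deriv_shift by blast
qed

lemma real_analytic_at_removable:
  assumes "real_analytic_at f a" "f a = 0"
  shows "real_analytic_at (\<lambda>x. if x = a then deriv f a else f x / (x - a)) a"
proof -
  obtain P where P: "(\<lambda>z. f (a + z)) has_fps_expansion P"
    using assms unfolding real_analytic_at_def by blast
  have P0: "fps_nth P 0 = 0"
    using P assms(2) by (auto simp: has_fps_expansion_def eval_fps_at_0 dest!: eventually_nhds_x_imp_x)
  have "(\<lambda>z. deriv f (a + z)) has_fps_expansion fps_deriv P"
    using has_fps_expansion_deriv[OF P] by (simp add: deriv_shift)
  hence P1: "fps_nth P 1 = deriv f a"
    by (auto simp: has_fps_expansion_def eval_fps_at_0 dest!: eventually_nhds_x_imp_x)
  show ?thesis
  proof (cases "P = 0")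
    case False
    have "(\<lambda>x. if x = 0 then deriv f a else f (a + x) / x ^ 1) has_fps_expansion fps_shift 1 P"
      by (rule has_fps_expansion_shift[OF P])
         (use False P0 P1 in \<open>auto intro!: subdegree_geI\<close>)
    thus ?thesis unfolding real_analytic_at_def
      by (intro exI[of _ "fps_shift 1 P"]) (simp add: algebra_simps cong: if_cong)
  next
    case True
    have ev: "\<forall>\<^sub>F z in nhds 0. 0 = f (a + z)"
      using P True by (auto simp: has_fps_expansion_def)
    hence "\<forall>\<^sub>F t in nhds a. 0 = f t"
      by (simp add: nhds_to_0[of a] eventually_filtermap add.commute)
    hence "\<forall>\<^sub>F t in nhds a. 0 = (if t = a then deriv f a else f t / (t - a))"
      by eventually_elim (use P1 True in auto)
    thus ?thesis
      by (rule real_analytic_at_cong[OF real_analytic_at_const])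
  qed
qed

lemma complex_derivative_along_reals:
  assumes "(g has_field_derivative D) (at (complex_of_real x))"
  shows "((\<lambda>t. g (of_real t)) has_vector_derivative D) (at x)"
  using has_vector_derivative_real_field[OF assms] by simp

text \<open>A holomorphic primitive of the complex extension differs from the given real primitive by
  a constant on a real neighbourhood, because the difference has derivative zero there.\<close>

lemma real_analytic_at_primitive:
  assumes "real_analytic_at f' x"
    and "\<forall>\<^sub>F t in nhds x. (f has_real_derivative f' t) (at t)"
  shows "real_analytic_at f x"
proof -
  obtain g where g: "g analytic_on {complex_of_real x}"
    "\<forall>\<^sub>F t in nhds x. g (of_real t) = of_real (f' t)"
    using assms(1) by (rule real_analytic_atE)
  obtain r where r: "r > 0" "g holomorphic_on ball (of_real x) r"
    using g(1) analytic_on_def by auto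
  obtain G where G: "\<And>z. z \<in> ball (complex_of_real x) r \<Longrightarrow>
      (G has_field_derivative g z) (at z within ball (of_real x) r)"
    using holomorphic_convex_primitive'[OF convex_ball open_ball r(2)] by blast
  hence G': "(G has_field_derivative g z) (at z)" if "z \<in> ball (complex_of_real x) r" for z
    using that at_within_open[OF that open_ball] by metis
  obtain e where e: "e > 0" and ev: "\<And>t. dist t x < e \<Longrightarrow>
      (f has_real_derivative f' t) (at t) \<and> g (of_real t) = of_real (f' t)"
    using eventually_conj[OF assms(2) g(2)] unfolding eventually_nhds_metric by blast
  define d where "d = min e r"
  have d: "d > 0" using e r by (simp add: d_def)
  define h where "h = (\<lambda>t. G (of_real t) - complex_of_real (f t))"
  have h: "(h has_derivative (\<lambda>_. 0)) (at t within ball x d)" if "t \<in> ball x d" for t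
  proof -
    have t: "dist t x < e" "complex_of_real t \<in> ball (of_real x) r"
      using that by (auto simp: d_def dist_commute dist_of_real)
    have "((\<lambda>t. G (of_real t)) has_vector_derivative g (of_real t)) (at t)"
      by (rule complex_derivative_along_reals[OF G'[OF t(2)]])
    moreover have "((\<lambda>t. complex_of_real (f t)) has_vector_derivative of_real (f' t)) (at t)"
      using ev[OF t(1)] has_vector_derivative_of_real by blast
    ultimately have "(h has_vector_derivative g (of_real t) - of_real (f' t)) (at t)"
      unfolding h_def by (rule has_vector_derivative_diff)
    hence "(h has_vector_derivative 0) (at t)"
      using ev[OF t(1)] by simp
    thus ?thesis
      by (simp add: has_vector_derivative_def has_derivative_at_withinI)
  qed
  obtain c where c: "\<And>t. t \<in> ball x d \<Longrightarrow> h t = c"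
    using has_derivative_zero_constant[OF convex_ball h] by blast
  have "\<forall>\<^sub>F t in nhds x. t \<in> ball x d"
    by (intro eventually_nhds_in_open) (use d in auto)
  hence "\<forall>\<^sub>F t in nhds x. G (of_real t) - c = of_real (f t)"
    by eventually_elim (use c in \<open>auto simp: h_def algebra_simps\<close>)
  moreover have "(\<lambda>z. G z - c) analytic_on {complex_of_real x}"
  proof -
    have "G holomorphic_on ball (of_real x) r"
      unfolding holomorphic_on_open[OF open_ball] using G' by blast
    hence "(\<lambda>z. G z - c) holomorphic_on ball (of_real x) r"
      by (intro holomorphic_intros)
    thus ?thesis using r(1) unfolding analytic_at
      by (intro exI[of _ "ball (complex_of_real x) r"]) auto
  qed
  ultimately show ?thesis by (rule real_analytic_atI[rotated])
qed

text \<open>The complex extension has nonzero derivative, hence is injective near the point, and the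
  inverse of an injective holomorphic function is holomorphic. Continuity of the given real inverse
  keeps its values inside the region of injectivity.\<close>

lemma real_analytic_at_inverse_function:
  assumes "real_analytic_at f x" "deriv f x \<noteq> 0"
    and "isCont h (f x)" "h (f x) = x" "\<forall>\<^sub>F s in nhds (f x). f (h s) = s"
  shows "real_analytic_at h (f x)"
proof -
  obtain g where g: "g analytic_on {complex_of_real x}"
    "\<forall>\<^sub>F t in nhds x. g (of_real t) = of_real (f t)"
    using assms(1) by (rule real_analytic_atE)
  obtain S where S: "open S" "complex_of_real x \<in> S" "g holomorphic_on S"
    using g(1) analytic_at by blast
  have "(g has_field_derivative deriv g (of_real x)) (at (of_real x))"
    using S holomorphic_derivI by blast
  hence "((\<lambda>t. g (of_real t)) has_vector_derivative deriv g (of_real x)) (at x)"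
    by (rule complex_derivative_along_reals)
  hence "((\<lambda>t. complex_of_real (f t)) has_vector_derivative deriv g (of_real x)) (at x)"
    using has_vector_derivative_cong_ev[of UNIV "\<lambda>t. g (of_real t)" "\<lambda>t. of_real (f t)" x]
      g(2) eventually_nhds_x_imp_x[OF g(2)] by (auto elim: eventually_mono)
  moreover have "((\<lambda>t. complex_of_real (f t)) has_vector_derivative of_real (deriv f x)) (at x)"
    using real_analytic_at_imp_DERIV[OF assms(1)] has_vector_derivative_of_real by blast
  ultimately have "deriv g (of_real x) = of_real (deriv f x)"
    by (rule vector_derivative_unique_at)
  with assms(2) have nz: "deriv g (of_real x) \<noteq> 0" by simp
  obtain r where r: "r > 0" "ball (complex_of_real x) r \<subseteq> S" "inj_on g (ball (of_real x) r)"
    using has_complex_derivative_locally_injective[OF S(3) S(2) S(1) nz] by blast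
  let ?B = "ball (complex_of_real x) r"
  have holB: "g holomorphic_on ?B"
    using S r holomorphic_on_subset by blast
  obtain k where k: "k holomorphic_on (g ` ?B)" "\<And>z. z \<in> ?B \<Longrightarrow> k (g z) = z"
    using holomorphic_has_inverse[OF holB open_ball r(3)] by metis
  have "open (g ` ?B)"
    by (rule open_mapping_thm3[OF holB open_ball r(3)])
  moreover have "g (of_real x) = of_real (f x)"
    using g(2) by (rule eventually_nhds_x_imp_x)
  ultimately have ank: "k analytic_on {complex_of_real (f x)}"
    using k(1) r(1) unfolding analytic_at
    by (intro exI[of _ "g ` ?B"] conjI) (auto intro!: image_eqI[of _ g "of_real x"])
  have lim: "(h \<longlongrightarrow> x) (nhds (f x))"
    using assms(3,4) tendsto_at_iff_tendsto_nhds[of h "f x"] by (simp add: isCont_def)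
  have "\<forall>\<^sub>F t in nhds x. t \<in> ball x r"
    by (intro eventually_nhds_in_open) (use r in auto)
  with g(2) have "\<forall>\<^sub>F t in nhds x. k (of_real (f t)) = of_real t"
  proof eventually_elim
    case (elim t)
    thus ?case using k(2)[of "of_real t"] by (simp add: dist_of_real)
  qed
  hence "\<forall>\<^sub>F s in nhds (f x). k (of_real (f (h s))) = of_real (h s)"
    by (rule eventually_compose_filterlim[OF _ lim])
  with assms(5) have "\<forall>\<^sub>F s in nhds (f x). k (of_real s) = of_real (h s)"
    by eventually_elim simp
  thus ?thesis by (rule real_analytic_atI[OF ank])
qed

section \<open>Smooth bumps and the fundamental lemma of the calculus of variations\<close>

text \<open>The functions \<open>exp (- 1 / t) / t ^ k\<close> extended by zero to \<open>t \<le> 0\<close>. Carrying the power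
  \<open>k\<close> along makes the family closed under differentiation up to linear combinations.\<close>

definition flat_exp :: "nat \<Rightarrow> real \<Rightarrow> real" where
  "flat_exp k t = (if t > 0 then exp (- inverse t) * inverse t ^ k else 0)"

text \<open>One term of the exponential series, \<open>s ^ (k + 2) / fact (k + 2) \<le> exp s\<close> at \<open>s = 1 / t\<close>,
  shows that the function vanishes to second order at zero; so its derivative there is zero.\<close>

lemma flat_exp_bound: "\<bar>flat_exp k t\<bar> \<le> fact (k + 2) * t\<^sup>2"
proof (cases "t > 0")
  case True
  define s where "s = inverse t"
  have s: "s > 0" using True by (simp add: s_def)
  have "(\<Sum>n\<in>{k + 2}. s ^ n /\<^sub>R fact n) \<le> exp s"
    unfolding exp_def by (rule sum_le_suminf[OF summable_exp_generic]) (use s in auto)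
  moreover define N :: real where "N = fact (k + 2)"
  moreover have "N > 0" by (simp only: N_def fact_gt_zero)
  ultimately have "s ^ (k + 2) * exp (- s) \<le> N"
    by (simp add: field_simps exp_minus)
  hence "s ^ k * exp (- s) * (s\<^sup>2 * t\<^sup>2) \<le> N * t\<^sup>2"
    using mult_right_mono[of "s ^ (k + 2) * exp (- s)" N "t\<^sup>2"]
    by (simp add: power_add power2_eq_square mult_ac)
  moreover have "s\<^sup>2 * t\<^sup>2 = 1"
    using True by (simp add: s_def power_mult_distrib[symmetric])
  ultimately have "s ^ k * exp (- s) \<le> N * t\<^sup>2" by (simp only: mult_1_right)
  thus ?thesis
    using True unfolding N_def by (simp add: flat_exp_def s_def mult_ac del: fact_Suc)
qed (simp add: flat_exp_def)

lemma flat_exp_DERIV: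
  "(flat_exp k has_real_derivative flat_exp (k + 2) t - k * flat_exp (k + 1) t) (at t)"
proof (cases t "0::real" rule: linorder_cases)
  case less
  have "((\<lambda>_. 0) has_real_derivative 0) (at t)" by simp
  hence "(flat_exp k has_real_derivative 0) (at t)"
    by (rule has_field_derivative_transform_within_open[of _ _ _ "{..<0}"])
       (use less in \<open>auto simp: flat_exp_def\<close>)
  thus ?thesis using less by (simp add: flat_exp_def)
next
  case greater
  have i: "(inverse has_real_derivative - (inverse t ^ 2)) (at t)"
    using DERIV_inverse[of t] greater by (simp add: numeral_2_eq_2)
  have p: "((\<lambda>t. inverse t ^ k) has_real_derivative k * (- (inverse t ^ 2) * inverse t ^ (k - Suc 0))) (at t)"
    by (rule DERIV_power[OF i])
  have e: "((\<lambda>t. exp (- inverse t)) has_real_derivative exp (- inverse t) * inverse t ^ 2) (at t)"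
    using DERIV_chain2[OF DERIV_exp DERIV_minus[OF i]] by simp
  have "((\<lambda>t. exp (- inverse t) * inverse t ^ k) has_real_derivative
      (exp (- inverse t) * inverse t ^ (k + 2) - k * (exp (- inverse t) * inverse t ^ (k + 1)))) (at t)"
    by (rule DERIV_cong[OF DERIV_mult[OF e p]], cases k)
       (auto simp: algebra_simps power_add power2_eq_square)
  hence "(flat_exp k has_real_derivative
      (exp (- inverse t) * inverse t ^ (k + 2) - k * (exp (- inverse t) * inverse t ^ (k + 1)))) (at t)"
    by (rule has_field_derivative_transform_within_open[of _ _ _ "{0<..}"])
       (use greater in \<open>auto simp: flat_exp_def\<close>)
  thus ?thesis using greater by (simp add: flat_exp_def)
next
  case equal
  have "((\<lambda>h. flat_exp k h / h) \<longlongrightarrow> 0) (at 0)"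
  proof (rule Lim_null_comparison)
    show "\<forall>\<^sub>F h in at 0. norm (flat_exp k h / h) \<le> fact (k + 2) * \<bar>h\<bar>"
    proof (rule eventually_at_filter[THEN iffD2], rule always_eventually, intro allI impI)
      fix h :: real assume "h \<noteq> 0"
      thus "norm (flat_exp k h / h) \<le> fact (k + 2) * \<bar>h\<bar>"
        using flat_exp_bound[of k h] power2_abs[of h]
        by (simp add: pos_divide_le_eq power2_eq_square mult.assoc del: fact_Suc)
    qed
    show "((\<lambda>h. fact (k + 2) * \<bar>h\<bar>) \<longlongrightarrow> 0) (at (0::real))"
      by (auto intro!: tendsto_eq_intros)
  qed
  thus ?thesis using equal by (simp add: DERIV_def flat_exp_def)
qed

text \<open>An algebra of functions closed under differentiation consists of smooth functions. This
  one contains the bumps below, and smoothness is read off without a formula for the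
  higher derivatives.\<close>

inductive_set bump_algebra :: "(real \<Rightarrow> real) set" where
  const: "(\<lambda>_. c) \<in> bump_algebra"
| flat: "(\<lambda>t. flat_exp k (c * t + d)) \<in> bump_algebra"
| add: "f \<in> bump_algebra \<Longrightarrow> g \<in> bump_algebra \<Longrightarrow> (\<lambda>t. f t + g t) \<in> bump_algebra"
| mult: "f \<in> bump_algebra \<Longrightarrow> g \<in> bump_algebra \<Longrightarrow> (\<lambda>t. f t * g t) \<in> bump_algebra"

lemma bump_algebra_DERIV:
  "f \<in> bump_algebra \<Longrightarrow> \<exists>f'\<in>bump_algebra. \<forall>t. (f has_real_derivative f' t) (at t)"
proof (induction rule: bump_algebra.induct)
  case (const c)
  show ?case by (rule bexI[OF _ bump_algebra.const[of 0]]) auto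
next
  case (flat k c d)
  let ?f' = "\<lambda>t. c * (flat_exp (k + 2) (c * t + d) + (- real k) * flat_exp (k + 1) (c * t + d))"
  have "?f' \<in> bump_algebra"
    by (intro bump_algebra.intros)
  moreover have "((\<lambda>t. flat_exp k (c * t + d)) has_real_derivative ?f' t) (at t)" for t
    by (rule DERIV_cong[OF DERIV_chain2[OF flat_exp_DERIV]])
       (auto intro!: derivative_eq_intros simp: algebra_simps)
  ultimately show ?case by (intro bexI[of _ ?f'] allI)
next
  case (add f g)
  then obtain f' g' where "f' \<in> bump_algebra" "g' \<in> bump_algebra"
    "\<And>t. (f has_real_derivative f' t) (at t)" "\<And>t. (g has_real_derivative g' t) (at t)" by blast
  thus ?case
    by (intro bexI[of _ "\<lambda>t. f' t + g' t"] bump_algebra.intros) (auto intro!: derivative_intros)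
next
  case (mult f g)
  then obtain f' g' where *: "f' \<in> bump_algebra" "g' \<in> bump_algebra"
    "\<And>t. (f has_real_derivative f' t) (at t)" "\<And>t. (g has_real_derivative g' t) (at t)" by blast
  have "(\<lambda>t. f t * g' t + f' t * g t) \<in> bump_algebra"
    by (intro bump_algebra.intros mult *)
  thus ?case using * mult
    by (intro bexI[of _ "\<lambda>t. f t * g' t + f' t * g t"]) (auto intro!: derivative_eq_intros)
qed

lemma bump_algebra_higher_deriv: "f \<in> bump_algebra \<Longrightarrow> (deriv ^^ n) f \<in> bump_algebra"
proof (induction n)
  case (Suc n)
  then obtain f' where "f' \<in> bump_algebra" "\<And>t. ((deriv ^^ n) f has_real_derivative f' t) (at t)"
    using bump_algebra_DERIV by blast
  moreover from this have "deriv ((deriv ^^ n) f) = f'"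
    by (auto intro: DERIV_imp_deriv)
  ultimately show ?case by simp
qed simp

text \<open>Smooth functions between 0 and 1 that are positive exactly on the open interval and
  increase to its indicator as \<open>n\<close> grows.\<close>

definition bump :: "nat \<Rightarrow> real \<Rightarrow> real \<Rightarrow> real \<Rightarrow> real" where
  "bump n a b t = flat_exp 0 (real (Suc n) * (t - a)) * flat_exp 0 (real (Suc n) * (b - t))"

lemma bump_outside: "t \<notin> {a<..<b} \<Longrightarrow> bump n a b t = 0"
  by (auto simp: bump_def flat_exp_def zero_less_mult_iff)

lemma bump_pos: "t \<in> {a<..<b} \<Longrightarrow> bump n a b t > 0"
  by (auto simp: bump_def flat_exp_def)

lemma bump_nonneg: "0 \<le> bump n a b t"
  by (auto simp: bump_def flat_exp_def)

lemma bump_le_1: "bump n a b t \<le> 1"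
proof -
  have "0 \<le> flat_exp 0 s \<and> flat_exp 0 s \<le> 1" for s by (simp add: flat_exp_def)
  thus ?thesis unfolding bump_def by (intro mult_le_one) auto
qed

lemma test_function_bump: "test_function (bump n a b)"
proof -
  have "(\<lambda>t. flat_exp 0 (real (Suc n) * t + - (real (Suc n) * a)) * flat_exp 0 ((- real (Suc n)) * t + real (Suc n) * b)) \<in> bump_algebra"
    by (intro bump_algebra.intros)
  also have "(\<lambda>t. flat_exp 0 (real (Suc n) * t + - (real (Suc n) * a)) * flat_exp 0 ((- real (Suc n)) * t + real (Suc n) * b)) = bump n a b"
    by (auto simp: bump_def fun_eq_iff algebra_simps)
  finally have "bump n a b \<in> bump_algebra" .
  hence "(deriv ^^ k) (bump n a b) differentiable at t" for k t
    using bump_algebra_higher_deriv bump_algebra_DERIV real_differentiable_def by blast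
  thus ?thesis
    unfolding test_function_def using bump_outside by (metis greaterThanLessThan_subseteq_atLeastAtMost_iff in_mono order_refl)
qed

lemma bump_tendsto: "(\<lambda>n. bump n a b t) \<longlonglongrightarrow> indicator {a<..<b} t"
proof (cases "t \<in> {a<..<b}")
  case True
  have *: "(\<lambda>n. flat_exp 0 (real (Suc n) * c)) \<longlonglongrightarrow> 1" if "c > 0" for c
  proof -
    have "(\<lambda>n. exp (- (inverse (real (Suc n)) * inverse c))) \<longlonglongrightarrow> exp (- (0 * inverse c))"
      by (intro tendsto_intros LIMSEQ_inverse_real_of_nat)
    thus ?thesis using that by (simp add: flat_exp_def mult.commute)
  qed
  show ?thesis
    unfolding bump_def using tendsto_mult[OF *[of "t - a"] *[of "b - t"]] True by simp
next
  case False
  thus ?thesis using bump_outside[OF False] by simp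
qed

lemma test_function_DERIV:
  assumes "test_function \<phi>"
  shows "(\<phi> has_real_derivative deriv \<phi> t) (at t)"
    and "(deriv \<phi> has_real_derivative deriv (deriv \<phi>) t) (at t)"
proof -
  have "(deriv ^^ n) \<phi> differentiable at t" for n t
    using assms unfolding test_function_def by blast
  from this[of 0] this[of 1] show "(\<phi> has_real_derivative deriv \<phi> t) (at t)"
    "(deriv \<phi> has_real_derivative deriv (deriv \<phi>) t) (at t)"
    by (simp_all add: DERIV_deriv_iff_real_differentiable)
qed

lemma deriv_eq_0_outside:
  fixes f :: "real \<Rightarrow> real"
  assumes "\<And>t. t \<notin> {a..b} \<Longrightarrow> f t = 0" "t \<notin> {a..b}"
  shows "deriv f t = 0"
proof -
  have "((\<lambda>_. 0) has_real_derivative 0) (at t)" by simp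
  hence "(f has_real_derivative 0) (at t)"
    by (rule has_field_derivative_transform_within_open[of _ _ _ "- {a..b}"])
       (use assms in auto)
  thus ?thesis by (rule DERIV_imp_deriv)
qed

lemma test_function_deriv:
  assumes "test_function \<phi>" shows "test_function (deriv \<phi>)"
proof -
  obtain a b where ab: "\<And>t. t \<notin> {a..b} \<Longrightarrow> \<phi> t = 0"
    using assms unfolding test_function_def by blast
  have "(deriv ^^ n) (deriv \<phi>) differentiable at t" for n t
  proof -
    have "(deriv ^^ Suc n) \<phi> differentiable at t"
      using assms unfolding test_function_def by blast
    thus ?thesis by (simp add: funpow_swap1)
  qed
  thus ?thesis unfolding test_function_def using deriv_eq_0_outside[of a b \<phi>, OF ab] by blast
qed

lemma test_function_continuous:
  assumes "test_function \<phi>" shows "continuous_on A \<phi>"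
  using test_function_DERIV(1)[OF assms] DERIV_isCont continuous_at_imp_continuous_on by blast

lemma continuous_set_integrable_lebesgue:
  fixes f :: "real \<Rightarrow> real"
  assumes "continuous_on UNIV f"
  shows "set_integrable lebesgue {a..b} f"
proof -
  have "continuous_on {a..b} f" using assms continuous_on_subset by blast
  thus ?thesis using absolutely_integrable_continuous_real by blast
qed

lemma L1_loc_continuous: "continuous_on UNIV f \<Longrightarrow> L1_loc f"
  unfolding L1_loc_def by (simp add: continuous_set_integrable_lebesgue)

lemma integrable_L1_loc_mult:
  assumes g: "L1_loc g" and \<phi>: "continuous_on UNIV \<phi>" "\<And>t. t \<notin> {a..b} \<Longrightarrow> \<phi> t = 0"
  shows "integrable lebesgue (\<lambda>t. g t * \<phi> t)"
proof -
  have int: "integrable lebesgue (\<lambda>t. indicator {a..b} t * g t)"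
    using g unfolding L1_loc_def set_integrable_def by simp
  have "compact (\<phi> ` {a..b})"
    using \<phi>(1) by (intro compact_continuous_image) (auto intro: continuous_on_subset)
  then obtain B where B: "\<And>t. t \<in> {a..b} \<Longrightarrow> \<bar>\<phi> t\<bar> \<le> B"
    using compact_imp_bounded bounded_iff by (metis imageI real_norm_def)
  have meas: "\<phi> \<in> borel_measurable lebesgue"
    using borel_measurable_continuous_onI[OF \<phi>(1)] by (intro measurable_completion) simp
  have eq: "g t * \<phi> t = indicator {a..b} t * g t * \<phi> t" for t
    using \<phi>(2)[of t] by (auto simp: indicator_def)
  show ?thesis unfolding eq
  proof (rule Bochner_Integration.integrable_bound)
    show "integrable lebesgue (\<lambda>t. B * (indicator {a..b} t * g t))"
      using int by simp
    show "(\<lambda>t. indicator {a..b} t * g t * \<phi> t) \<in> borel_measurable lebesgue"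
      using borel_measurable_integrable[OF int] meas by (rule borel_measurable_times)
    show "AE t in lebesgue. norm (indicator {a..b} t * g t * \<phi> t) \<le> norm (B * (indicator {a..b} t * g t))"
      using B by (intro always_eventually)
        (auto simp: indicator_def abs_mult mult.commute intro!: mult_mono order_trans[OF B abs_ge_self])
  qed
qed

text \<open>Open intervals form an intersection-stable generator of the Borel sets, so by a Dynkin
  argument the integral over every Borel set vanishes. The integrand is first replaced by a Borel
  version, since it is only Lebesgue measurable.\<close>

lemma integral_zero_on_intervals_imp_AE_zero:
  fixes G :: "real \<Rightarrow> real"
  assumes int: "integrable lebesgue G"
    and zero: "\<And>x y. (LINT t:{x<..<y}|lebesgue. G t) = 0"
    and total: "(LINT t|lebesgue. G t) = 0"
  shows "AE t in lebesgue. G t = 0"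
proof -
  obtain H where H: "H \<in> borel_measurable lborel" "AE t in lborel. G t = H t"
    using completion_ex_borel_measurable_real[of G lborel] int by blast
  have ae: "AE t in lebesgue. G t = H t"
    using H(2) by (rule AE_completion)
  have Hm: "H \<in> borel_measurable lebesgue"
    using H(1) by (rule measurable_completion)
  have "integrable lebesgue H"
    using integrable_cong_AE[of G lebesgue H] int ae Hm by auto
  hence intH: "integrable lborel H"
    using integrable_completion H(1) by blast
  have intHA: "set_integrable lborel A H" if "A \<in> sets borel" for A
    unfolding set_integrable_def by (rule integrable_mult_indicator) (use that intH in auto)
  have eq: "(LINT t:A|lborel. H t) = (LINT t:A|lebesgue. G t)" if "A \<in> sets borel" for A
  proof -
    have "(LINT t:A|lebesgue. G t) = (LINT t:A|lebesgue. H t)"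
      unfolding set_lebesgue_integral_def
    proof (rule integral_cong_AE)
      have "A \<in> sets lebesgue" using that by auto
      thus "(\<lambda>t. indicat_real A t *\<^sub>R G t) \<in> borel_measurable lebesgue"
        "(\<lambda>t. indicat_real A t *\<^sub>R H t) \<in> borel_measurable lebesgue"
        using borel_measurable_integrable[OF int] Hm
        by (auto intro!: borel_measurable_times borel_measurable_indicator)
      show "AE t in lebesgue. indicat_real A t *\<^sub>R G t = indicat_real A t *\<^sub>R H t"
        using ae by eventually_elim simp
    qed
    also have "\<dots> = (LINT t:A|lborel. H t)"
      unfolding set_lebesgue_integral_def
      by (rule integral_completion) (use that H(1) in measurable)
    finally show ?thesis by simp
  qed
  have totH: "(LINT t:UNIV|lborel. H t) = 0"
    using eq[of UNIV] total by (simp add: set_lebesgue_integral_def)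
  have "set_lebesgue_integral lborel A H = 0" if "A \<in> sets borel" for A
  proof -
    have A: "A \<in> sigma_sets UNIV (range (\<lambda>(a::real, b). box a b))"
      using that by (simp add: borel_eq_box)
    have "Int_stable (range (\<lambda>(a::real, b). box a b))"
      by (auto simp: Int_stable_def box_real Int_greaterThanLessThan)
    moreover have "range (\<lambda>(a::real, b). box a b) \<subseteq> Pow UNIV" by simp
    ultimately show ?thesis using A
    proof (induction rule: sigma_sets_induct_disjoint)
      case (basic A)
      then obtain a b where "A = {a<..<b}" by (auto simp: box_real)
      thus ?case using eq[of A] zero by simp
    next
      case (compl A)
      have A: "A \<in> sets borel" using compl(1) by (simp add: borel_eq_box)
      have "(LINT t:A \<union> (UNIV - A)|lborel. H t) = (LINT t:A|lborel. H t) + (LINT t:UNIV - A|lborel. H t)"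
        by (rule set_integral_Un) (use A intHA in auto)
      thus ?case using compl(2) totH by simp
    next
      case (union A)
      have A: "A i \<in> sets borel" for i using union(2) by (auto simp: borel_eq_box)
      have "(LINT t:(\<Union>i. A i)|lborel. H t) = (\<Sum>i. (LINT t:(A i)|lborel. H t))"
        by (rule lebesgue_integral_countable_add)
           (use A union(1) intHA in \<open>auto simp: disjoint_family_on_def\<close>)
      thus ?case using union(3) by simp
    qed (auto simp: set_lebesgue_integral_def)
  qed
  hence "AE t in lborel. H t = 0"
    by (intro sigma_finite_measure.density_zero[OF sigma_finite_lborel intH]) auto
  hence "AE t in lebesgue. H t = 0" by (rule AE_completion)
  with ae show ?thesis by eventually_elim simp
qed

text \<open>Testing with bumps that converge to the indicator of a subinterval gives, by dominated
  convergence, a vanishing integral over that subinterval.\<close>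

theorem fundamental_lemma_of_variations:
  fixes g :: "real \<Rightarrow> real"
  assumes g: "L1_loc g"
    and zero: "\<And>\<phi>. test_function \<phi> \<Longrightarrow> (\<And>t. t \<notin> {\<alpha><..<\<beta>} \<Longrightarrow> \<phi> t = 0) \<Longrightarrow>
      (LINT t|lebesgue. g t * \<phi> t) = 0"
  shows "AE t in lebesgue. t \<in> {\<alpha><..<\<beta>} \<longrightarrow> g t = 0"
proof -
  define G where "G = (\<lambda>t. indicator {\<alpha><..<\<beta>} t * g t)"
  have "set_integrable lebesgue {\<alpha><..<\<beta>} g"
    by (rule set_integrable_subset[of _ "{\<alpha>..\<beta>}"]) (use g in \<open>auto simp: L1_loc_def\<close>)
  hence int: "integrable lebesgue G"
    by (simp add: G_def set_integrable_def)
  have *: "(LINT t:{x<..<y}|lebesgue. g t) = 0" if xy: "\<alpha> \<le> x" "y \<le> \<beta>" for x y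
  proof -
    have intxy: "integrable lebesgue (\<lambda>t. indicator {x..y} t * g t)"
      using g unfolding L1_loc_def set_integrable_def by simp
    have gb: "(\<lambda>t. g t * bump n x y t) \<in> borel_measurable lebesgue" for n
      by (rule borel_measurable_integrable[OF integrable_L1_loc_mult[OF g, of _ x y]])
         (auto intro!: test_function_continuous test_function_bump bump_outside)
    have "(\<lambda>n. LINT t|lebesgue. g t * bump n x y t) \<longlonglongrightarrow>
          (LINT t|lebesgue. g t * indicator {x<..<y} t)"
    proof (rule integral_dominated_convergence)
      show "(\<lambda>t. g t * indicator {x<..<y} t) \<in> borel_measurable lebesgue"
        by (rule borel_measurable_LIMSEQ_real[of lebesgue "\<lambda>n t. g t * bump n x y t", OF _ gb])
           (intro tendsto_mult tendsto_const bump_tendsto)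
      show "integrable lebesgue (\<lambda>t. norm (indicator {x..y} t * g t))"
        using intxy by (rule integrable_norm)
      show "AE t in lebesgue. (\<lambda>n. g t * bump n x y t) \<longlonglongrightarrow> g t * indicator {x<..<y} t"
        by (intro always_eventually allI tendsto_mult tendsto_const bump_tendsto)
      show "AE t in lebesgue. norm (g t * bump n x y t) \<le> norm (indicator {x..y} t * g t)" for n
      proof (intro always_eventually allI)
        fix t show "norm (g t * bump n x y t) \<le> norm (indicator {x..y} t * g t)"
          using bump_outside[of t x y n] bump_nonneg[of n x y t] bump_le_1[of n x y t]
          by (cases "t \<in> {x<..<y}") (auto simp: abs_mult mult_left_le)
      qed
    qed (rule gb)
    moreover have "(LINT t|lebesgue. g t * bump n x y t) = 0" for n
      by (rule zero[OF test_function_bump]) (use xy in \<open>auto intro!: bump_outside\<close>)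
    ultimately show ?thesis
      by (simp add: LIMSEQ_const_iff set_lebesgue_integral_def mult.commute)
  qed
  have "AE t in lebesgue. G t = 0"
  proof (rule integral_zero_on_intervals_imp_AE_zero[OF int])
    fix x y
    have "indicator {x<..<y} t *\<^sub>R G t = indicator {max \<alpha> x<..<min \<beta> y} t *\<^sub>R g t" for t
      by (auto simp: G_def indicator_def)
    hence "(LINT t:{x<..<y}|lebesgue. G t) = (LINT t:{max \<alpha> x<..<min \<beta> y}|lebesgue. g t)"
      unfolding set_lebesgue_integral_def by simp
    thus "(LINT t:{x<..<y}|lebesgue. G t) = 0" using * by simp
  next
    show "(LINT t|lebesgue. G t) = 0"
      using *[of \<alpha> \<beta>] by (simp add: G_def set_lebesgue_integral_def)
  qed
  thus ?thesis by (rule AE_mp) (auto simp: G_def indicator_def intro!: always_eventually)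
qed

section \<open>Differential inequalities with countably many exceptional points\<close>

text \<open>A weak singular wave is differentiable only off a countable set, which may even be dense.
  The monotonicity criterion survives: tilt \<open>f\<close> slightly so that derivatives become positive. If
  the value dropped, a level between the end values could be chosen outside the countable image of
  the exceptional set, and at the last point where that level is reached the derivative would have
  to be nonpositive.\<close>

lemma countable_exceptions_nondecreasing:
  fixes f :: "real \<Rightarrow> real"
  assumes "a \<le> b" and cont: "continuous_on {a..b} f" and S: "countable S"
    and deriv: "\<And>t. t \<in> {a<..<b} - S \<Longrightarrow> \<exists>D\<ge>0. (f has_real_derivative D) (at t)"
  shows "f a \<le> f b"
proof (rule ccontr)
  assume "\<not> f a \<le> f b"
  hence less: "f b < f a" by simp
  with \<open>a \<le> b\<close> have ab: "a < b" by (cases "a = b") auto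
  define \<epsilon> where "\<epsilon> = (f a - f b) / (2 * (b - a))"
  have eps: "\<epsilon> > 0" "\<epsilon> * (b - a) = (f a - f b) / 2"
    using less ab by (auto simp: \<epsilon>_def field_simps)
  define g where "g = (\<lambda>t. f t + \<epsilon> * (t - a))"
  have gab: "g b < g a" using less eps by (simp add: g_def)
  have contg: "continuous_on {a..b} g"
    unfolding g_def by (intro continuous_intros cont)
  \<comment> \<open>The level is not attained on \<open>S\<close>, so the derivative exists wherever it is attained.\<close>
  have "uncountable ({g b<..<g a} - g ` S)"
    using gab S uncountable_minus_countable uncountable_open_interval by blast
  then obtain \<gamma> where \<gamma>: "g b < \<gamma>" "\<gamma> < g a" "\<gamma> \<notin> g ` S"
    by (metis Diff_iff countable_empty equals0I greaterThanLessThan_iff)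
  let ?A = "{a..b} \<inter> g -` {\<gamma>..}"
  have "compact ?A"
    using continuous_closed_preimage[OF contg closed_atLeastAtMost closed_atLeast]
    by (meson bounded_closed_interval bounded_subset compact_eq_bounded_closed inf_le1)
  moreover have "a \<in> ?A" using ab \<gamma> by auto
  ultimately obtain c where c: "c \<in> ?A" "\<And>t. t \<in> ?A \<Longrightarrow> t \<le> c"
    using compact_attains_sup[of ?A] by blast
  have cb: "c < b" using c(1) \<gamma>(1) by (cases "c = b") auto
  have gc: "g c = \<gamma>"
  proof (rule ccontr)
    assume "g c \<noteq> \<gamma>"
    hence "\<gamma> < g c" using c(1) by auto
    moreover have "continuous_on {c..b} g"
      using contg by (rule continuous_on_subset) (use c(1) in auto)
    ultimately obtain t where "c \<le> t" "t \<le> b" "g t = \<gamma>"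
      using IVT2'[of g b \<gamma> c] \<gamma>(1) cb by auto
    moreover from this have "t \<in> ?A" using c(1) by auto
    ultimately show False using c(2)[of t] \<open>\<gamma> < g c\<close> by (cases "t = c") auto
  qed
  have ac: "a < c" using c(1) gc \<gamma>(2) by (cases "a = c") auto
  have "c \<in> {a<..<b} - S" using ac cb gc \<gamma>(3) by auto
  then obtain D where "D \<ge> 0" "(f has_real_derivative D) (at c)"
    using deriv by blast
  hence "(g has_real_derivative D + \<epsilon>) (at c)"
    unfolding g_def by (auto intro!: derivative_eq_intros)
  then obtain d where d: "d > 0" "\<And>h. 0 < h \<Longrightarrow> h < d \<Longrightarrow> g c < g (c + h)"
    using DERIV_pos_inc_right[of g "D + \<epsilon>" c] \<open>D \<ge> 0\<close> eps by auto
  define h where "h = min (d / 2) (b - c)"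
  have "0 < h" "h < d" "c + h \<le> b" using d cb by (auto simp: h_def)
  with d(2)[of h] c(2)[of "c + h"] ac gc show False by auto
qed

lemma countable_exceptions_constant:
  fixes f :: "real \<Rightarrow> real"
  assumes "a \<le> b" and cont: "continuous_on {a..b} f" and S: "countable S"
    and deriv: "\<And>t. t \<in> {a<..<b} - S \<Longrightarrow> (f has_real_derivative 0) (at t)"
  shows "f b = f a"
proof (rule antisym)
  show "f a \<le> f b"
    by (rule countable_exceptions_nondecreasing[OF assms(1-3)]) (use deriv in blast)
  have "- f a \<le> - f b"
    by (rule countable_exceptions_nondecreasing[OF assms(1) _ S])
       (use cont deriv DERIV_minus in \<open>fastforce intro: continuous_intros\<close>)+
  thus "f b \<le> f a" by simp
qed

text \<open>Compare \<open>u\<close> with a primitive of \<open>r\<close>. So a continuous function whose derivative agrees off a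
  countable set with a continuous function is continuously differentiable.\<close>

lemma countable_exceptions_DERIV:
  fixes u r :: "real \<Rightarrow> real"
  assumes cont: "continuous_on UNIV u" "continuous_on UNIV r" and S: "countable S"
    and deriv: "\<And>t. t \<in> {a<..<b} - S \<Longrightarrow> (u has_real_derivative r t) (at t)"
    and x: "x \<in> {a<..<b}"
  shows "(u has_real_derivative r x) (at x)"
proof -
  obtain R where R: "\<And>t. (R has_real_derivative r t) (at t)"
    using einterval_antiderivative[of "-\<infinity>" "\<infinity>" r] cont(2)
    by (auto simp: has_real_derivative_iff_has_vector_derivative continuous_on_eq_continuous_at)
  have contR: "continuous_on A R" for A
    by (intro continuous_at_imp_continuous_on ballI DERIV_isCont[OF R])
  have eq: "u t - R t = u a - R a" if "t \<in> {a<..<b}" for t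
  proof (rule countable_exceptions_constant[of a t "\<lambda>t. u t - R t" S])
    show "continuous_on {a..t} (\<lambda>t. u t - R t)"
      by (intro continuous_intros contR continuous_on_subset[OF cont(1)]) auto
    fix s assume "s \<in> {a<..<t} - S"
    hence "(u has_real_derivative r s) (at s)" using deriv that by auto
    from DERIV_diff[OF this R[of s]] show "((\<lambda>t. u t - R t) has_real_derivative 0) (at s)" by simp
  qed (use that S in auto)
  have "((\<lambda>t. R t + (u a - R a)) has_real_derivative r x) (at x)"
    using DERIV_add[OF R[of x] DERIV_const] by simp
  thus ?thesis
    by (rule has_field_derivative_transform_within_open[of _ _ _ "{a<..<b}"])
       (use x eq in \<open>auto simp: algebra_simps\<close>)
qed

text \<open>The function \<open>(y t)\<^sup>2 * exp (- (2 * K * t))\<close> cannot increase.\<close>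

lemma gronwall_countable_exceptions:
  fixes y :: "real \<Rightarrow> real"
  assumes "a \<le> b" and cont: "continuous_on {a..b} y" and S: "countable S"
    and deriv: "\<And>t. t \<in> {a<..<b} - S \<Longrightarrow> \<exists>D. (y has_real_derivative D) (at t) \<and> \<bar>D\<bar> \<le> K * \<bar>y t\<bar>"
    and "y a = 0"
  shows "y b = 0"
proof -
  define f where "f = (\<lambda>t. - ((y t)\<^sup>2 * exp (- (2 * K * t))))"
  have "f a \<le> f b"
  proof (rule countable_exceptions_nondecreasing[OF \<open>a \<le> b\<close> _ S])
    show "continuous_on {a..b} f" unfolding f_def by (intro continuous_intros cont)
    fix t assume "t \<in> {a<..<b} - S"
    then obtain D where D: "(y has_real_derivative D) (at t)" "\<bar>D\<bar> \<le> K * \<bar>y t\<bar>"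
      using deriv by blast
    have "y t * D \<le> \<bar>y t\<bar> * \<bar>D\<bar>" by (metis abs_ge_self abs_mult)
    also have "\<dots> \<le> \<bar>y t\<bar> * (K * \<bar>y t\<bar>)" using D(2) by (intro mult_left_mono) auto
    also have "\<dots> = K * (y t)\<^sup>2" by (simp add: power2_eq_square)
    finally have "0 \<le> 2 * (K * (y t)\<^sup>2 - y t * D) * exp (- (2 * K * t))" by simp
    moreover have "(f has_real_derivative 2 * (K * (y t)\<^sup>2 - y t * D) * exp (- (2 * K * t))) (at t)"
      unfolding f_def by (auto intro!: derivative_eq_intros D(1) simp: algebra_simps power2_eq_square)
    ultimately show "\<exists>D\<ge>0. (f has_real_derivative D) (at t)" by blast
  qed
  thus ?thesis using \<open>y a = 0\<close> by (simp add: f_def mult_le_0_iff)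
qed

lemma gronwall_countable_exceptions_backward:
  fixes y :: "real \<Rightarrow> real"
  assumes "a \<le> b" and cont: "continuous_on {a..b} y" and S: "countable S"
    and deriv: "\<And>t. t \<in> {a<..<b} - S \<Longrightarrow> \<exists>D. (y has_real_derivative D) (at t) \<and> \<bar>D\<bar> \<le> K * \<bar>y t\<bar>"
    and "y b = 0"
  shows "y a = 0"
proof -
  have "(\<lambda>t. y (- t)) (- a) = 0"
  proof (rule gronwall_countable_exceptions[of "- b" "- a" _ "uminus ` S" K])
    show "continuous_on {- b..- a} (\<lambda>t. y (- t))"
      by (rule continuous_on_compose2[OF cont]) (auto intro!: continuous_intros)
    fix t assume "t \<in> {- b<..<- a} - uminus ` S"
    hence "- t \<in> {a<..<b} - S" by (auto simp: image_iff)
    then obtain D where "(y has_real_derivative D) (at (- t))" "\<bar>D\<bar> \<le> K * \<bar>y (- t)\<bar>"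
      using deriv by blast
    moreover from this have "((\<lambda>t. y (- t)) has_real_derivative D * (- 1)) (at t)"
      by (intro DERIV_chain2[where g = uminus]) (auto intro!: derivative_eq_intros)
    ultimately show "\<exists>D. ((\<lambda>t. y (- t)) has_real_derivative D) (at t) \<and> \<bar>D\<bar> \<le> K * \<bar>y (- t)\<bar>"
      by auto
  qed (use assms in auto)
  thus ?thesis by simp
qed

text \<open>For \<open>f a = 0\<close> this is the quotient of \<open>f\<close> by \<open>x - a\<close>, with the removable singularity
  filled in. It is used to split off known zeros without losing analyticity.\<close>

definition divided_diff :: "real \<Rightarrow> (real \<Rightarrow> real) \<Rightarrow> real \<Rightarrow> real" where
  "divided_diff a f x = (if x = a then deriv f a else f x / (x - a))"

lemma divided_diff_eq: "f a = 0 \<Longrightarrow> f x = (x - a) * divided_diff a f x"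
  by (simp add: divided_diff_def)

lemma real_analytic_divided_diff:
  assumes "\<forall>x. real_analytic_at f x" "f a = 0"
  shows "real_analytic_at (divided_diff a f) x"
proof (cases "x = a")
  case True
  thus ?thesis using real_analytic_at_removable[of f a] assms
    unfolding divided_diff_def[abs_def] by blast
next
  case False
  have "real_analytic_at (\<lambda>x. f x / (x - a)) x"
    by (intro real_analytic_at_divide real_analytic_at_diff) (use assms False in auto)
  moreover have "\<forall>\<^sub>F t in nhds x. t \<in> - {a}"
    by (intro eventually_nhds_in_open) (use False in auto)
  hence "\<forall>\<^sub>F t in nhds x. f t / (t - a) = divided_diff a f t"
    by eventually_elim (simp add: divided_diff_def)
  ultimately show ?thesis by (rule real_analytic_at_cong)
qed

lemma real_analytic_DERIV:
  "\<forall>x. real_analytic_at f x \<Longrightarrow> (f has_real_derivative deriv f x) (at x)"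
  by (simp add: real_analytic_at_imp_DERIV)

lemma real_analytic_continuous: "\<forall>x. real_analytic_at f x \<Longrightarrow> continuous_on A f"
  by (intro continuous_at_imp_continuous_on ballI DERIV_isCont[OF real_analytic_DERIV])

lemma deriv_divided_diff:
  assumes "\<forall>x. real_analytic_at f x" "f a = 0"
  shows "deriv (deriv f) a = 2 * deriv (divided_diff a f) a"
proof -
  define q where "q = divided_diff a f"
  have q: "\<forall>x. real_analytic_at q x"
    using real_analytic_divided_diff[OF assms] by (simp add: q_def)
  have fq: "f = (\<lambda>x. (x - a) * q x)"
    using divided_diff_eq[of f a, OF assms(2)] by (auto simp: q_def)
  have "(f has_real_derivative q x + (x - a) * deriv q x) (at x)" for x
    unfolding fq by (auto intro!: derivative_eq_intros real_analytic_DERIV[OF q])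
  hence df: "deriv f = (\<lambda>x. q x + (x - a) * deriv q x)"
    by (auto intro: DERIV_imp_deriv)
  have q': "(deriv q has_real_derivative deriv (deriv q) a) (at a)"
    using q real_analytic_at_deriv real_analytic_at_imp_DERIV by blast
  have "(deriv f has_real_derivative 2 * deriv q a) (at a)"
    unfolding df by (auto intro!: derivative_eq_intros real_analytic_DERIV[OF q] q')
  thus ?thesis by (simp add: DERIV_imp_deriv q_def)
qed

lemma real_analytic_level_gap:
  "\<forall>x. real_analytic_at F x \<Longrightarrow> \<forall>x. real_analytic_at (\<lambda>x. c - F x) x"
  by (intro allI real_analytic_at_diff real_analytic_at_const) auto

lemma deriv_level_gap:
  "\<forall>x. real_analytic_at F x \<Longrightarrow> deriv (\<lambda>x. c - F x) = (\<lambda>x. - deriv F x)"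
  by (rule ext, rule DERIV_imp_deriv) (auto intro!: derivative_eq_intros real_analytic_DERIV)

lemma real_analytic_compose_continuous:
  assumes "\<forall>x. real_analytic_at f x" "continuous_on UNIV u"
  shows "continuous_on UNIV (\<lambda>t. f (u t))"
  by (rule continuous_on_compose2[OF real_analytic_continuous[OF assms(1), of UNIV] assms(2)]) auto

text \<open>With energy level \<open>F 0\<close>, the first integral says that the square of the speed of a wave of
  height \<open>x > 0\<close> is twice the value of this function at \<open>x\<close>.\<close>

definition gap_quotient :: "(real \<Rightarrow> real) \<Rightarrow> real \<Rightarrow> real" where
  "gap_quotient F = divided_diff 0 (\<lambda>x. F 0 - F x)"

lemma gap_quotient_eq: "F 0 - F x = x * gap_quotient F x"
  using divided_diff_eq[of "\<lambda>x. F 0 - F x" 0 x] by (simp add: gap_quotient_def)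

lemma
  assumes F: "\<forall>x. real_analytic_at F x"
  shows real_analytic_gap_quotient: "\<forall>x. real_analytic_at (gap_quotient F) x"
    and gap_quotient_0: "gap_quotient F 0 = - deriv F 0"
    and deriv_gap_quotient_0: "deriv (gap_quotient F) 0 = - deriv (deriv F) 0 / 2"
proof -
  note gap = real_analytic_level_gap[OF F, of "F 0"] and dgap = deriv_level_gap[OF F, of "F 0"]
  show "\<forall>x. real_analytic_at (gap_quotient F) x"
    unfolding gap_quotient_def using real_analytic_divided_diff[OF gap] by simp
  show "gap_quotient F 0 = - deriv F 0"
    by (simp add: gap_quotient_def divided_diff_def dgap)
  have "(deriv F has_real_derivative deriv (deriv F) 0) (at 0)"
    using F real_analytic_at_deriv real_analytic_at_imp_DERIV by blast
  hence "deriv (deriv (\<lambda>x. F 0 - F x)) 0 = - deriv (deriv F) 0"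
    unfolding dgap by (intro DERIV_imp_deriv DERIV_minus)
  thus "deriv (gap_quotient F) 0 = - deriv (deriv F) 0 / 2"
    using deriv_divided_diff[OF gap, of 0] by (simp add: gap_quotient_def)
qed

text \<open>The part of the definition of a singular wave that carries over from the strong and the
  weak case alike; \<open>S\<close> is the set where the derivative need not exist.\<close>

definition energy_solution :: "(real \<Rightarrow> real) \<Rightarrow> real \<Rightarrow> real set \<Rightarrow> (real \<Rightarrow> real) \<Rightarrow> bool" where
  "energy_solution F h S u \<longleftrightarrow> continuous_on UNIV u \<and> countable S \<and>
     (\<forall>t. t \<notin> S \<longrightarrow> (\<exists>D. (u has_real_derivative D) (at t) \<and> u t * D\<^sup>2 / 2 + F (u t) = h))"

lemma countable_dense:
  fixes S :: "real set"
  assumes "countable S" "a < b"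
  obtains t where "t \<in> {a<..<b}" "t \<notin> S"
proof -
  have "uncountable ({a<..<b} - S)"
    using assms uncountable_minus_countable uncountable_open_interval by blast
  then obtain t where "t \<in> {a<..<b} - S"
    by (metis countable_empty equals0I)
  thus ?thesis using that by blast
qed

text \<open>The kinetic term is nonnegative off \<open>S\<close>, and the complement of a countable set is dense.\<close>

lemma energy_solution_bound:
  assumes u: "energy_solution F h S u" and F: "\<forall>x. real_analytic_at F x" and nonneg: "\<And>t. 0 \<le> u t"
  shows "F (u t) \<le> h"
proof (rule ccontr)
  assume "\<not> F (u t) \<le> h"
  hence gt: "h < F (u t)" by simp
  have contF: "continuous_on UNIV (\<lambda>t. F (u t))"
    using u by (intro real_analytic_compose_continuous[OF F]) (simp add: energy_solution_def)
  hence "open ((\<lambda>t. F (u t)) -` {h<..})"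
    by (intro open_vimage) auto
  then obtain e where e: "e > 0" "\<And>s. dist s t < e \<Longrightarrow> h < F (u s)"
    using gt open_dist[of "(\<lambda>t. F (u t)) -` {h<..}"] by (metis greaterThan_iff vimage_eq)
  obtain s where s: "s \<in> {t<..<t + e}" "s \<notin> S"
    using countable_dense[of S t "t + e"] u e by (auto simp: energy_solution_def)
  then obtain D where "u s * D\<^sup>2 / 2 + F (u s) = h"
    using u by (auto simp: energy_solution_def)
  moreover have "0 \<le> u s * D\<^sup>2 / 2" using nonneg by simp
  ultimately show False using e(2)[of s] s by (auto simp: dist_real_def)
qed

text \<open>At a critical point \<open>c\<close> of \<open>F\<close> on the energy level, the energy identity bounds the slope by a
  multiple of the distance \<open>\<bar>u - c\<bar>\<close>, since \<open>F\<close> agrees with \<open>F c\<close> to second order and \<open>u\<close> stays away from zero. By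
  Gronwall the set where \<open>u = c\<close> is open; it is also closed.\<close>

theorem equilibrium_is_isolated:
  assumes u: "energy_solution F (F c) S u" and F: "\<forall>x. real_analytic_at F x"
    and c: "c > 0" "deriv F c = 0" and t0: "u t0 = c"
  shows "u t = c"
proof -
  have contu: "continuous_on A u" for A
    using u by (auto simp: energy_solution_def intro: continuous_on_subset)
  define f where "f = (\<lambda>x. F c - F x)"
  have f: "\<forall>x. real_analytic_at f x" unfolding f_def by (rule real_analytic_level_gap[OF F])
  have df: "deriv f c = 0" by (simp add: f_def deriv_level_gap[OF F] c)
  define q where "q = divided_diff c f"
  have q: "\<forall>x. real_analytic_at q x" "q c = 0"
    using real_analytic_divided_diff[OF f] df by (simp_all add: q_def f_def divided_diff_def)
  define p where "p = divided_diff c q"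
  have p: "\<forall>x. real_analytic_at p x"
    using real_analytic_divided_diff[OF q] by (simp add: p_def)
  have fp: "F c - F x = (x - c)\<^sup>2 * p x" for x
    using divided_diff_eq[of f c x] divided_diff_eq[of q c x] q(2)
    by (simp add: p_def q_def f_def power2_eq_square)
  have "isCont p c" using real_analytic_DERIV[OF p] DERIV_isCont by blast
  then obtain d0 where d0: "d0 > 0" "\<And>x. \<bar>x - c\<bar> < d0 \<Longrightarrow> \<bar>p x - p c\<bar> < 1"
    unfolding continuous_at_eps_delta by (metis dist_real_def zero_less_one)
  define M where "M = \<bar>p c\<bar> + 1"
  define d where "d = min d0 (c / 2)"
  \<comment> \<open>From \<open>u > c / 2\<close> and \<open>u * D\<^sup>2 / 2 \<le> M * (u - c)\<^sup>2\<close> one gets \<open>D\<^sup>2 \<le> 4 * M / c * (u - c)\<^sup>2\<close>.\<close>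
  define K where "K = sqrt (4 * M / c)"
  have d: "d > 0" using d0 c by (simp add: d_def)
  have slope: "\<bar>D\<bar> \<le> K * \<bar>u s - c\<bar>"
    if "\<bar>u s - c\<bar> < d" "u s * D\<^sup>2 / 2 + F (u s) = F c" for s D
  proof -
    have us: "u s > c / 2" using that(1) by (auto simp: d_def abs_if split: if_splits)
    have "\<bar>p (u s)\<bar> \<le> M" using d0(2)[of "u s"] that(1) by (auto simp: M_def d_def)
    hence "(u s - c)\<^sup>2 * p (u s) \<le> (u s - c)\<^sup>2 * M"
      by (intro mult_left_mono) auto
    hence "u s * D\<^sup>2 \<le> 2 * M * (u s - c)\<^sup>2"
      using that(2) fp[of "u s"] by (simp add: field_simps)
    moreover have "c / 2 * D\<^sup>2 \<le> u s * D\<^sup>2"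
      using us by (intro mult_right_mono) auto
    ultimately have "D\<^sup>2 \<le> 4 * M / c * (u s - c)\<^sup>2"
      using c by (simp add: field_simps)
    also have "\<dots> = (K * \<bar>u s - c\<bar>)\<^sup>2"
      using c by (simp add: K_def M_def power_mult_distrib)
    finally have "\<bar>D\<bar> \<le> \<bar>K * \<bar>u s - c\<bar>\<bar>" by (simp add: abs_le_square_iff)
    thus ?thesis using c by (simp add: K_def M_def abs_mult)
  qed
  let ?Z = "{t. u t = c}"
  have "open ?Z"
    unfolding open_dist
  proof
    fix s assume "s \<in> ?Z"
    hence s: "u s = c" by simp
    obtain e where e: "e > 0" "\<And>t. dist t s < e \<Longrightarrow> \<bar>u t - c\<bar> < d"
      using contu[of UNIV] d s unfolding continuous_on_iff by (metis UNIV_I dist_real_def)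
    have bound: "\<exists>D. ((\<lambda>t. u t - c) has_real_derivative D) (at r) \<and> \<bar>D\<bar> \<le> K * \<bar>u r - c\<bar>"
      if r: "r \<notin> S" "dist r s < e" for r
    proof -
      obtain D where D: "(u has_real_derivative D) (at r)" "u r * D\<^sup>2 / 2 + F (u r) = F c"
        using u r(1) unfolding energy_solution_def by blast
      thus ?thesis using slope[OF e(2)[OF r(2)] D(2)] by (auto intro!: derivative_eq_intros exI[of _ D])
    qed
    have "u t = c" if t: "dist t s < e" for t
    proof (cases "s \<le> t")
      case True
      have "u t - c = 0"
      proof (rule gronwall_countable_exceptions[of s t "\<lambda>t. u t - c" S K])
        show "s \<le> t" using True by simp
        show "continuous_on {s..t} (\<lambda>t. u t - c)" by (intro continuous_intros contu)
        show "countable S" using u by (simp add: energy_solution_def)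
        show "\<exists>D. ((\<lambda>t. u t - c) has_real_derivative D) (at r) \<and> \<bar>D\<bar> \<le> K * \<bar>u r - c\<bar>"
          if "r \<in> {s<..<t} - S" for r
          by (rule bound) (use that t in \<open>auto simp: dist_real_def\<close>)
      qed (use s in simp)
      thus ?thesis by simp
    next
      case False
      have "u t - c = 0"
      proof (rule gronwall_countable_exceptions_backward[of t s "\<lambda>t. u t - c" S K])
        show "t \<le> s" using False by simp
        show "continuous_on {t..s} (\<lambda>t. u t - c)" by (intro continuous_intros contu)
        show "countable S" using u by (simp add: energy_solution_def)
        show "\<exists>D. ((\<lambda>t. u t - c) has_real_derivative D) (at r) \<and> \<bar>D\<bar> \<le> K * \<bar>u r - c\<bar>"
          if "r \<in> {t<..<s} - S" for r
          by (rule bound) (use that t in \<open>auto simp: dist_real_def\<close>)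
      qed (use s in simp)
      thus ?thesis by simp
    qed
    thus "\<exists>e>0. \<forall>y. dist y s < e \<longrightarrow> y \<in> ?Z" using e(1) by blast
  qed
  moreover have "closed ?Z"
    using continuous_closed_vimage[of "{c}" u] contu[of UNIV]
    by (auto simp: vimage_def continuous_on_eq_continuous_at)
  ultimately have "?Z = {} \<or> ?Z = UNIV" using clopen[of ?Z] by simp
  moreover have "t0 \<in> ?Z" using t0 by simp
  ultimately have "t \<in> ?Z" by auto
  thus ?thesis by simp
qed

section \<open>The wave profile of an admissible potential\<close>

text \<open>Write \<open>2 * (F 0 - F x) = x\<^sup>2 * (m - x) * k x\<close>. The sign conditions say exactly that the
  analytic cofactor \<open>k\<close> is positive on the closed interval from 0 to \<open>m\<close>: at 0 this is
  \<open>F'' 0 < 0\<close>, and at \<open>m\<close> it is \<open>F' m \<noteq> 0\<close>. The substitution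
  \<open>u = m * (1 - cos \<theta>) / 2\<close> turns the first integral \<open>u'\<^sup>2 = u * (m - u) * k u\<close> into
  \<open>\<theta>' = sqrt (k u)\<close>, an autonomous equation with a positive analytic right-hand side. Its solution is
  the inverse function of an elementary integral. Thus the turning point at the crest
  and the points of contact with zero are regular points in the variable \<open>\<theta>\<close>.\<close>

locale compacton_potential =
  fixes F :: "real \<Rightarrow> real" and m :: real
  assumes analytic: "\<forall>x. real_analytic_at F x"
    and critical: "deriv F 0 = 0" and hyperbolic: "deriv (deriv F) 0 < 0"
    and m_pos: "m > 0" and level: "F m = F 0"
    and below: "\<And>x. x \<in> {0<..<m} \<Longrightarrow> F x < F 0" and regular: "deriv F m \<noteq> 0"
begin

definition cofactor :: "real \<Rightarrow> real" where
  "cofactor x = - 2 * divided_diff m (divided_diff 0 (gap_quotient F)) x"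

lemma cofactor_aux:
  defines "g \<equiv> divided_diff 0 (gap_quotient F)"
  shows "F 0 - F x = x\<^sup>2 * g x" "g x = (m - x) * cofactor x / 2" "g 0 = - deriv (deriv F) 0 / 2"
    "\<forall>x. real_analytic_at cofactor x"
proof -
  have q0: "gap_quotient F 0 = 0" by (simp add: gap_quotient_0[OF analytic] critical)
  have g: "\<forall>x. real_analytic_at g x"
    using real_analytic_divided_diff[OF real_analytic_gap_quotient[OF analytic] q0] by (simp add: g_def)
  show gap: "F 0 - F x = x\<^sup>2 * g x" for x
    using gap_quotient_eq[of F x] divided_diff_eq[of "gap_quotient F" 0 x] q0
    by (simp add: g_def power2_eq_square)
  have gm: "g m = 0"
    using gap[of m] m_pos level by simp
  show "g x = (m - x) * cofactor x / 2"
    using divided_diff_eq[of g m x] gm by (simp add: cofactor_def g_def algebra_simps)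
  show "g 0 = - deriv (deriv F) 0 / 2"
    by (simp add: g_def divided_diff_def deriv_gap_quotient_0[OF analytic])
  show "\<forall>x. real_analytic_at cofactor x"
    unfolding cofactor_def[abs_def]
    using real_analytic_at_mult[OF real_analytic_at_const, of "divided_diff m g" _ "- 2"]
      real_analytic_divided_diff[OF g gm] by (simp add: g_def)
qed

lemma analytic_cofactor: "\<forall>x. real_analytic_at cofactor x"
  by (rule cofactor_aux)

lemma gap_factorisation: "2 * (F 0 - F x) = x\<^sup>2 * (m - x) * cofactor x"
  using cofactor_aux(1,2)[of x] by simp

lemma deriv_F_factor:
  "- 2 * deriv F x = (2 * x * (m - x) - x\<^sup>2) * cofactor x + x\<^sup>2 * (m - x) * deriv cofactor x"
proof -
  have "((\<lambda>x. 2 * (F 0 - F x)) has_real_derivative - 2 * deriv F x) (at x)"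
    by (auto intro!: derivative_eq_intros real_analytic_DERIV[OF analytic])
  moreover have "((\<lambda>x. x\<^sup>2 * (m - x) * cofactor x) has_real_derivative
      (2 * x * (m - x) - x\<^sup>2) * cofactor x + x\<^sup>2 * (m - x) * deriv cofactor x) (at x)"
    by (auto intro!: derivative_eq_intros real_analytic_DERIV[OF analytic_cofactor] simp: algebra_simps power2_eq_square)
  ultimately show ?thesis
    unfolding gap_factorisation by (rule DERIV_unique)
qed

text \<open>In the interior this is the strict inequality \<open>F x < F 0\<close>. At the two ends the value of the
  cofactor is a positive multiple of \<open>- F'' 0\<close> and of \<open>F' m\<close>; the latter is nonzero, and
  nonnegative as a limit from the interior.\<close>

lemma cofactor_pos:
  assumes "x \<in> {0..m}" shows "cofactor x > 0"
proof -
  have inner: "cofactor x > 0" if "x \<in> {0<..<m}" for x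
  proof -
    have "0 < (x\<^sup>2 * (m - x)) * cofactor x"
      using below[OF that] gap_factorisation[of x] by simp
    moreover have "0 < x\<^sup>2 * (m - x)" using that by simp
    ultimately show ?thesis by (simp add: zero_less_mult_iff)
  qed
  consider "x = 0" | "x = m" | "x \<in> {0<..<m}" using assms by force
  thus ?thesis
  proof cases
    case 1
    have "m * cofactor 0 = - deriv (deriv F) 0" using cofactor_aux(2)[of 0] cofactor_aux(3) by simp
    hence "0 < m * cofactor 0" using hyperbolic by simp
    thus ?thesis using 1 m_pos by (simp add: zero_less_mult_iff)
  next
    case 2
    have "cofactor m \<noteq> 0"
      using deriv_F_factor[of m] regular by auto
    moreover have "cofactor m \<ge> 0"
    proof (rule tendsto_lowerbound)
      show "(cofactor \<longlongrightarrow> cofactor m) (at_left m)"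
        using real_analytic_continuous[OF analytic_cofactor, of UNIV]
        by (simp add: continuous_on_eq_continuous_at isCont_def filterlim_at_split)
      show "\<forall>\<^sub>F x in at_left m. 0 \<le> cofactor x"
        using eventually_at_left_real[OF m_pos] by eventually_elim (use inner in fastforce)
    qed simp
    ultimately show ?thesis using 2 by simp
  qed (use inner in auto)
qed

definition height :: "real \<Rightarrow> real" where "height \<theta> = m * (1 - cos \<theta>) / 2"

definition speed :: "real \<Rightarrow> real" where "speed \<theta> = sqrt (cofactor (height \<theta>))"

lemma height_range: "height \<theta> \<in> {0..m}"
proof -
  have "m * (1 - cos \<theta>) \<ge> 0" using m_pos by simp
  moreover have "1 - cos \<theta> \<le> 2" using cos_ge_minus_one[of \<theta>] by simp
  hence "m * (1 - cos \<theta>) \<le> m * 2" using m_pos by (intro mult_left_mono) auto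
  ultimately show ?thesis by (simp add: height_def)
qed

lemma speed_pos: "speed \<theta> > 0"
  using cofactor_pos[OF height_range] by (simp add: speed_def)

lemma speed_sq: "(speed \<theta>)\<^sup>2 = cofactor (height \<theta>)"
  using cofactor_pos[OF height_range, of \<theta>] by (simp add: speed_def)

lemma analytic_height: "real_analytic_at height x"
proof -
  have "real_analytic_at (\<lambda>\<theta>. m / 2 * (1 - cos \<theta>)) x"
    by (intro real_analytic_at_mult real_analytic_at_diff real_analytic_at_const real_analytic_at_cos)
  thus ?thesis by (simp add: height_def[abs_def])
qed

lemma analytic_speed: "real_analytic_at speed x"
  unfolding speed_def[abs_def]
  using cofactor_pos[OF height_range] analytic_cofactor
  by (intro real_analytic_at_compose[OF _ real_analytic_at_sqrt]
      real_analytic_at_compose[OF analytic_height]) auto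

text \<open>The time needed to reach the phase \<open>\<theta>\<close>, that is, the integral of \<open>1 / speed\<close> from 0.\<close>

definition clock :: "real \<Rightarrow> real" where
  "clock = (SOME \<tau>. \<tau> 0 = 0 \<and> (\<forall>\<theta>. (\<tau> has_real_derivative 1 / speed \<theta>) (at \<theta>)))"

lemma clock: "clock 0 = 0" "(clock has_real_derivative 1 / speed \<theta>) (at \<theta>)"
proof -
  have "continuous_on UNIV speed"
    using analytic_speed real_analytic_continuous by blast
  hence "isCont (\<lambda>\<theta>. 1 / speed \<theta>) \<theta>" for \<theta>
    using speed_pos[of \<theta>]
    by (auto simp: continuous_on_eq_continuous_at intro!: continuous_intros)
  then obtain R where R: "\<And>\<theta>. (R has_real_derivative 1 / speed \<theta>) (at \<theta>)"
    using einterval_antiderivative[of "-\<infinity>" "\<infinity>" "\<lambda>\<theta>. 1 / speed \<theta>"]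
    by (auto simp: has_real_derivative_iff_has_vector_derivative)
  have "\<exists>\<tau>. \<tau> 0 = 0 \<and> (\<forall>\<theta>. (\<tau> has_real_derivative 1 / speed \<theta>) (at \<theta>))"
    by (rule exI[of _ "\<lambda>\<theta>. R \<theta> - R 0"]) (auto intro!: derivative_eq_intros R)
  from someI_ex[OF this] show "clock 0 = 0" "(clock has_real_derivative 1 / speed \<theta>) (at \<theta>)"
    unfolding clock_def by blast+
qed

lemma isCont_clock: "isCont clock \<theta>"
  using clock(2) by (rule DERIV_isCont)

lemma clock_strict_mono: "strict_mono clock"
  by (rule strict_monoI, rule DERIV_pos_imp_increasing)
     (use clock(2) speed_pos in \<open>auto intro!: exI\<close>)

text \<open>The speed is even and \<open>2 * pi\<close>-periodic in \<open>\<theta>\<close>. These symmetries of the clock give the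
  symmetry of the wave about its crest.\<close>

lemma clock_minus: "clock (- \<theta>) = - clock \<theta>"
proof -
  have sym: "speed (- \<theta>) = speed \<theta>" for \<theta> by (simp add: speed_def height_def)
  have "((\<lambda>\<theta>. clock \<theta> + clock (- \<theta>)) has_real_derivative 0) (at \<theta>)" for \<theta>
    by (rule DERIV_cong[OF DERIV_add[OF clock(2) DERIV_chain2[OF clock(2) DERIV_minus[OF DERIV_ident]]]])
       (simp add: sym)
  hence "clock \<theta> + clock (- \<theta>) = clock 0 + clock (- 0)"
    using DERIV_isconst_all by blast
  thus ?thesis using clock(1) by simp
qed

definition width :: real where "width = clock (2 * pi)"

lemma clock_shift: "clock (\<theta> + 2 * pi) = clock \<theta> + width"
proof -
  have per: "speed (\<theta> + 2 * pi) = speed \<theta>" for \<theta> by (simp add: speed_def height_def)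
  have "((\<lambda>\<theta>. clock (\<theta> + 2 * pi) - clock \<theta>) has_real_derivative 0) (at \<theta>)" for \<theta>
    by (rule DERIV_cong[OF DERIV_diff[OF DERIV_chain2[OF clock(2) DERIV_add[OF DERIV_ident DERIV_const]] clock(2)]])
       (simp add: per)
  hence "clock (\<theta> + 2 * pi) - clock \<theta> = clock (0 + 2 * pi) - clock 0"
    using DERIV_isconst_all[of "\<lambda>\<theta>. clock (\<theta> + 2 * pi) - clock \<theta>" \<theta> 0] by blast
  thus ?thesis using clock(1) by (simp add: width_def)
qed

lemma clock_reflect: "clock (2 * pi - \<theta>) = width - clock \<theta>"
  using clock_shift[of "- \<theta>"] clock_minus[of \<theta>] by (simp add: algebra_simps)

lemma clock_pi: "clock pi = width / 2"
  using clock_reflect[of pi] by simp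

lemma width_pos: "width > 0"
  using strict_monoD[OF clock_strict_mono, of 0 "2 * pi"] clock(1) by (simp add: width_def)

lemma clock_multiple: "clock (2 * pi * real n) = real n * width"
proof (induction n)
  case (Suc n)
  thus ?case using clock_shift[of "2 * pi * real n"] by (simp add: algebra_simps)
qed (simp add: clock(1))

lemma clock_surj: "\<exists>\<theta>. clock \<theta> = t"
proof -
  obtain n where n: "\<bar>t\<bar> < real n * width"
    using width_pos reals_Archimedean3 by blast
  have "\<exists>\<theta>\<ge>- (2 * pi * real n). \<theta> \<le> 2 * pi * real n \<and> clock \<theta> = t"
    by (rule IVT) (use n clock_multiple[of n] clock_minus[of "2 * pi * real n"] isCont_clock in auto)
  thus ?thesis by blast
qed

definition phase :: "real \<Rightarrow> real" where "phase t = (THE \<theta>. clock \<theta> = t)"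

lemma clock_inj: "clock \<theta> = clock \<theta>' \<longleftrightarrow> \<theta> = \<theta>'"
  using clock_strict_mono strict_mono_eq by blast

lemma clock_phase [simp]: "clock (phase t) = t"
  using clock_surj[of t] clock_inj theI'[of "\<lambda>\<theta>. clock \<theta> = t"] unfolding phase_def by blast

lemma phase_clock [simp]: "phase (clock \<theta>) = \<theta>"
  using clock_phase[of "clock \<theta>"] clock_inj by blast

lemma phase_less: "phase s < phase t \<longleftrightarrow> s < t"
  by (metis clock_phase clock_strict_mono strict_mono_less)

lemma DERIV_phase: "(phase has_real_derivative speed (phase t)) (at t)"
proof -
  have cont: "isCont phase t"
  proof -
    have "isCont phase (clock (phase t))"
      by (rule isCont_inverse_function[of 1]) (auto simp: isCont_clock)
    thus ?thesis by simp
  qed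
  have "(phase has_real_derivative inverse (1 / speed (phase t))) (at t)"
    by (rule DERIV_inverse_function[where f = clock and a = "t - 1" and b = "t + 1"])
       (use clock(2) speed_pos[of "phase t"] cont in auto)
  thus ?thesis by simp
qed

lemma analytic_phase: "real_analytic_at phase t"
proof -
  have "real_analytic_at clock (phase t)"
  proof (rule real_analytic_at_primitive)
    show "real_analytic_at (\<lambda>\<theta>. 1 / speed \<theta>) (phase t)"
      using speed_pos[of "phase t"]
      by (intro real_analytic_at_divide analytic_speed real_analytic_at_const) auto
  qed (use clock(2) in auto)
  moreover have "deriv clock (phase t) \<noteq> 0"
    using DERIV_imp_deriv[OF clock(2)] speed_pos[of "phase t"] by simp
  ultimately have "real_analytic_at phase (clock (phase t))"
    by (rule real_analytic_at_inverse_function) (use DERIV_isCont[OF DERIV_phase] in auto)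
  thus ?thesis by simp
qed

definition profile :: "real \<Rightarrow> real" where "profile t = height (phase t)"

definition slope :: "real \<Rightarrow> real" where "slope t = m / 2 * sin (phase t) * speed (phase t)"

lemma analytic_profile: "real_analytic_at profile t"
  unfolding profile_def[abs_def] by (rule real_analytic_at_compose[OF analytic_phase analytic_height])

lemma DERIV_height: "(height has_real_derivative m / 2 * sin \<theta>) (at \<theta>)"
  unfolding height_def[abs_def] by (auto intro!: derivative_eq_intros)

lemma DERIV_profile: "(profile has_real_derivative slope t) (at t)"
  unfolding profile_def[abs_def] slope_def by (rule DERIV_chain2[OF DERIV_height DERIV_phase])

lemma profile_gap: "profile t * (m - profile t) = (m / 2 * sin (phase t))\<^sup>2"
proof -
  have "profile t * (m - profile t) = (m / 2)\<^sup>2 * (1 - (cos (phase t))\<^sup>2)"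
    by (simp add: profile_def height_def field_simps power2_eq_square)
  also have "\<dots> = (m / 2 * sin (phase t))\<^sup>2"
    by (simp only: sin_squared_eq power_mult_distrib)
  finally show ?thesis .
qed

lemma slope_sq: "(slope t)\<^sup>2 = profile t * (m - profile t) * cofactor (profile t)"
proof -
  have c: "cofactor (profile t) = (speed (phase t))\<^sup>2" by (simp add: speed_sq profile_def)
  show ?thesis unfolding slope_def by (simp only: c profile_gap power_mult_distrib)
qed

lemma profile_energy: "profile t * (slope t)\<^sup>2 / 2 + F (profile t) = F 0"
proof -
  have "profile t * (slope t)\<^sup>2 = 2 * (F 0 - F (profile t))"
    unfolding gap_factorisation slope_sq by (simp add: power2_eq_square)
  thus ?thesis by (simp add: field_simps)
qed

lemma DERIV_slope:
  "(slope has_real_derivative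
     (((m - 2 * profile t) * cofactor (profile t) + profile t * (m - profile t) * deriv cofactor (profile t)) / 2)) (at t)"
proof -
  let ?\<theta> = "phase t"
  have d: "((\<lambda>\<theta>. cofactor (height \<theta>)) has_real_derivative
      deriv cofactor (height ?\<theta>) * (m / 2 * sin ?\<theta>)) (at ?\<theta>)"
    by (rule DERIV_chain2[OF real_analytic_DERIV[OF analytic_cofactor] DERIV_height])
  have "(speed has_real_derivative
      inverse (sqrt (cofactor (height ?\<theta>))) / 2 * (deriv cofactor (height ?\<theta>) * (m / 2 * sin ?\<theta>))) (at ?\<theta>)"
    unfolding speed_def[abs_def]
    by (rule DERIV_chain2[OF DERIV_real_sqrt d]) (rule cofactor_pos[OF height_range])
  hence sp: "((\<lambda>t. speed (phase t)) has_real_derivative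
      inverse (speed ?\<theta>) / 2 * (deriv cofactor (height ?\<theta>) * (m / 2 * sin ?\<theta>)) * speed ?\<theta>) (at t)"
    unfolding speed_def[symmetric] by (rule DERIV_chain2[OF _ DERIV_phase])
  have sn: "((\<lambda>t. m / 2 * sin (phase t)) has_real_derivative m / 2 * (cos ?\<theta> * speed ?\<theta>)) (at t)"
    by (intro DERIV_cmult DERIV_chain2[OF DERIV_sin DERIV_phase])
  have eq: "m / 2 * (cos ?\<theta> * speed ?\<theta>) * speed ?\<theta> +
      inverse (speed ?\<theta>) / 2 * (deriv cofactor (height ?\<theta>) * (m / 2 * sin ?\<theta>)) * speed ?\<theta> * (m / 2 * sin ?\<theta>) =
      ((m - 2 * profile t) * cofactor (profile t) + profile t * (m - profile t) * deriv cofactor (profile t)) / 2"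
  proof -
    have 1: "m - 2 * profile t = m * cos ?\<theta>" by (simp add: profile_def height_def field_simps)
    note 2 = profile_gap[of t]
    have 3: "speed ?\<theta> * speed ?\<theta> = cofactor (profile t)"
      using speed_sq[of ?\<theta>] by (simp add: power2_eq_square profile_def)
    have 4: "inverse (speed ?\<theta>) * speed ?\<theta> = 1" using speed_pos[of ?\<theta>] by simp
    have a: "m / 2 * (cos ?\<theta> * speed ?\<theta>) * speed ?\<theta> = m * cos ?\<theta> * (speed ?\<theta> * speed ?\<theta>) / 2"
      by simp
    have b: "inverse (speed ?\<theta>) / 2 * (deriv cofactor (height ?\<theta>) * (m / 2 * sin ?\<theta>)) * speed ?\<theta> * (m / 2 * sin ?\<theta>)
       = (inverse (speed ?\<theta>) * speed ?\<theta>) * ((m / 2 * sin ?\<theta>)\<^sup>2 * deriv cofactor (profile t)) / 2"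
      by (simp add: power2_eq_square profile_def mult_ac)
    show ?thesis by (simp only: a b 1 2 3 4 mult_1_left add_divide_distrib)
  qed
  show ?thesis
    unfolding slope_def[abs_def] by (rule DERIV_cong[OF DERIV_mult[OF sn sp] eq])
qed

text \<open>This is \<open>(u\<^sup>2)'' = u'\<^sup>2 - 2 * F' u\<close>, the equation of the wave in divergence form. It follows
  from \<open>u'\<^sup>2 = P u\<close> and \<open>u'' = P' u / 2\<close> with \<open>P x = x * (m - x) * k x\<close>, after differentiating
  \<open>x * P x = 2 * (F 0 - F x)\<close>.\<close>

lemma DERIV_momentum:
  "((\<lambda>t. 2 * profile t * slope t) has_real_derivative (slope t)\<^sup>2 - 2 * deriv F (profile t)) (at t)"
proof -
  let ?y = "profile t"
  let ?s' = "((m - 2 * ?y) * cofactor ?y + ?y * (m - ?y) * deriv cofactor ?y) / 2"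
  have "((\<lambda>t. 2 * profile t * slope t) has_real_derivative 2 * slope t * slope t + 2 * ?y * ?s') (at t)"
    by (rule DERIV_cong[OF DERIV_mult[OF DERIV_cmult[OF DERIV_profile] DERIV_slope]]) simp
  moreover have "2 * slope t * slope t + 2 * ?y * ?s' = (slope t)\<^sup>2 - 2 * deriv F ?y"
  proof -
    have "2 * slope t * slope t = (slope t)\<^sup>2 + ?y * (m - ?y) * cofactor ?y"
      using slope_sq[of t] by (simp add: power2_eq_square)
    moreover have "2 * ?y * ?s' = ?y * ((m - 2 * ?y) * cofactor ?y + ?y * (m - ?y) * deriv cofactor ?y)"
      by simp
    ultimately show ?thesis using deriv_F_factor[of ?y]
      by (simp add: power2_eq_square algebra_simps)
  qed
  ultimately show ?thesis by (simp only:)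
qed

lemma phase_0: "phase 0 = 0" using phase_clock[of 0] clock(1) by simp
lemma phase_width: "phase width = 2 * pi" by (simp add: width_def)
lemma phase_half: "phase (width / 2) = pi" using phase_clock[of pi] clock_pi by simp

lemma phase_reflect: "phase (width - t) = 2 * pi - phase t"
  using clock_reflect[of "phase t"] by (metis clock_phase phase_clock)

lemma profile_ends: "profile 0 = 0" "profile width = 0" "slope 0 = 0" "slope width = 0"
  by (simp_all add: profile_def height_def slope_def phase_0 phase_width)

lemma profile_half: "profile (width / 2) = m"
  by (simp add: profile_def height_def phase_half)

lemma profile_reflect: "profile (width - t) = profile t"
  by (simp add: profile_def height_def phase_reflect)

lemma profile_range: "profile t \<in> {0..m}"
  unfolding profile_def by (rule height_range)

lemma profile_increasing:
  assumes "0 \<le> s" "s < t" "t \<le> width / 2"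
  shows "profile s < profile t"
proof -
  have "0 \<le> phase s" "phase s < phase t" "phase t \<le> pi"
    using phase_0 phase_less[of s 0] phase_less[of s t] phase_less[of "width / 2" t] phase_half assms by auto
  hence "cos (phase t) < cos (phase s)" by (intro cos_monotone_0_pi) auto
  thus ?thesis using m_pos by (simp add: profile_def height_def)
qed

lemma profile_decreasing:
  assumes "width / 2 \<le> s" "s < t" "t \<le> width"
  shows "profile t < profile s"
  using profile_increasing[of "width - t" "width - s"] assms by (simp add: profile_reflect)

lemma profile_pos:
  assumes "0 < t" "t < width" shows "0 < profile t"
proof (cases "t \<le> width / 2")
  case True
  thus ?thesis using profile_increasing[of 0 t] assms profile_ends by simp
next
  case False
  thus ?thesis using profile_decreasing[of t width] assms profile_ends by simp
qed

lemma profile_less_m: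
  assumes "0 \<le> t" "t \<le> width" "t \<noteq> width / 2" shows "profile t < m"
  using profile_increasing[of t "width / 2"] profile_decreasing[of "width / 2" t] assms profile_half
  by (cases "t < width / 2") auto

text \<open>The phase \<open>arccos (1 - 2 * w / m)\<close> of a rising solution moves with the prescribed speed off a
  countable set, so the clock of the phase advances at unit rate. This fixes both the solution and
  the time it takes to rise.\<close>

theorem rising_solution_is_profile:
  assumes "a < b" and cont: "continuous_on {a..b} w" and S: "countable S"
    and ends: "w a = 0" "w b = m" and range: "\<And>t. t \<in> {a<..<b} \<Longrightarrow> w t \<in> {0<..<m}"
    and sol: "\<And>t. t \<in> {a<..<b} - S \<Longrightarrow>
        \<exists>D\<ge>0. (w has_real_derivative D) (at t) \<and> w t * D\<^sup>2 / 2 + F (w t) = F 0"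
  shows "b - a = width / 2" "\<And>t. t \<in> {a..b} \<Longrightarrow> w t = profile (t - a)"
proof -
  \<comment> \<open>The phase of \<open>w\<close> on the rising branch.\<close>
  define \<phi> where "\<phi> = (\<lambda>t. arccos (1 - 2 * w t / m))"
  have rng: "0 \<le> w t" "w t \<le> m" if "t \<in> {a..b}" for t
    using that range[of t] ends m_pos by (cases "t = a"; cases "t = b"; force)+
  have arg: "- 1 \<le> 1 - 2 * w t / m" "1 - 2 * w t / m \<le> 1" if "t \<in> {a..b}" for t
    using rng[OF that] m_pos by (auto simp: field_simps)
  have height_phi: "height (\<phi> t) = w t" if "t \<in> {a..b}" for t
    using arg[OF that] m_pos by (simp add: height_def \<phi>_def cos_arccos field_simps)
  have cont_phi: "continuous_on {a..b} \<phi>"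
    unfolding \<phi>_def by (intro continuous_on_arccos continuous_intros cont) (use arg m_pos in auto)
  have "clock (\<phi> t) - t = clock (\<phi> a) - a" if t: "t \<in> {a..b}" for t
  proof (rule countable_exceptions_constant[of a t "\<lambda>t. clock (\<phi> t) - t" S])
    have "continuous_on {a..t} \<phi>"
      by (rule continuous_on_subset[OF cont_phi]) (use t in auto)
    moreover have "continuous_on UNIV clock"
      by (simp add: continuous_at_imp_continuous_on isCont_clock)
    ultimately have "continuous_on {a..t} (\<lambda>t. clock (\<phi> t))"
      by (metis continuous_on_compose2 subset_UNIV)
    thus "continuous_on {a..t} (\<lambda>t. clock (\<phi> t) - t)"
      by (intro continuous_intros)
    fix s assume "s \<in> {a<..<t} - S"
    hence s: "s \<in> {a<..<b} - S" using t by auto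
    then obtain D where D: "D \<ge> 0" "(w has_real_derivative D) (at s)" "w s * D\<^sup>2 / 2 + F (w s) = F 0"
      using sol by blast
    define z where "z = 1 - 2 * w s / m"
    have ws: "0 < w s" "w s < m" using range[of s] s by auto
    have z: "- 1 < z" "z < 1" using ws m_pos by (auto simp: z_def field_simps)
    have one: "1 - z\<^sup>2 = 4 * (w s * (m - w s)) / m\<^sup>2"
      using m_pos by (simp add: z_def field_simps power2_eq_square)
    have "w s * D\<^sup>2 = w s * (w s * (m - w s) * cofactor (w s))"
      using D(3) gap_factorisation[of "w s"] by (simp add: power2_eq_square algebra_simps)
    hence Dsq: "D\<^sup>2 = w s * (m - w s) * cofactor (w s)" using ws by simp
    have "(\<phi> has_real_derivative inverse (- sqrt (1 - z\<^sup>2)) * (- (2 * D / m))) (at s)"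
      unfolding \<phi>_def
    proof (rule DERIV_chain2[where f = arccos and g = "\<lambda>t. 1 - 2 * w t / m"])
      show "(arccos has_real_derivative inverse (- sqrt (1 - z\<^sup>2))) (at (1 - 2 * w s / m))"
        using DERIV_arccos[OF z] by (simp add: z_def)
      show "((\<lambda>t. 1 - 2 * w t / m) has_real_derivative - (2 * D / m)) (at s)"
        using m_pos by (auto intro!: derivative_eq_intros D(2))
    qed
    moreover have "inverse (- sqrt (1 - z\<^sup>2)) * (- (2 * D / m)) = speed (\<phi> s)"
    proof (rule power2_eq_imp_eq)
      have "1 - z\<^sup>2 > 0" using one ws m_pos by simp
      hence sq: "(sqrt (1 - z\<^sup>2))\<^sup>2 = 1 - z\<^sup>2" by simp
      have "(inverse (- sqrt (1 - z\<^sup>2)) * (- (2 * D / m)))\<^sup>2 = (4 * D\<^sup>2 / m\<^sup>2) / (1 - z\<^sup>2)"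
        by (simp add: power_mult_distrib power_divide power_inverse sq divide_inverse)
      also have "\<dots> = cofactor (w s)"
        unfolding one Dsq using ws m_pos by simp
      finally show "(inverse (- sqrt (1 - z\<^sup>2)) * (- (2 * D / m)))\<^sup>2 = (speed (\<phi> s))\<^sup>2"
        using speed_sq[of "\<phi> s"] height_phi[of s] s by simp
      show "0 \<le> inverse (- sqrt (1 - z\<^sup>2)) * (- (2 * D / m))"
        using D(1) m_pos \<open>1 - z\<^sup>2 > 0\<close> by simp
      show "0 \<le> speed (\<phi> s)" using speed_pos[of "\<phi> s"] by simp
    qed
    ultimately have "(\<phi> has_real_derivative speed (\<phi> s)) (at s)" by simp
    from DERIV_diff[OF DERIV_chain2[OF clock(2) this] DERIV_ident]
    show "((\<lambda>t. clock (\<phi> t) - t) has_real_derivative 0) (at s)"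
      using speed_pos[of "\<phi> s"] by simp
  qed (use t S in auto)
  moreover have "\<phi> a = 0" using ends by (simp add: \<phi>_def)
  ultimately have time: "clock (\<phi> t) = t - a" if "t \<in> {a..b}" for t
    using that clock(1) by fastforce
  have "\<phi> b = pi" using ends m_pos by (simp add: \<phi>_def)
  thus "b - a = width / 2" using time[of b] clock_pi \<open>a < b\<close> by simp
  fix t assume t: "t \<in> {a..b}"
  hence "phase (t - a) = \<phi> t" using time by (metis phase_clock)
  thus "w t = profile (t - a)" using height_phi[OF t] by (simp add: profile_def)
qed

end

section \<open>From classical to distributional solutions\<close>

lemma has_bochner_integral_compact_FTC:
  fixes f :: "real \<Rightarrow> real"
  assumes deriv: "\<And>t. (f has_real_derivative f' t) (at t)" and cont: "continuous_on UNIV f'"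
    and zero: "\<And>t. t \<notin> {a..b} \<Longrightarrow> f t = 0"
  shows "has_bochner_integral lebesgue f' 0"
proof -
  have zero': "f' t = 0" if "t \<notin> {a..b}" for t
    using deriv_eq_0_outside[of a b f t] zero that DERIV_imp_deriv[OF deriv] by metis
  define c d where "c = min a b - 1" and "d = max a b + 1"
  have cd: "c \<le> d" "f c = 0" "f d = 0" by (auto simp: c_def d_def intro!: zero)
  have "has_bochner_integral lborel (\<lambda>t. f' t * indicator {c..d} t) (f d - f c)"
    by (rule has_bochner_integral_FTC_Icc_real)
       (use cd deriv cont in \<open>auto simp: continuous_on_eq_continuous_at\<close>)
  also have "(\<lambda>t. f' t * indicator {c..d} t) = f'"
  proof
    fix t show "f' t * indicator {c..d} t = f' t"
      using zero'[of t] by (cases "t \<in> {a..b}") (auto simp: indicator_def c_def d_def)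
  qed
  finally have "has_bochner_integral lborel f' 0" using cd by simp
  moreover have "f' \<in> borel_measurable lborel"
    using borel_measurable_continuous_onI[OF cont] by simp
  ultimately show ?thesis
    by (simp add: has_bochner_integral_iff integrable_completion integral_completion)
qed

lemma L2_loc_continuous:
  assumes "continuous_on UNIV f" shows "L2_loc f"
  unfolding L2_loc_def
proof (intro conjI allI)
  show "f \<in> borel_measurable lebesgue"
    using borel_measurable_continuous_onI[OF assms] by (intro measurable_completion) simp
  show "set_integrable lebesgue {a..b} (\<lambda>t. (f t)\<^sup>2)" for a b
    by (intro continuous_set_integrable_lebesgue continuous_intros assms)
qed

lemma test_function_support:
  assumes "test_function \<phi>"
  obtains a b where "\<And>t. t \<notin> {a..b} \<Longrightarrow> \<phi> t = 0" "\<And>t. t \<notin> {a..b} \<Longrightarrow> deriv \<phi> t = 0"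
    "\<And>t. t \<notin> {a..b} \<Longrightarrow> deriv (deriv \<phi>) t = 0"
proof -
  obtain a b where ab: "\<And>t. t \<notin> {a..b} \<Longrightarrow> \<phi> t = 0"
    using assms unfolding test_function_def by blast
  have "\<And>t. t \<notin> {a..b} \<Longrightarrow> deriv \<phi> t = 0"
    using deriv_eq_0_outside[of a b \<phi>] ab by blast
  moreover from this have "\<And>t. t \<notin> {a..b} \<Longrightarrow> deriv (deriv \<phi>) t = 0"
    using deriv_eq_0_outside[of a b "deriv \<phi>"] by blast
  ultimately show ?thesis using that ab by blast
qed

lemma has_bochner_integral_by_parts:
  fixes f :: "real \<Rightarrow> real"
  assumes deriv: "\<And>t. (f has_real_derivative f' t) (at t)" and cont: "continuous_on UNIV f'"
    and \<phi>: "test_function \<phi>"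
  shows "has_bochner_integral lebesgue (\<lambda>t. f t * deriv \<phi> t + f' t * \<phi> t) 0"
proof -
  obtain a b where ab: "\<And>t. t \<notin> {a..b} \<Longrightarrow> \<phi> t = 0"
    using test_function_support[OF \<phi>] by metis
  have contf: "continuous_on UNIV f"
    by (intro continuous_at_imp_continuous_on ballI DERIV_isCont[OF deriv])
  show ?thesis
  proof (rule has_bochner_integral_compact_FTC[where f = "\<lambda>t. f t * \<phi> t" and a = a and b = b])
    show "((\<lambda>t. f t * \<phi> t) has_real_derivative f t * deriv \<phi> t + f' t * \<phi> t) (at t)" for t
      by (rule DERIV_cong[OF DERIV_mult[OF deriv test_function_DERIV(1)[OF \<phi>]]]) (simp add: algebra_simps)
    show "continuous_on UNIV (\<lambda>t. f t * deriv \<phi> t + f' t * \<phi> t)"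
      by (intro continuous_intros contf cont test_function_continuous test_function_deriv \<phi>)
  qed (use ab in auto)
qed

lemma C1_has_weak_derivative:
  fixes f :: "real \<Rightarrow> real"
  assumes deriv: "\<And>t. (f has_real_derivative f' t) (at t)" and cont: "continuous_on UNIV f'"
  shows "has_weak_derivative f f'"
  unfolding has_weak_derivative_def
proof (intro conjI allI impI)
  have contf: "continuous_on UNIV f"
    by (intro continuous_at_imp_continuous_on ballI DERIV_isCont[OF deriv])
  show L: "L1_loc f" "L1_loc f'" using contf cont by (auto intro: L1_loc_continuous)
  fix \<phi> assume \<phi>: "test_function \<phi>"
  obtain a b where ab: "\<And>t. t \<notin> {a..b} \<Longrightarrow> \<phi> t = 0" "\<And>t. t \<notin> {a..b} \<Longrightarrow> deriv \<phi> t = 0"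
    using test_function_support[OF \<phi>] by metis
  have int: "integrable lebesgue (\<lambda>t. f t * deriv \<phi> t)" "integrable lebesgue (\<lambda>t. f' t * \<phi> t)"
    using integrable_L1_loc_mult[OF L(1), of "deriv \<phi>" a b] integrable_L1_loc_mult[OF L(2), of \<phi> a b]
      test_function_continuous[OF \<phi>, of UNIV] test_function_continuous[OF test_function_deriv[OF \<phi>], of UNIV] ab
    by blast+
  have "(LINT t|lebesgue. f t * deriv \<phi> t + f' t * \<phi> t) = 0"
    using has_bochner_integral_by_parts[OF deriv cont \<phi>] by (simp add: has_bochner_integral_iff)
  thus "(LINT t|lebesgue. f t * deriv \<phi> t) = - (LINT t|lebesgue. f' t * \<phi> t)"
    using int by simp
qed

text \<open>The divergence form makes the integrand of the weak equation the derivative of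
  \<open>2 * u * u' * \<phi>\<close>, which has compact support. No second derivative of \<open>u\<close> enters, so the jump of
  \<open>u''\<close> at the edge of a bump is harmless.\<close>

theorem C1_momentum_balance_imp_TWS:
  assumes F: "\<forall>x. real_analytic_at F x"
    and u: "\<And>t. (u has_real_derivative u' t) (at t)" "continuous_on UNIV u'"
    and momentum: "\<And>t. ((\<lambda>t. 2 * u t * u' t) has_real_derivative (u' t)\<^sup>2 - 2 * deriv F (u t)) (at t)"
    and range: "\<And>t. 0 \<le> u t" "\<And>t. u t \<le> B"
  shows "TWS F u"
proof -
  let ?w = "\<lambda>t. 2 * u t * u' t"
  have contu: "continuous_on UNIV u"
    by (intro continuous_at_imp_continuous_on ballI DERIV_isCont[OF u(1)])
  have F': "\<forall>x. real_analytic_at (deriv F) x"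
    using F real_analytic_at_deriv by blast
  note contF = real_analytic_compose_continuous[OF F' contu]
  have bdd: "bounded (range u)"
    unfolding bounded_iff using range by (intro exI[of _ B]) auto
  have weak: "has_weak_derivative u u'" "has_weak_derivative (\<lambda>t. (u t)\<^sup>2) ?w"
  proof -
    show "has_weak_derivative u u'" by (rule C1_has_weak_derivative[OF u])
    have "((\<lambda>t. (u t)\<^sup>2) has_real_derivative ?w t) (at t)" for t
      by (auto intro!: derivative_eq_intros u(1))
    moreover have "continuous_on UNIV ?w"
      by (intro continuous_intros contu u(2))
    ultimately show "has_weak_derivative (\<lambda>t. (u t)\<^sup>2) ?w"
      by (rule C1_has_weak_derivative)
  qed
  have "has_bochner_integral lebesgue
      (\<lambda>t. ?w t * deriv \<phi> t + (u' t)\<^sup>2 * \<phi> t - 2 * deriv F (u t) * \<phi> t) 0"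
    if "test_function \<phi>" for \<phi>
  proof -
    have "continuous_on UNIV (\<lambda>t. (u' t)\<^sup>2 - 2 * deriv F (u t))"
      by (intro continuous_intros contF u(2))
    from has_bochner_integral_by_parts[OF momentum this that]
    show ?thesis by (simp add: algebra_simps)
  qed
  hence "\<exists>v w. has_weak_derivative u v \<and> L2_loc v \<and> has_weak_derivative (\<lambda>t. (u t)\<^sup>2) w \<and>
        (\<forall>\<phi>. test_function \<phi> \<longrightarrow> has_bochner_integral lebesgue
             (\<lambda>t. w t * deriv \<phi> t + (v t)\<^sup>2 * \<phi> t - 2 * deriv F (u t) * \<phi> t) 0)"
    using weak L2_loc_continuous[OF u(2)] by blast
  thus ?thesis
    unfolding TWS_def using range(1) bdd L2_loc_continuous[OF contu] by blast
qed

section \<open>Trains of bumps\<close>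

definition separated :: "real \<Rightarrow> real set \<Rightarrow> bool" where
  "separated T A \<longleftrightarrow> (\<forall>s\<in>A. \<forall>s'\<in>A. s \<noteq> s' \<longrightarrow> T \<le> \<bar>s - s'\<bar>)"

text \<open>Copies of the graph of \<open>f\<close> over the interval from 0 to \<open>T\<close>, started at the points of \<open>A\<close>
  and zero elsewhere. For separated starting points the sum has at most one term.\<close>

definition train :: "real \<Rightarrow> real set \<Rightarrow> (real \<Rightarrow> real) \<Rightarrow> real \<Rightarrow> real" where
  "train T A f t = (\<Sum>s\<in>{s \<in> A. t \<in> {s<..<s + T}}. f (t - s))"

lemma train_inside:
  assumes "separated T A" "s \<in> A" "t \<in> {s<..<s + T}"
  shows "train T A f t = f (t - s)"
proof -
  have "{s \<in> A. t \<in> {s<..<s + T}} = {s}"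
    using assms unfolding separated_def by fastforce
  thus ?thesis by (simp add: train_def)
qed

lemma train_outside: "\<forall>s\<in>A. t \<notin> {s<..<s + T} \<Longrightarrow> train T A f t = 0"
  unfolding train_def by (rule sum.neutral) auto

lemma train_combine:
  assumes "separated T A" "h 0 0 = 0"
  shows "train T A (\<lambda>x. h (f x) (g x)) t = h (train T A f t) (train T A g t)"
  using train_inside[OF assms(1)] train_outside[of A t T] assms(2)
  by (cases "\<forall>s\<in>A. t \<notin> {s<..<s + T}") fastforce+

lemma DERIV_zero_bound:
  fixes f :: "real \<Rightarrow> real"
  assumes "(f has_real_derivative 0) (at x)" "f x = 0" "\<epsilon> > 0"
  obtains \<delta> where "\<delta> > 0" "\<And>y. \<bar>y - x\<bar> < \<delta> \<Longrightarrow> \<bar>f y\<bar> \<le> \<epsilon> * \<bar>y - x\<bar>"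
proof -
  have "((\<lambda>h. f (x + h) / h) \<longlongrightarrow> 0) (at 0)"
    using assms(1,2) by (simp add: DERIV_def)
  then obtain \<delta> where d: "\<delta> > 0" "\<And>h. h \<noteq> 0 \<Longrightarrow> \<bar>h\<bar> < \<delta> \<Longrightarrow> \<bar>f (x + h) / h\<bar> < \<epsilon>"
    using assms(3) unfolding LIM_def dist_real_def by (metis diff_zero)
  have "\<bar>f y\<bar> \<le> \<epsilon> * \<bar>y - x\<bar>" if "\<bar>y - x\<bar> < \<delta>" for y
  proof (cases "y = x")
    case False
    thus ?thesis using d(2)[of "y - x"] that by (simp add: pos_divide_less_eq)
  qed (simp add: assms(2))
  thus ?thesis using d(1) that by blast
qed

text \<open>A point inside a bump is at least as close to one end of that bump as it is to any point
  outside the bumps. So near a point of rest the train is controlled by the behaviour of \<open>f\<close> at its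
  two ends, uniformly over the bumps.\<close>

lemma train_near_rest:
  assumes sep: "separated T A" and rest: "\<forall>s\<in>A. t \<notin> {s<..<s + T}" and "f 0 = 0"
  obtains x where "train T A f y = f x" "\<bar>x\<bar> \<le> \<bar>y - t\<bar> \<or> \<bar>x - T\<bar> \<le> \<bar>y - t\<bar>"
proof (cases "\<forall>s\<in>A. y \<notin> {s<..<s + T}")
  case True
  thus ?thesis using that[of 0] train_outside[OF True] \<open>f 0 = 0\<close> by simp
next
  case False
  then obtain s where s: "s \<in> A" "y \<in> {s<..<s + T}" by blast
  hence "t \<le> s \<or> s + T \<le> t" using rest by auto
  hence "\<bar>y - s\<bar> \<le> \<bar>y - t\<bar> \<or> \<bar>y - s - T\<bar> \<le> \<bar>y - t\<bar>" using s(2) by auto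
  thus ?thesis using that[of "y - s"] train_inside[OF sep s] by simp
qed

lemma train_DERIV:
  assumes sep: "separated T A"
    and deriv: "\<And>x. (f has_real_derivative f' x) (at x)"
    and ends: "f 0 = 0" "f T = 0" "f' 0 = 0" "f' T = 0"
  shows "(train T A f has_real_derivative train T A f' t) (at t)"
proof (cases "\<forall>s\<in>A. t \<notin> {s<..<s + T}")
  case False
  then obtain s where s: "s \<in> A" "t \<in> {s<..<s + T}" by blast
  have "((\<lambda>t. f (t - s)) has_real_derivative f' (t - s)) (at t)"
    using DERIV_chain2[OF deriv DERIV_diff[OF DERIV_ident DERIV_const]] by simp
  hence "(train T A f has_real_derivative f' (t - s)) (at t)"
    by (rule has_field_derivative_transform_within_open[of _ _ _ "{s<..<s + T}"])
       (use s train_inside[OF sep] in auto)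
  thus ?thesis using train_inside[OF sep s] by simp
next
  case True
  have "((\<lambda>h. train T A f (t + h) / h) \<longlongrightarrow> 0) (at 0)"
  proof (rule LIM_I)
    fix r :: real assume "r > 0"
    define \<epsilon> where "\<epsilon> = r / 2"
    have eps: "0 < \<epsilon>" "\<epsilon> < r" using \<open>r > 0\<close> by (auto simp: \<epsilon>_def)
    obtain \<delta>1 where d1: "\<delta>1 > 0" "\<And>y. \<bar>y - 0\<bar> < \<delta>1 \<Longrightarrow> \<bar>f y\<bar> \<le> \<epsilon> * \<bar>y - 0\<bar>"
      using DERIV_zero_bound[of f 0 \<epsilon>] deriv[of 0] ends eps by auto
    obtain \<delta>2 where d2: "\<delta>2 > 0" "\<And>y. \<bar>y - T\<bar> < \<delta>2 \<Longrightarrow> \<bar>f y\<bar> \<le> \<epsilon> * \<bar>y - T\<bar>"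
      using DERIV_zero_bound[of f T \<epsilon>] deriv[of T] ends eps by auto
    have bound: "\<bar>train T A f (t + h)\<bar> \<le> \<epsilon> * \<bar>h\<bar>" if h: "\<bar>h\<bar> < min \<delta>1 \<delta>2" for h
    proof -
      obtain x where x: "train T A f (t + h) = f x" "\<bar>x\<bar> \<le> \<bar>t + h - t\<bar> \<or> \<bar>x - T\<bar> \<le> \<bar>t + h - t\<bar>"
        by (rule train_near_rest[where f = f, OF sep True ends(1)])
      from x(2) have "\<bar>f x\<bar> \<le> \<epsilon> * \<bar>h\<bar>"
      proof
        assume "\<bar>x\<bar> \<le> \<bar>t + h - t\<bar>"
        hence "\<bar>f x\<bar> \<le> \<epsilon> * \<bar>x\<bar>" "\<epsilon> * \<bar>x\<bar> \<le> \<epsilon> * \<bar>h\<bar>"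
          using d1(2)[of x] h eps by (auto intro: mult_left_mono)
        thus ?thesis by simp
      next
        assume "\<bar>x - T\<bar> \<le> \<bar>t + h - t\<bar>"
        hence "\<bar>f x\<bar> \<le> \<epsilon> * \<bar>x - T\<bar>" "\<epsilon> * \<bar>x - T\<bar> \<le> \<epsilon> * \<bar>h\<bar>"
          using d2(2)[of x] h eps by (auto intro: mult_left_mono)
        thus ?thesis by simp
      qed
      thus ?thesis by (simp add: x(1))
    qed
    have "\<bar>train T A f (t + h) / h\<bar> < r" if "h \<noteq> 0" "\<bar>h\<bar> < min \<delta>1 \<delta>2" for h
    proof -
      have "\<bar>train T A f (t + h) / h\<bar> \<le> \<epsilon>"
        using bound[OF that(2)] that(1) by (simp add: pos_divide_le_eq)
      thus ?thesis using eps by simp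
    qed
    thus "\<exists>s>0. \<forall>x. x \<noteq> 0 \<and> norm (x - 0) < s \<longrightarrow> norm (train T A f (t + x) / x - 0) < r"
      using d1(1) d2(1) by (intro exI[of _ "min \<delta>1 \<delta>2"]) auto
  qed
  thus ?thesis using train_outside[OF True] by (simp add: DERIV_def)
qed

lemma train_continuous:
  assumes sep: "separated T A" and cont: "continuous_on UNIV f" and ends: "f 0 = 0" "f T = 0"
  shows "continuous_on UNIV (train T A f)"
proof (intro continuous_at_imp_continuous_on ballI)
  have contf: "isCont f x" for x using cont by (simp add: continuous_on_eq_continuous_at)
  fix t :: real
  show "isCont (train T A f) t"
  proof (cases "\<forall>s\<in>A. t \<notin> {s<..<s + T}")
    case False
    then obtain s where s: "s \<in> A" "t \<in> {s<..<s + T}" by blast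
    have "\<forall>\<^sub>F t in nhds t. t \<in> {s<..<s + T}"
      by (rule eventually_nhds_in_open) (use s in auto)
    hence eq: "\<forall>\<^sub>F t in nhds t. train T A f t = f (t - s)"
      by eventually_elim (rule train_inside[OF sep s(1)])
    have "isCont (\<lambda>t. f (t - s)) t"
      by (rule isCont_o2[where f = "\<lambda>t. t - s" and g = f]) (auto intro: contf)
    thus ?thesis unfolding isCont_cong[OF eq] .
  next
    case True
    show ?thesis
      unfolding continuous_at_eps_delta
    proof (intro allI impI)
      fix \<epsilon> :: real assume "\<epsilon> > 0"
      obtain \<delta>1 where d1: "\<delta>1 > 0" "\<And>y. \<bar>y\<bar> < \<delta>1 \<Longrightarrow> \<bar>f y\<bar> < \<epsilon>"
        using contf[of 0] ends \<open>\<epsilon> > 0\<close> unfolding continuous_at_eps_delta dist_real_def by (metis diff_zero)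
      obtain \<delta>2 where d2: "\<delta>2 > 0" "\<And>y. \<bar>y - T\<bar> < \<delta>2 \<Longrightarrow> \<bar>f y\<bar> < \<epsilon>"
        using contf[of T] ends \<open>\<epsilon> > 0\<close> unfolding continuous_at_eps_delta dist_real_def by (metis diff_zero)
      have "\<bar>train T A f y\<bar> < \<epsilon>" if y: "\<bar>y - t\<bar> < min \<delta>1 \<delta>2" for y
      proof -
        obtain x where x: "train T A f y = f x" "\<bar>x\<bar> \<le> \<bar>y - t\<bar> \<or> \<bar>x - T\<bar> \<le> \<bar>y - t\<bar>"
          by (rule train_near_rest[where f = f, OF sep True ends(1)])
        thus ?thesis using d1(2)[of x] d2(2)[of x] y by auto
      qed
      thus "\<exists>d>0. \<forall>x'. dist x' t < d \<longrightarrow> dist (train T A f x') (train T A f t) < \<epsilon>"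
        using d1(1) d2(1) train_outside[OF True, of f]
        by (intro exI[of _ "min \<delta>1 \<delta>2"]) (auto simp: dist_real_def)
    qed
  qed
qed

lemma separated_locally_finite:
  assumes "separated T A" "T > 0"
  shows "finite (A \<inter> {a..b})"
proof (rule finite_imageD[where f = "\<lambda>s. \<lfloor>s / T\<rfloor>"])
  have "(\<lambda>s. \<lfloor>s / T\<rfloor>) ` (A \<inter> {a..b}) \<subseteq> {\<lfloor>a / T\<rfloor>..\<lfloor>b / T\<rfloor>}"
    using \<open>T > 0\<close> by (auto intro!: floor_mono divide_right_mono)
  thus "finite ((\<lambda>s. \<lfloor>s / T\<rfloor>) ` (A \<inter> {a..b}))"
    using finite_subset by blast
  show "inj_on (\<lambda>s. \<lfloor>s / T\<rfloor>) (A \<inter> {a..b})"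
  proof (rule inj_onI, rule ccontr)
    fix s s' assume s: "s \<in> A \<inter> {a..b}" "s' \<in> A \<inter> {a..b}" "\<lfloor>s / T\<rfloor> = \<lfloor>s' / T\<rfloor>" "s \<noteq> s'"
    hence "\<bar>s / T - s' / T\<bar> < 1" by linarith
    hence "\<bar>s - s'\<bar> < T" using \<open>T > 0\<close> by (simp add: diff_divide_distrib[symmetric] abs_divide)
    thus False using s assms(1) unfolding separated_def by fastforce
  qed
qed

lemma bump_intervals_separated:
  assumes disj: "disjoint_family_on (\<lambda>k. bump_interval t1 t2 (a k)) K" and "t1 < t2"
  shows "separated (t2 - t1) ((\<lambda>k. t1 - a k * (t2 - t1)) ` K)"
    and "inj_on (\<lambda>k. t1 - a k * (t2 - t1)) K"
proof -
  have apart: "t2 - t1 \<le> \<bar>(t1 - a k * (t2 - t1)) - (t1 - a l * (t2 - t1))\<bar>"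
    if kl: "k \<in> K" "l \<in> K" "k \<noteq> l" for k l
  proof (rule ccontr)
    define p q T where "p = t1 - a k * (t2 - t1)" and "q = t1 - a l * (t2 - t1)" and "T = t2 - t1"
    assume "\<not> t2 - t1 \<le> \<bar>(t1 - a k * (t2 - t1)) - (t1 - a l * (t2 - t1))\<bar>"
    hence less: "\<bar>p - q\<bar> < T" by (simp add: p_def q_def T_def)
    have "bump_interval t1 t2 (a k) = {p<..<p + T}" "bump_interval t1 t2 (a l) = {q<..<q + T}"
      by (auto simp: bump_interval_def p_def q_def T_def)
    \<comment> \<open>If two starting points were too close, the midpoint of the overlap would lie in both intervals.\<close>
    moreover have "(max p q + (min p q + T)) / 2 \<in> {p<..<p + T} \<inter> {q<..<q + T}"
      using less by (auto simp: max_def min_def abs_if field_simps split: if_splits)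
    ultimately show False using disj kl unfolding disjoint_family_on_def by blast
  qed
  show "separated (t2 - t1) ((\<lambda>k. t1 - a k * (t2 - t1)) ` K)"
    unfolding separated_def by (intro ballI impI, elim imageE, hypsubst, rule apart) auto
  show "inj_on (\<lambda>k. t1 - a k * (t2 - t1)) K"
  proof (rule inj_onI, rule ccontr)
    fix k l assume "k \<in> K" "l \<in> K" "t1 - a k * (t2 - t1) = t1 - a l * (t2 - t1)" "k \<noteq> l"
    thus False using apart[of k l] \<open>t1 < t2\<close> by simp
  qed
qed

lemma local_extremum_DERIV_zero:
  assumes "local_extremum u t" "(u has_real_derivative D) (at t)"
  shows "D = 0"
proof -
  obtain d where d: "d > 0"
    "(\<forall>s. s \<noteq> t \<and> \<bar>s - t\<bar> < d \<longrightarrow> u s \<le> u t) \<or> (\<forall>s. s \<noteq> t \<and> \<bar>s - t\<bar> < d \<longrightarrow> u t \<le> u s)"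
    using assms(1) unfolding local_extremum_def eventually_at dist_real_def by blast
  hence "(\<forall>s. \<bar>t - s\<bar> < d \<longrightarrow> u s \<le> u t) \<or> (\<forall>s. \<bar>t - s\<bar> < d \<longrightarrow> u t \<le> u s)"
    by (metis abs_minus_commute order_refl)
  thus ?thesis
    using DERIV_local_max[OF assms(2) d(1)] DERIV_local_min[OF assms(2) d(1)] by blast
qed

context compacton_potential
begin

text \<open>For a single start this is a solitary wave; for a general separated set it is a composite
  wave.\<close>

definition wave :: "real set \<Rightarrow> real \<Rightarrow> real" where "wave A = train width A profile"

definition wave_slope :: "real set \<Rightarrow> real \<Rightarrow> real" where "wave_slope A = train width A slope"

lemma profile_continuous: "continuous_on UNIV profile" "continuous_on UNIV slope"
  by (intro continuous_at_imp_continuous_on ballI DERIV_isCont[OF DERIV_profile] DERIV_isCont[OF DERIV_slope])+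

lemma wave_inside:
  "separated width A \<Longrightarrow> s \<in> A \<Longrightarrow> t \<in> {s<..<s + width} \<Longrightarrow> wave A t = profile (t - s)"
  unfolding wave_def by (rule train_inside)

lemma wave_outside: "\<forall>s\<in>A. t \<notin> {s<..<s + width} \<Longrightarrow> wave A t = 0"
  unfolding wave_def by (rule train_outside)

context
  fixes A :: "real set"
  assumes sep: "separated width A"
begin

lemma wave_DERIV: "(wave A has_real_derivative wave_slope A t) (at t)"
  unfolding wave_def wave_slope_def by (rule train_DERIV[OF sep DERIV_profile]) (simp_all add: profile_ends)

lemma wave_slope_continuous: "continuous_on UNIV (wave_slope A)"
  unfolding wave_slope_def by (rule train_continuous[OF sep]) (simp_all add: profile_ends profile_continuous)

lemma wave_continuous: "continuous_on X (wave A)"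
  by (intro continuous_at_imp_continuous_on ballI DERIV_isCont[OF wave_DERIV])

lemma wave_range: "wave A t \<in> {0..m}"
  using wave_inside[OF sep] wave_outside[of A t] profile_range m_pos
  by (cases "\<forall>s\<in>A. t \<notin> {s<..<s + width}") fastforce+

lemma wave_pos_iff: "wave A t > 0 \<longleftrightarrow> (\<exists>s\<in>A. t \<in> {s<..<s + width})"
proof (cases "\<forall>s\<in>A. t \<notin> {s<..<s + width}")
  case True
  thus ?thesis using wave_outside[OF True] by simp
next
  case False
  then obtain s where s: "s \<in> A" "t \<in> {s<..<s + width}" by blast
  hence "wave A t > 0" using wave_inside[OF sep s] profile_pos[of "t - s"] by simp
  thus ?thesis using s by blast
qed

lemma wave_momentum:
  "((\<lambda>t. 2 * wave A t * wave_slope A t) has_real_derivative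
     (wave_slope A t)\<^sup>2 - 2 * deriv F (wave A t)) (at t)"
proof -
  have "(\<lambda>t. 2 * wave A t * wave_slope A t) = train width A (\<lambda>t. 2 * profile t * slope t)"
    unfolding wave_def wave_slope_def
    by (rule ext, rule train_combine[OF sep, symmetric, where h = "\<lambda>x y. 2 * x * y"]) simp
  moreover have "(\<lambda>t. (wave_slope A t)\<^sup>2 - 2 * deriv F (wave A t)) =
      train width A (\<lambda>t. (slope t)\<^sup>2 - 2 * deriv F (profile t))"
    unfolding wave_def wave_slope_def
    by (rule ext, rule train_combine[OF sep, symmetric, where h = "\<lambda>x y. y\<^sup>2 - 2 * deriv F x"])
       (simp add: critical)
  moreover have "(train width A (\<lambda>t. 2 * profile t * slope t) has_real_derivative
      train width A (\<lambda>t. (slope t)\<^sup>2 - 2 * deriv F (profile t)) t) (at t)"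
    by (rule train_DERIV[OF sep DERIV_momentum]) (simp_all add: profile_ends critical)
  ultimately show ?thesis by metis
qed

lemma wave_energy: "energy F (wave A) t = F 0"
proof -
  have "wave A t * (wave_slope A t)\<^sup>2 / 2 + F (wave A t) = F 0"
  proof (cases "\<forall>s\<in>A. t \<notin> {s<..<s + width}")
    case True
    thus ?thesis using wave_outside by simp
  next
    case False
    then obtain s where "s \<in> A" "t \<in> {s<..<s + width}" by blast
    thus ?thesis using train_inside[OF sep] profile_energy
      unfolding wave_def wave_slope_def by simp
  qed
  thus ?thesis unfolding energy_def DERIV_imp_deriv[OF wave_DERIV] .
qed

lemma wave_C1: "wave A C1_differentiable_on UNIV"
  unfolding C1_differentiable_on_def
  using wave_DERIV wave_slope_continuous has_real_derivative_iff_has_vector_derivative by blast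

lemma wave_at_start:
  assumes "s \<in> A" shows "wave A s = 0"
proof (rule wave_outside, rule ballI)
  fix r assume "r \<in> A"
  thus "s \<notin> {r<..<r + width}"
    using sep assms unfolding separated_def by (cases "r = s") fastforce+
qed

lemma wave_at_middle:
  assumes "s \<in> A" "0 < x" "x < width" shows "wave A (s + x) > 0"
  unfolding wave_pos_iff using assms by (intro bexI[of _ s]) auto

lemma wave_nonconstant:
  assumes "s \<in> A" shows "\<not> wave A constant_on {s..s + width}"
proof
  assume "wave A constant_on {s..s + width}"
  hence "wave A s = wave A (s + width / 2)"
    using width_pos unfolding constant_on_def by auto
  thus False
    using wave_at_start[OF assms] wave_at_middle[OF assms, of "width / 2"] width_pos by simp
qed

lemma wave_strong_singular:
  assumes "A \<noteq> {}" shows "strong_singular_TWS F (wave A)"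
  unfolding strong_singular_TWS_def
proof (intro conjI exI[of _ "F 0"])
  show "TWS F (wave A)"
    by (rule C1_momentum_balance_imp_TWS[OF analytic wave_DERIV wave_slope_continuous wave_momentum])
       (use wave_range in auto)
  obtain s where "s \<in> A" using assms by blast
  thus "\<not> wave A constant_on UNIV"
    using wave_nonconstant constant_on_subset by blast
  show "classical_solution_on UNIV F (F 0) (wave A)"
    unfolding classical_solution_on_def using wave_C1 wave_energy by blast
qed

lemma wave_piecewise_analytic: "piecewise_analytic (wave A)"
  unfolding piecewise_analytic_def
proof (intro conjI exI[of _ "A \<union> (\<lambda>s. s + width) ` A"] allI impI)
  show "continuous_on UNIV (wave A)" by (rule wave_continuous)
  fix a b :: real
  have "(\<lambda>s. s + width) ` A \<inter> {a..b} \<subseteq> (\<lambda>s. s + width) ` (A \<inter> {a - width..b - width})"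
    by auto
  hence "finite ((\<lambda>s. s + width) ` A \<inter> {a..b})"
    using finite_subset separated_locally_finite[OF sep width_pos] by blast
  thus "finite ((A \<union> (\<lambda>s. s + width) ` A) \<inter> {a..b})"
    using separated_locally_finite[OF sep width_pos] by (simp add: Int_Un_distrib2)
  assume "a < b" and free: "{a<..<b} \<inter> (A \<union> (\<lambda>s. s + width) ` A) = {}"
  show "\<exists>g. (\<forall>x\<in>{a..b}. real_analytic_at g x) \<and> (\<forall>x\<in>{a<..<b}. g x = wave A x)"
  proof (cases "\<exists>s\<in>A. {a<..<b} \<inter> {s<..<s + width} \<noteq> {}")
    case True
    then obtain s r where s: "s \<in> A" and r: "r \<in> {a<..<b}" "r \<in> {s<..<s + width}" by blast
    have "s \<notin> {a<..<b}" "s + width \<notin> {a<..<b}" using free s by auto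
    hence sub: "{a<..<b} \<subseteq> {s<..<s + width}" using r by auto
    have "real_analytic_at (\<lambda>t. profile (t - s)) x" for x
      by (rule real_analytic_at_compose[OF real_analytic_at_diff analytic_profile]) auto
    moreover have "\<forall>x\<in>{a<..<b}. profile (x - s) = wave A x"
      using wave_inside[OF sep s] sub by auto
    ultimately show ?thesis by blast
  next
    case False
    hence "\<forall>s\<in>A. x \<notin> {s<..<s + width}" if "x \<in> {a<..<b}" for x
      using that by blast
    hence "\<forall>x\<in>{a<..<b}. 0 = wave A x" by (simp add: wave_outside)
    thus ?thesis using real_analytic_at_const by (intro exI[of _ "\<lambda>_. 0"]) auto
  qed
qed

lemma wave_compact_support:
  assumes "finite A" "A \<noteq> {}" shows "has_compact_support (wave A)"
proof -
  define a b where "a = Min A" and "b = Max A + width"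
  have ab: "a \<in> A" "\<And>s. s \<in> A \<Longrightarrow> a \<le> s \<and> s + width \<le> b"
    using assms by (auto simp: a_def b_def)
  have "wave A t = 0" if "t \<in> - {a..b}" for t
    using that ab(2) by (intro wave_outside) fastforce
  hence "wave A constant_on (- {a..b})" unfolding constant_on_def by blast
  moreover have "{a..a + width} \<subseteq> {a..b}" using ab by auto
  hence "\<not> wave A constant_on {a..b}" using wave_nonconstant[OF ab(1)] constant_on_subset by blast
  moreover have "a < b" using ab(1) ab(2)[of a] width_pos by simp
  ultimately show ?thesis unfolding has_compact_support_def constant_outside_def by blast
qed

lemma wave_not_compact_support:
  assumes "infinite A" shows "\<not> has_compact_support (wave A)"
proof
  assume "has_compact_support (wave A)"
  then obtain a b where ab: "wave A constant_on (- {a..b})"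
    unfolding has_compact_support_def constant_outside_def by blast
  have "infinite (A - A \<inter> {a - width..b})"
    using separated_locally_finite[OF sep width_pos] assms by simp
  then obtain s where "s \<in> A" "s \<notin> {a - width..b}"
    by (metis DiffE IntI finite.emptyI ex_in_conv)
  hence "s \<in> A" "{s..s + width} \<subseteq> - {a..b}" by auto
  thus False using wave_nonconstant ab constant_on_subset by blast
qed

lemma wave_period:
  assumes "A \<noteq> {}" "has_period (wave A) T" shows "width \<le> T"
proof (rule ccontr)
  assume "\<not> width \<le> T"
  obtain s where s: "s \<in> A" using assms by blast
  have T: "T > 0" "wave A (s + T) = wave A s" using assms(2) by (auto simp: has_period_def)
  thus False
    using wave_at_start[OF s] wave_at_middle[OF s, of T] \<open>\<not> width \<le> T\<close> by simp
qed

end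

lemma separated_singleton: "separated T {s}"
  by (simp add: separated_def)

lemma wave_singleton: "wave {s} t = (if t \<in> {s<..<s + width} then profile (t - s) else 0)"
  using wave_inside[OF separated_singleton, of s s t] wave_outside[of "{s}" t] by auto

text \<open>Minimality of the support: a wave that is constant outside some interval is zero there,
  since it vanishes far away, so the interval covers all points of positive height.\<close>

lemma wave_singleton_solitary: "compact_solitary_wave F (wave {s}) s (s + width)"
  unfolding compact_solitary_wave_def
proof (intro conjI)
  let ?u = "wave {s}"
  note sep = separated_singleton[of width s]
  show "singular_TWS F ?u"
    using wave_strong_singular[OF sep] by (simp add: singular_TWS_def)
  show "continuous_on UNIV ?u" by (rule wave_continuous[OF sep])
  have zero: "?u t = 0" if "t \<notin> {s..s + width}" for t
    using that by (auto simp: wave_singleton)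
  have out: "constant_outside ?u s (s + width)"
    using zero width_pos wave_nonconstant[OF sep, of s]
    by (auto simp: constant_outside_def constant_on_def)
  have "{s..s + width} \<subseteq> {a..b}" if ab: "constant_outside ?u a b" for a b
  proof -
    obtain c where c: "\<And>t. t \<notin> {a..b} \<Longrightarrow> ?u t = c"
      using ab by (auto simp: constant_outside_def constant_on_def)
    have "c = 0"
    proof -
      have "min a s - 1 \<notin> {a..b}" "min a s - 1 \<notin> {s..s + width}" by auto
      thus ?thesis using c zero by metis
    qed
    hence inside: "t \<in> {a..b}" if "t \<in> {s<..<s + width}" for t
      using c[of t] wave_pos_iff[OF sep, of t] that by auto
    have "a \<le> s"
    proof (rule ccontr)
      assume "\<not> a \<le> s"
      hence "s < s + min (a - s) width / 2" "s + min (a - s) width / 2 < s + width"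
        "s + min (a - s) width / 2 < a" using width_pos by (auto simp: min_def field_simps)
      thus False using inside[of "s + min (a - s) width / 2"] by auto
    qed
    moreover have "s + width \<le> b"
    proof (rule ccontr)
      assume "\<not> s + width \<le> b"
      hence "s < s + width - min (s + width - b) width / 2"
        "s + width - min (s + width - b) width / 2 < s + width"
        "b < s + width - min (s + width - b) width / 2"
        using width_pos by (auto simp: min_def field_simps)
      thus False using inside[of "s + width - min (s + width - b) width / 2"] by auto
    qed
    ultimately show ?thesis by auto
  qed
  with out show "has_support ?u s (s + width)" unfolding has_support_def by blast
  show "\<exists>!t. t \<in> {s<..<s + width} \<and> local_extremum ?u t"
  proof (rule ex1I[of _ "s + width / 2"])
    have "?u t \<le> ?u (s + width / 2)" for t
      using wave_range[OF sep, of t] width_pos by (simp add: wave_singleton profile_half)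
    thus "s + width / 2 \<in> {s<..<s + width} \<and> local_extremum ?u (s + width / 2)"
      using width_pos by (auto simp: local_extremum_def)
  next
    fix t assume t: "t \<in> {s<..<s + width} \<and> local_extremum ?u t"
    have "wave_slope {s} t = slope (t - s)"
      unfolding wave_slope_def by (rule train_inside[OF sep]) (use t in auto)
    hence "slope (t - s) = 0"
      using local_extremum_DERIV_zero[OF _ wave_DERIV[OF sep]] t by metis
    moreover have "0 < profile (t - s)" "0 < cofactor (profile (t - s))"
      using t profile_pos[of "t - s"] cofactor_pos[OF profile_range] by auto
    ultimately have "profile (t - s) = m" using slope_sq[of "t - s"] by simp
    thus "t = s + width / 2" using profile_less_m[of "t - s"] t by force
  qed
qed

end

section \<open>Consequences of the distributional equation\<close>

lemma singular_TWS_energy_solution: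
  assumes "singular_TWS F u" "continuous_on UNIV u"
  obtains h S where "energy_solution F h S u"
proof -
  have *: "energy_solution F h S u" if S: "countable S" "classical_solution_on (- S) F h u" for h S
    unfolding energy_solution_def
  proof (intro conjI allI impI assms(2) S(1))
    fix t assume "t \<notin> S"
    then obtain D where D: "(u has_real_derivative D) (at t)"
      using S(2) unfolding classical_solution_on_def C1_differentiable_on_def
      by (auto simp: has_real_derivative_iff_has_vector_derivative)
    moreover have "energy F u t = h" using S(2) \<open>t \<notin> S\<close> unfolding classical_solution_on_def by blast
    ultimately show "\<exists>D. (u has_real_derivative D) (at t) \<and> u t * D\<^sup>2 / 2 + F (u t) = h"
      unfolding energy_def using DERIV_imp_deriv by blast
  qed
  have "\<exists>h S. countable S \<and> classical_solution_on (- S) F h u"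
    using assms(1) unfolding singular_TWS_def
  proof
    assume "strong_singular_TWS F u"
    then obtain h where "classical_solution_on (- {}) F h u"
      unfolding strong_singular_TWS_def by auto
    thus ?thesis using countable_empty by blast
  qed (auto simp: weak_singular_TWS_def)
  thus ?thesis using * that by blast
qed

text \<open>The weak derivative of \<open>u\<^sup>2\<close> is eliminated by testing its definition with \<open>\<phi>'\<close>.\<close>

lemma TWS_weak_form:
  assumes "TWS F u"
  shows "\<exists>v. has_weak_derivative u v \<and> (\<forall>\<phi>. test_function \<phi> \<longrightarrow> has_bochner_integral lebesgue
       (\<lambda>t. (v t)\<^sup>2 * \<phi> t - 2 * deriv F (u t) * \<phi> t - (u t)\<^sup>2 * deriv (deriv \<phi>) t) 0)"
proof -
  obtain v w where v: "has_weak_derivative u v" and w: "has_weak_derivative (\<lambda>t. (u t)\<^sup>2) w"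
    and eq: "\<And>\<phi>. test_function \<phi> \<Longrightarrow> has_bochner_integral lebesgue
             (\<lambda>t. w t * deriv \<phi> t + (v t)\<^sup>2 * \<phi> t - 2 * deriv F (u t) * \<phi> t) 0"
    using assms unfolding TWS_def by blast
  have "has_bochner_integral lebesgue
       (\<lambda>t. (v t)\<^sup>2 * \<phi> t - 2 * deriv F (u t) * \<phi> t - (u t)\<^sup>2 * deriv (deriv \<phi>) t) 0"
    if \<phi>: "test_function \<phi>" for \<phi>
  proof -
    have \<phi>': "test_function (deriv \<phi>)" by (rule test_function_deriv[OF \<phi>])
    obtain a b where ab: "\<And>t. t \<notin> {a..b} \<Longrightarrow> deriv \<phi> t = 0" "\<And>t. t \<notin> {a..b} \<Longrightarrow> deriv (deriv \<phi>) t = 0"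
      using test_function_support[OF \<phi>] by metis
    have L: "L1_loc (\<lambda>t. (u t)\<^sup>2)" "L1_loc w" using w by (auto simp: has_weak_derivative_def)
    have "integrable lebesgue (\<lambda>t. (u t)\<^sup>2 * deriv (deriv \<phi>) t)"
      by (rule integrable_L1_loc_mult[OF L(1) test_function_continuous[OF test_function_deriv[OF \<phi>']] ab(2)])
    moreover have "integrable lebesgue (\<lambda>t. w t * deriv \<phi> t)"
      by (rule integrable_L1_loc_mult[OF L(2) test_function_continuous[OF \<phi>'] ab(1)])
    moreover have "(LINT t|lebesgue. (u t)\<^sup>2 * deriv (deriv \<phi>) t) = - (LINT t|lebesgue. w t * deriv \<phi> t)"
      using w \<phi>' by (auto simp: has_weak_derivative_def)
    ultimately have "has_bochner_integral lebesgue (\<lambda>t. (u t)\<^sup>2 * deriv (deriv \<phi>) t + w t * deriv \<phi> t) 0"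
      by (simp add: has_bochner_integral_iff)
    from has_bochner_integral_diff[OF eq[OF \<phi>] this] show ?thesis
      by (simp add: algebra_simps)
  qed
  thus ?thesis using v by blast
qed

text \<open>Where \<open>u\<close> is continuously differentiable, integration by parts against test functions
  supported in a smaller closed interval identifies the weak derivative; countably many such intervals
  exhaust the open one.\<close>

lemma weak_derivative_eq_derivative_AE:
  assumes v: "has_weak_derivative u v" and u: "continuous_on UNIV u"
    and r: "continuous_on UNIV r"
    and deriv: "\<And>t. t \<in> {a<..<b} \<Longrightarrow> (u has_real_derivative r t) (at t)"
  shows "AE t in lebesgue. t \<in> {a<..<b} \<longrightarrow> v t = r t"
proof -
  have inner: "AE t in lebesgue. t \<in> {c<..<d} \<longrightarrow> v t - r t = 0" if cd: "a < c" "d < b" for c d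
  proof (rule fundamental_lemma_of_variations)
    have L: "L1_loc v" "L1_loc r" "L1_loc u"
      using v r u by (auto simp: has_weak_derivative_def intro: L1_loc_continuous)
    thus "L1_loc (\<lambda>t. v t - r t)"
      unfolding L1_loc_def by (auto intro: set_integral_diff)
    fix \<phi> assume \<phi>: "test_function \<phi>" and zero: "\<And>t. t \<notin> {c<..<d} \<Longrightarrow> \<phi> t = 0"
    have z1: "\<phi> t = 0" if "t \<notin> {c..d}" for t
      by (rule zero) (use that in auto)
    note z = z1 deriv_eq_0_outside[of c d \<phi>, OF z1]
    have cont: "continuous_on UNIV \<phi>" "continuous_on UNIV (deriv \<phi>)"
      by (intro test_function_continuous test_function_deriv \<phi>)+
    have "has_bochner_integral lebesgue (\<lambda>t. u t * deriv \<phi> t + r t * \<phi> t) 0"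
    proof (rule has_bochner_integral_compact_FTC[where f = "\<lambda>t. u t * \<phi> t" and a = c and b = d])
      show "continuous_on UNIV (\<lambda>t. u t * deriv \<phi> t + r t * \<phi> t)"
        by (intro continuous_intros u r cont)
      show "u t * \<phi> t = 0" if "t \<notin> {c..d}" for t using z that by simp
      show "((\<lambda>t. u t * \<phi> t) has_real_derivative u t * deriv \<phi> t + r t * \<phi> t) (at t)" for t
      proof (cases "t \<in> {a<..<b}")
        case True
        show ?thesis
          by (rule DERIV_cong[OF DERIV_mult[OF deriv[OF True] test_function_DERIV(1)[OF \<phi>]]])
             (simp add: algebra_simps)
      next
        case False
        hence t: "t \<in> - {c..d}" using cd by auto
        have "((\<lambda>_. 0) has_real_derivative 0) (at t)" by simp
        hence "((\<lambda>t. u t * \<phi> t) has_real_derivative 0) (at t)"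
          by (rule has_field_derivative_transform_within_open[of _ _ _ "- {c..d}"]) (use t z in auto)
        thus ?thesis using z[of t] t by simp
      qed
    qed
    hence sum0: "(LINT t|lebesgue. u t * deriv \<phi> t + r t * \<phi> t) = 0"
      by (simp add: has_bochner_integral_iff)
    have int: "integrable lebesgue (\<lambda>t. v t * \<phi> t)" "integrable lebesgue (\<lambda>t. r t * \<phi> t)"
      "integrable lebesgue (\<lambda>t. u t * deriv \<phi> t)"
      using integrable_L1_loc_mult[OF L(1) cont(1) z(1)] integrable_L1_loc_mult[OF L(2) cont(1) z(1)]
        integrable_L1_loc_mult[OF L(3) cont(2) z(2)] by blast+
    have "(LINT t|lebesgue. u t * deriv \<phi> t) = - (LINT t|lebesgue. v t * \<phi> t)"
      using v \<phi> by (auto simp: has_weak_derivative_def)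
    thus "(LINT t|lebesgue. (v t - r t) * \<phi> t) = 0"
      using sum0 int by (simp add: left_diff_distrib)
  qed
  have "AE t in lebesgue. \<forall>n. t \<in> {a + 1 / real (Suc n)<..<b - 1 / real (Suc n)} \<longrightarrow> v t - r t = 0"
    unfolding AE_all_countable by (intro allI inner) auto
  thus ?thesis
  proof eventually_elim
    case (elim t)
    show ?case
    proof
      assume t: "t \<in> {a<..<b}"
      hence "0 < min (t - a) (b - t)" by simp
      then obtain n where "1 / real (Suc n) < min (t - a) (b - t)"
        using nat_approx_posE by blast
      hence "t \<in> {a + 1 / real (Suc n)<..<b - 1 / real (Suc n)}" by auto
      thus "v t = r t" using elim by auto
    qed
  qed
qed

text \<open>On a constant piece only the term with \<open>F'\<close> survives in the weak equation. The energy identity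
  alone would not give this.\<close>

lemma constant_piece_is_critical:
  assumes F: "TWS F u" "continuous_on UNIV u" and "a < b" and const: "\<And>t. t \<in> {a<..<b} \<Longrightarrow> u t = c"
  shows "deriv F c = 0"
proof -
  obtain v where v: "has_weak_derivative u v"
    and eq: "\<And>\<phi>. test_function \<phi> \<Longrightarrow> has_bochner_integral lebesgue
       (\<lambda>t. (v t)\<^sup>2 * \<phi> t - 2 * deriv F (u t) * \<phi> t - (u t)\<^sup>2 * deriv (deriv \<phi>) t) 0"
    using TWS_weak_form[OF F(1)] by blast
  have "AE t in lebesgue. t \<in> {a<..<b} \<longrightarrow> v t = 0"
  proof (rule weak_derivative_eq_derivative_AE[OF v F(2)])
    fix t assume t: "t \<in> {a<..<b}"
    have "((\<lambda>_. c) has_real_derivative 0) (at t)" by simp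
    thus "(u has_real_derivative 0) (at t)"
      by (rule has_field_derivative_transform_within_open[of _ _ _ "{a<..<b}"]) (use t const in auto)
  qed simp
  note vz = this
  have "AE t in lebesgue. t \<in> {a<..<b} \<longrightarrow> deriv F c = 0"
  proof (rule fundamental_lemma_of_variations)
    show "L1_loc (\<lambda>t. deriv F c)" by (intro L1_loc_continuous) simp
    fix \<phi> assume \<phi>: "test_function \<phi>" and zero: "\<And>t. t \<notin> {a<..<b} \<Longrightarrow> \<phi> t = 0"
    have z1: "\<phi> t = 0" if "t \<notin> {a..b}" for t
      by (rule zero) (use that in auto)
    note z = z1 deriv_eq_0_outside[of a b \<phi>, OF z1]
    have z2: "deriv (deriv \<phi>) t = 0" if "t \<notin> {a..b}" for t
      using deriv_eq_0_outside[of a b "deriv \<phi>" t] z(2) that by blast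
    let ?I = "\<lambda>t. (v t)\<^sup>2 * \<phi> t - 2 * deriv F (u t) * \<phi> t - (u t)\<^sup>2 * deriv (deriv \<phi>) t"
    let ?J = "\<lambda>t. - (2 * deriv F c) * \<phi> t - c\<^sup>2 * deriv (deriv \<phi>) t"
    have ae: "AE t in lebesgue. t \<noteq> a \<and> t \<noteq> b"
      by (intro AE_conjI AE_I'[of "{a}"] AE_I'[of "{b}"]) (auto intro: null_sets_completionI)
    have meas: "?J \<in> borel_measurable lebesgue"
    proof -
      have "continuous_on UNIV ?J"
        by (intro continuous_intros test_function_continuous test_function_deriv \<phi>)
      from borel_measurable_continuous_onI[OF this] show ?thesis
        by (intro measurable_completion) simp
    qed
    have "has_bochner_integral lebesgue ?J 0"
    proof (rule has_bochner_integral_cong_AE[THEN iffD1, OF _ meas _ eq[OF \<phi>]])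
      show "?I
          \<in> borel_measurable lebesgue"
        using eq[OF \<phi>] by (auto simp: has_bochner_integral_iff)
      show "AE t in lebesgue. ?I t = ?J t"
        using vz ae
      proof eventually_elim
        case (elim t)
        thus ?case using const[of t] z[of t] z2[of t] by (cases "t \<in> {a<..<b}") auto
      qed
    qed
    moreover have "has_bochner_integral lebesgue (deriv (deriv \<phi>)) 0"
      by (rule has_bochner_integral_compact_FTC[of "deriv \<phi>" _ a b])
         (auto intro: test_function_DERIV(2)[OF \<phi>] z test_function_continuous test_function_deriv \<phi>)
    hence "has_bochner_integral lebesgue (\<lambda>t. c\<^sup>2 * deriv (deriv \<phi>) t) (c\<^sup>2 * 0)"
      by (intro has_bochner_integral_mult_right) auto
    ultimately have "has_bochner_integral lebesgue (\<lambda>t. - (2 * deriv F c) * \<phi> t) 0"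
      using has_bochner_integral_add[of lebesgue ?J 0
          "\<lambda>t. c\<^sup>2 * deriv (deriv \<phi>) t" 0] by simp
    hence "has_bochner_integral lebesgue (\<lambda>t. (- 1 / 2) * (- (2 * deriv F c) * \<phi> t)) ((- 1 / 2) * 0)"
      by (intro has_bochner_integral_mult_right) auto
    thus "(LINT t|lebesgue. deriv F c * \<phi> t) = 0"
      by (simp add: has_bochner_integral_iff)
  qed
  show "deriv F c = 0"
  proof (rule ccontr)
    assume "deriv F c \<noteq> 0"
    hence "AE t in lebesgue. t \<notin> {a<..<b}"
      using \<open>AE t in lebesgue. t \<in> {a<..<b} \<longrightarrow> deriv F c = 0\<close> by simp
    hence "emeasure lebesgue {a<..<b} = 0"
      by (subst (asm) AE_iff_measurable[of "{a<..<b}"]) auto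
    thus False using \<open>a < b\<close> by simp
  qed
qed

text \<open>On a monotone piece the speed is \<open>\<sigma> * sqrt (2 * q u)\<close> with \<open>\<sigma> = \<plusminus> 1\<close>, and the integrand of the weak
  equation has the primitive \<open>2 * u * u' * \<phi> - u\<^sup>2 * \<phi>'\<close>. The boundary terms are what a corner
  contributes to the weak equation.\<close>

lemma monotone_piece_momentum:
  fixes F :: "real \<Rightarrow> real"
  defines "q \<equiv> gap_quotient F"
  assumes F: "\<forall>x. real_analytic_at F x" and u: "continuous_on UNIV u" and \<phi>: "test_function \<phi>"
    and "a \<le> b" and \<sigma>: "\<sigma>\<^sup>2 = (1::real)"
    and deriv: "\<And>t. t \<in> {a<..<b} \<Longrightarrow> (u has_real_derivative \<sigma> * sqrt (2 * q (u t))) (at t)"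
    and pos: "\<And>t. t \<in> {a<..<b} \<Longrightarrow> q (u t) > 0"
  shows "((\<lambda>t. 2 * q (u t) * \<phi> t - 2 * deriv F (u t) * \<phi> t - (u t)\<^sup>2 * deriv (deriv \<phi>) t) has_integral
      (\<sigma> * (2 * u b * sqrt (2 * q (u b)) * \<phi> b) - (u b)\<^sup>2 * deriv \<phi> b) -
      (\<sigma> * (2 * u a * sqrt (2 * q (u a)) * \<phi> a) - (u a)\<^sup>2 * deriv \<phi> a)) {a..b}"
proof -
  have q: "\<forall>x. real_analytic_at q x"
    unfolding q_def by (rule real_analytic_gap_quotient[OF F])
  note contq = real_analytic_compose_continuous[OF q u]
  have qd: "q x + x * deriv q x = - deriv F x" for x
  proof -
    have "((\<lambda>x. F 0 - F x) has_real_derivative - deriv F x) (at x)"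
      by (auto intro!: derivative_eq_intros real_analytic_DERIV[OF F])
    moreover have "((\<lambda>x. F 0 - F x) has_real_derivative q x + x * deriv q x) (at x)"
      unfolding gap_quotient_eq q_def[symmetric]
      by (auto intro!: derivative_eq_intros real_analytic_DERIV[OF q])
    ultimately show ?thesis by (metis DERIV_unique)
  qed
  let ?r = "\<lambda>t. sqrt (2 * q (u t))"
  let ?P = "\<lambda>t. \<sigma> * (2 * u t * ?r t * \<phi> t) - (u t)\<^sup>2 * deriv \<phi> t"
  show ?thesis
  proof (rule fundamental_theorem_of_calculus_interior[OF \<open>a \<le> b\<close>, of ?P])
    have "continuous_on UNIV ?P"
      by (intro continuous_intros u contq test_function_continuous test_function_deriv \<phi>)
    thus "continuous_on {a..b} ?P" by (rule continuous_on_subset) simp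
    fix t assume t: "t \<in> {a<..<b}"
    note du = deriv[OF t]
    have rr: "(?r t)\<^sup>2 = 2 * q (u t)" "?r t > 0" using pos[OF t] by auto
    have "((\<lambda>t. 2 * q (u t)) has_real_derivative 2 * (deriv q (u t) * (\<sigma> * ?r t))) (at t)"
      by (intro DERIV_cmult DERIV_chain2[OF real_analytic_DERIV[OF q] du])
    hence "(?r has_real_derivative inverse (?r t) / 2 * (2 * (deriv q (u t) * (\<sigma> * ?r t)))) (at t)"
      by (intro DERIV_chain2[where f = sqrt] DERIV_real_sqrt) (use pos[OF t] in auto)
    moreover have "inverse (?r t) / 2 * (2 * (deriv q (u t) * (\<sigma> * ?r t))) = \<sigma> * deriv q (u t)"
      using rr(2) by simp
    ultimately have dr: "(?r has_real_derivative \<sigma> * deriv q (u t)) (at t)" by (simp only:)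
    have d1: "((\<lambda>t. u t * ?r t) has_real_derivative \<sigma> * ?r t * ?r t + \<sigma> * deriv q (u t) * u t) (at t)"
      by (rule DERIV_mult[OF du dr])
    have d2: "((\<lambda>t. (u t)\<^sup>2) has_real_derivative 2 * u t * (\<sigma> * ?r t)) (at t)"
      by (auto intro!: derivative_eq_intros du)
    let ?D = "\<sigma> * 2 * ((\<sigma> * ?r t * ?r t + \<sigma> * deriv q (u t) * u t) * \<phi> t + deriv \<phi> t * (u t * ?r t)) -
        (2 * u t * (\<sigma> * ?r t) * deriv \<phi> t + deriv (deriv \<phi>) t * (u t)\<^sup>2)"
    let ?J = "2 * q (u t) * \<phi> t - 2 * deriv F (u t) * \<phi> t - (u t)\<^sup>2 * deriv (deriv \<phi>) t"
    have "(?P has_real_derivative ?D) (at t)"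
      using DERIV_diff[OF DERIV_cmult[OF DERIV_mult[OF d1 test_function_DERIV(1)[OF \<phi>]], of "\<sigma> * 2"]
          DERIV_mult[OF d2 test_function_DERIV(2)[OF \<phi>]]] by (simp add: mult_ac)
    moreover have "?D = ?J"
    proof -
      have "?D = \<sigma>\<^sup>2 * 2 * ((?r t)\<^sup>2 + u t * deriv q (u t)) * \<phi> t - (u t)\<^sup>2 * deriv (deriv \<phi>) t"
        by (simp add: algebra_simps power2_eq_square)
      also have "\<dots> = 2 * q (u t) * \<phi> t + 2 * (q (u t) + u t * deriv q (u t)) * \<phi> t - (u t)\<^sup>2 * deriv (deriv \<phi>) t"
        unfolding \<sigma> rr(1) by (simp add: algebra_simps)
      finally show ?thesis unfolding qd by (simp add: algebra_simps)
    qed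
    ultimately show "(?P has_vector_derivative ?J) (at t)"
      by (simp add: has_real_derivative_iff_has_vector_derivative)
  qed
qed

section \<open>Classification of compact solitary waves\<close>

lemma interior_extremum_local:
  fixes u :: "real \<Rightarrow> real"
  assumes "x \<in> {c<..<d}" "(\<forall>y\<in>{c..d}. u y \<le> u x) \<or> (\<forall>y\<in>{c..d}. u x \<le> u y)"
  shows "local_extremum u x"
proof -
  have ev: "\<forall>\<^sub>F y in at x. y \<in> {c<..<d}"
    using assms(1) by (intro eventually_at_in_open') auto
  show ?thesis
    using assms(2) unfolding local_extremum_def
  proof
    assume "\<forall>y\<in>{c..d}. u y \<le> u x"
    with ev have "\<forall>\<^sub>F y in at x. u y \<le> u x" by (auto elim: eventually_mono)
    thus "(\<forall>\<^sub>F y in at x. u y \<le> u x) \<or> (\<forall>\<^sub>F y in at x. u x \<le> u y)" ..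
  next
    assume "\<forall>y\<in>{c..d}. u x \<le> u y"
    with ev have "\<forall>\<^sub>F y in at x. u x \<le> u y" by (auto elim: eventually_mono)
    thus "(\<forall>\<^sub>F y in at x. u y \<le> u x) \<or> (\<forall>\<^sub>F y in at x. u x \<le> u y)" ..
  qed
qed

text \<open>The crest is the unique extremum. If \<open>u\<close> failed to rise strictly before the crest, then a minimum
  over the stretch from the failure to the crest would be attained in its interior, giving a second
  extremum.\<close>

lemma unique_extremum_imp_unimodal:
  fixes u :: "real \<Rightarrow> real"
  assumes cont: "continuous_on UNIV u" and ends: "u a = 0" "u b = 0" and nonneg: "\<And>t. 0 \<le> u t"
    and nonconst: "\<not> u constant_on {a..b}"
    and unique: "\<exists>!t. t \<in> {a<..<b} \<and> local_extremum u t"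
  obtains t0 where "t0 \<in> {a<..<b}"
    "\<And>s t. a \<le> s \<Longrightarrow> s < t \<Longrightarrow> t \<le> t0 \<Longrightarrow> u s < u t"
    "\<And>s t. t0 \<le> s \<Longrightarrow> s < t \<Longrightarrow> t \<le> b \<Longrightarrow> u t < u s"
proof -
  obtain t0 where t0: "t0 \<in> {a<..<b}" and ext: "\<And>t. t \<in> {a<..<b} \<Longrightarrow> local_extremum u t \<Longrightarrow> t = t0"
    using unique by blast
  have cont': "continuous_on X u" for X using cont continuous_on_subset by blast
  have ab: "{a..b} \<noteq> {}" using t0 by auto
  obtain M where M: "M \<in> {a..b}" "\<And>t. t \<in> {a..b} \<Longrightarrow> u t \<le> u M"
    using continuous_attains_sup[OF compact_Icc ab cont'] by blast
  have "u M > 0"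
  proof (rule ccontr)
    assume "\<not> u M > 0"
    hence "u t = 0" if "t \<in> {a..b}" for t using M(2)[OF that] nonneg[of t] by simp
    thus False using nonconst unfolding constant_on_def by blast
  qed
  have max: "t = t0" if t: "t \<in> {a..b}" "u M \<le> u t" for t
  proof (rule ext)
    show "t \<in> {a<..<b}" using t \<open>u M > 0\<close> ends by (cases "t = a"; cases "t = b") auto
    thus "local_extremum u t"
      by (rule interior_extremum_local) (intro disjI1 ballI order_trans[OF M(2) t(2)])
  qed
  have top: "u t < u t0" if "t \<in> {a..b}" "t \<noteq> t0" for t
    using max[OF M(1)] max[OF that(1)] that by force
  show ?thesis
  proof (rule that[OF t0])
    fix s t assume st: "a \<le> s" "s < t" "t \<le> t0"
    show "u s < u t"
    proof (rule ccontr)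
      assume "\<not> u s < u t"
      hence le: "u t \<le> u s" by simp
      have s_top: "u s < u t0" using top[of s] st t0 by auto
      have t: "t < t0" using le s_top st by (cases "t = t0") auto
      obtain z where z: "z \<in> {s..t0}" "\<And>y. y \<in> {s..t0} \<Longrightarrow> u z \<le> u y"
        using continuous_attains_inf[OF compact_Icc _ cont', of s t0] st by auto
      have "z \<noteq> t0" using z(2)[of s] s_top st by auto
      \<comment> \<open>If the minimum is attained at \<open>s\<close>, it is also attained at \<open>t\<close>, because \<open>u t \<le> u s\<close>.\<close>
      define w where "w = (if z = s then t else z)"
      have w: "w \<in> {s<..<t0}" using z(1) \<open>z \<noteq> t0\<close> t st by (auto simp: w_def)
      have "\<forall>y\<in>{s..t0}. u w \<le> u y" using z(2) le by (auto simp: w_def intro: order_trans)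
      hence "local_extremum u w" using w by (intro interior_extremum_local[of w s t0]) auto
      hence "w = t0" using ext[of w] w st t0 by auto
      thus False using w by simp
    qed
  next
    fix s t assume st: "t0 \<le> s" "s < t" "t \<le> b"
    show "u t < u s"
    proof (rule ccontr)
      assume "\<not> u t < u s"
      hence le: "u s \<le> u t" by simp
      have t_top: "u t < u t0" using top[of t] st t0 by auto
      have s: "t0 < s" using le t_top st by (cases "s = t0") auto
      obtain z where z: "z \<in> {t0..t}" "\<And>y. y \<in> {t0..t} \<Longrightarrow> u z \<le> u y"
        using continuous_attains_inf[OF compact_Icc _ cont', of t0 t] st by auto
      have "z \<noteq> t0" using z(2)[of t] t_top st by auto
      define w where "w = (if z = t then s else z)"
      have w: "w \<in> {t0<..<t}" using z(1) \<open>z \<noteq> t0\<close> s st by (auto simp: w_def)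
      have "\<forall>y\<in>{t0..t}. u w \<le> u y" using z(2) le by (auto simp: w_def intro: order_trans)
      hence "local_extremum u w" using w by (intro interior_extremum_local[of w t0 t]) auto
      hence "w = t0" using ext[of w] w st t0 by auto
      thus False using w by simp
    qed
  qed
qed

text \<open>The constant value \<open>c\<close> outside the support is a critical point of \<open>F\<close> on the energy level. If
  \<open>c\<close> were positive, it would be an isolated equilibrium and the wave constant.\<close>

lemma compact_solitary_wave_rests_at_zero:
  assumes F: "\<forall>x. real_analytic_at F x" and u: "compact_solitary_wave F u t1 t2"
  shows "\<exists>S. energy_solution F (F 0) S u" "deriv F 0 = 0" "\<And>t. t \<notin> {t1<..<t2} \<Longrightarrow> u t = 0"
proof -
  have sing: "singular_TWS F u" and cont: "continuous_on UNIV u"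
    and supp: "constant_outside u t1 t2"
    using u by (auto simp: compact_solitary_wave_def has_support_def)
  have tws: "TWS F u" "\<And>t. 0 \<le> u t"
    using sing by (auto simp: singular_TWS_def strong_singular_TWS_def weak_singular_TWS_def TWS_def)
  obtain h S where sol: "energy_solution F h S u"
    by (rule singular_TWS_energy_solution[OF sing cont])
  obtain c where c: "\<And>t. t \<in> - {t1..t2} \<Longrightarrow> u t = c"
    using supp by (auto simp: constant_outside_def constant_on_def)
  have out: "u t = c" if "t \<notin> {t1<..<t2}" for t
  proof -
    have "t \<in> closure (- {t1..t2})" using that by (simp add: closure_complement)
    moreover have "continuous_on (closure (- {t1..t2})) u"
      using cont continuous_on_subset by blast
    ultimately show ?thesis
      using continuous_constant_on_closure[of "- {t1..t2}" u c t] c by blast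
  qed
  have Fc: "deriv F c = 0"
    by (rule constant_piece_is_critical[OF tws(1) cont, of t2 "t2 + 1"]) (auto intro: out)
  obtain t where t: "t \<in> {t2<..<t2 + 1}" "t \<notin> S"
    using countable_dense[of S t2 "t2 + 1"] sol by (auto simp: energy_solution_def)
  then obtain D where D: "(u has_real_derivative D) (at t)" "u t * D\<^sup>2 / 2 + F (u t) = h"
    using sol unfolding energy_solution_def by blast
  have "((\<lambda>_. c) has_real_derivative 0) (at t)" by simp
  hence "(u has_real_derivative 0) (at t)"
    by (rule has_field_derivative_transform_within_open[of _ _ _ "{t2<..}"]) (use t out in auto)
  hence "D = 0" using D(1) DERIV_unique by blast
  hence h: "h = F c" using D(2) out[of t] t by simp
  have "c = 0"
  proof (rule ccontr)
    assume "c \<noteq> 0"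
    hence "c > 0" using tws(2)[of t2] out[of t2] by simp
    moreover have "u t2 = c" by (rule out) simp
    ultimately have "u t = c" for t
      using equilibrium_is_isolated[of F c S u t2 t] sol F Fc h by simp
    thus False using supp by (auto simp: constant_outside_def constant_on_def)
  qed
  thus "\<exists>S. energy_solution F (F 0) S u" "deriv F 0 = 0" "\<And>t. t \<notin> {t1<..<t2} \<Longrightarrow> u t = 0"
    using sol h Fc out by auto
qed

text \<open>The energy identity determines the square of the slope off a countable set and monotonicity
  its sign; the resulting expression is continuous in \<open>t\<close>, so the exceptional points are removable.\<close>

lemma monotone_piece_slope:
  assumes F: "\<forall>x. real_analytic_at F x" and sol: "energy_solution F (F 0) S u"
    and pos: "\<And>t. t \<in> {a<..<b} \<Longrightarrow> 0 < u t" and \<sigma>: "\<sigma>\<^sup>2 = (1::real)"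
    and sign: "\<And>t D. t \<in> {a<..<b} \<Longrightarrow> (u has_real_derivative D) (at t) \<Longrightarrow> 0 \<le> \<sigma> * D"
    and t: "t \<in> {a<..<b}"
  shows "(u has_real_derivative \<sigma> * sqrt (2 * gap_quotient F (u t))) (at t)"
proof (rule countable_exceptions_DERIV[OF _ _ _ _ t])
  let ?q = "gap_quotient F"
  show u: "continuous_on UNIV u" and "countable S" using sol by (auto simp: energy_solution_def)
  note contq = real_analytic_compose_continuous[OF real_analytic_gap_quotient[OF F] u]
  show "continuous_on UNIV (\<lambda>t. \<sigma> * sqrt (2 * ?q (u t)))"
    by (intro continuous_intros contq)
  fix s assume s: "s \<in> {a<..<b} - S"
  then obtain D where D: "(u has_real_derivative D) (at s)" "u s * D\<^sup>2 / 2 + F (u s) = F 0"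
    using sol unfolding energy_solution_def by blast
  have "u s * D\<^sup>2 = 2 * (F 0 - F (u s))" using D(2) by (simp add: field_simps)
  also have "\<dots> = u s * (2 * ?q (u s))"
    using gap_quotient_eq[of F "u s"] by simp
  finally have "u s * D\<^sup>2 = u s * (2 * ?q (u s))" .
  hence "D\<^sup>2 = 2 * ?q (u s)" using pos[of s] s by simp
  hence "sqrt (2 * ?q (u s)) = \<bar>\<sigma> * D\<bar>"
    using \<sigma> by (metis power_mult_distrib mult_1 real_sqrt_abs)
  hence "\<sigma> * sqrt (2 * ?q (u s)) = \<sigma>\<^sup>2 * D"
    using sign[of s D] s D(1) by (simp add: power2_eq_square)
  thus "(u has_real_derivative \<sigma> * sqrt (2 * ?q (u s))) (at s)"
    using D(1) \<sigma> by simp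
qed

text \<open>Rising to the crest with slope \<open>s\<close> and falling with slope \<open>- s\<close> leaves the boundary
  terms \<open>4 * u t0 * s * \<phi> t0\<close> in the weak equation. Hence \<open>s = 0\<close>, which excludes peaked waves.\<close>

lemma no_corner_at_top:
  fixes F u :: "real \<Rightarrow> real"
  defines "q \<equiv> gap_quotient F"
  assumes F: "\<forall>x. real_analytic_at F x" and tws: "TWS F u" and u: "continuous_on UNIV u"
    and t0: "t0 \<in> {t1<..<t2}"
    and up: "\<And>t. t \<in> {t1<..<t0} \<Longrightarrow> (u has_real_derivative 1 * sqrt (2 * q (u t))) (at t)"
    and down: "\<And>t. t \<in> {t0<..<t2} \<Longrightarrow> (u has_real_derivative (- 1) * sqrt (2 * q (u t))) (at t)"
    and pos: "\<And>t. t \<in> {t1<..<t0} \<union> {t0<..<t2} \<Longrightarrow> q (u t) > 0" and top: "u t0 > 0"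
  shows "q (u t0) = 0"
proof -
  have q: "\<forall>x. real_analytic_at q x"
    unfolding q_def by (rule real_analytic_gap_quotient[OF F])
  have F': "\<forall>x. real_analytic_at (deriv F) x" using F real_analytic_at_deriv by blast
  note contq = real_analytic_compose_continuous[OF q u] real_analytic_compose_continuous[OF F' u]
  obtain v where v: "has_weak_derivative u v"
    and eq: "\<And>\<phi>. test_function \<phi> \<Longrightarrow> has_bochner_integral lebesgue
       (\<lambda>t. (v t)\<^sup>2 * \<phi> t - 2 * deriv F (u t) * \<phi> t - (u t)\<^sup>2 * deriv (deriv \<phi>) t) 0"
    using TWS_weak_form[OF tws] by blast
  have "AE t in lebesgue. t \<in> {t1<..<t0} \<longrightarrow> v t = 1 * sqrt (2 * q (u t))"
    by (rule weak_derivative_eq_derivative_AE[OF v u]) (intro continuous_intros contq, rule up)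
  moreover have "AE t in lebesgue. t \<in> {t0<..<t2} \<longrightarrow> v t = (- 1) * sqrt (2 * q (u t))"
    by (rule weak_derivative_eq_derivative_AE[OF v u]) (intro continuous_intros contq, rule down)
  moreover have "AE t in lebesgue. t \<noteq> t0"
    by (intro AE_I'[of "{t0}"]) (auto intro: null_sets_completionI)
  ultimately have v2: "AE t in lebesgue. t \<in> {t1<..<t2} \<longrightarrow> (v t)\<^sup>2 = 2 * q (u t)"
  proof eventually_elim
    case (elim t)
    show ?case
    proof
      assume "t \<in> {t1<..<t2}"
      hence "t \<in> {t1<..<t0} \<union> {t0<..<t2}" using elim(3) by auto
      thus "(v t)\<^sup>2 = 2 * q (u t)" using elim(1,2) pos[of t] by auto
    qed
  qed
  \<comment> \<open>A test function supported strictly inside the bump and positive at the crest.\<close>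
  define a b where "a = (t1 + t0) / 2" and "b = (t0 + t2) / 2"
  have ab: "t1 < a" "a < t0" "t0 < b" "b < t2" using t0 by (auto simp: a_def b_def)
  define \<phi> where "\<phi> = bump 0 a b"
  have \<phi>: "test_function \<phi>" unfolding \<phi>_def by (rule test_function_bump)
  have z: "\<phi> t = 0" if "t \<notin> {a..b}" for t unfolding \<phi>_def by (rule bump_outside) (use that in auto)
  note z' = deriv_eq_0_outside[of a b \<phi>, OF z]
  note z'' = deriv_eq_0_outside[of a b "deriv \<phi>", OF z']
  let ?J = "\<lambda>t. 2 * q (u t) * \<phi> t - 2 * deriv F (u t) * \<phi> t - (u t)\<^sup>2 * deriv (deriv \<phi>) t"
  let ?I = "\<lambda>t. (v t)\<^sup>2 * \<phi> t - 2 * deriv F (u t) * \<phi> t - (u t)\<^sup>2 * deriv (deriv \<phi>) t"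
  have contJ: "continuous_on UNIV ?J"
    by (intro continuous_intros contq u test_function_continuous test_function_deriv \<phi>)
  have "has_bochner_integral lebesgue ?J 0"
  proof (rule has_bochner_integral_cong_AE[THEN iffD1, OF _ _ _ eq[OF \<phi>]])
    show "?J \<in> borel_measurable lebesgue"
      using borel_measurable_continuous_onI[OF contJ] by (intro measurable_completion) simp
    show "?I \<in> borel_measurable lebesgue"
      using eq[OF \<phi>] by (auto simp: has_bochner_integral_iff)
    show "AE t in lebesgue. ?I t = ?J t"
      using v2
    proof eventually_elim
      case (elim t)
      thus ?case using z[of t] ab by (cases "t \<in> {a..b}") auto
    qed
  qed
  hence J: "(?J has_integral 0) UNIV"
    using has_integral_integral_lebesgue[of ?J] by (simp add: has_bochner_integral_iff)
  define c d where "c = (t1 + a) / 2" and "d = (b + t2) / 2"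
  have cd: "t1 < c" "c < a" "b < d" "d < t2" using ab by (auto simp: c_def d_def)
  have I1: "(?J has_integral
      ((1 * (2 * u t0 * sqrt (2 * q (u t0)) * \<phi> t0) - (u t0)\<^sup>2 * deriv \<phi> t0) -
       (1 * (2 * u c * sqrt (2 * q (u c)) * \<phi> c) - (u c)\<^sup>2 * deriv \<phi> c))) {c..t0}"
    unfolding q_def
  proof (rule monotone_piece_momentum[OF F u \<phi>])
    show "(u has_real_derivative 1 * sqrt (2 * gap_quotient F (u t))) (at t)"
      "0 < gap_quotient F (u t)" if "t \<in> {c<..<t0}" for t
      using up[of t] pos[of t] that cd unfolding q_def by auto
  qed (use cd ab in auto)
  have I2: "(?J has_integral
      (((- 1) * (2 * u d * sqrt (2 * q (u d)) * \<phi> d) - (u d)\<^sup>2 * deriv \<phi> d) -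
       ((- 1) * (2 * u t0 * sqrt (2 * q (u t0)) * \<phi> t0) - (u t0)\<^sup>2 * deriv \<phi> t0))) {t0..d}"
    unfolding q_def
  proof (rule monotone_piece_momentum[OF F u \<phi>])
    show "(u has_real_derivative (- 1) * sqrt (2 * gap_quotient F (u t))) (at t)"
      "0 < gap_quotient F (u t)" if "t \<in> {t0<..<d}" for t
      using down[of t] pos[of t] that cd unfolding q_def by auto
  qed (use cd ab in auto)
  have ends: "\<phi> c = 0" "\<phi> d = 0" "deriv \<phi> c = 0" "deriv \<phi> d = 0"
    using cd by (auto intro!: z z')
  have "c \<le> t0" "t0 \<le> d" using cd ab by auto
  hence "(?J has_integral 4 * u t0 * sqrt (2 * q (u t0)) * \<phi> t0) {c..d}"
    by (rule has_integral_eq_rhs[OF has_integral_combine[OF _ _ I1 I2]]) (simp add: ends algebra_simps)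
  moreover have "?J t = 0" if "t \<notin> {c..d}" for t
  proof -
    have "t \<notin> {a..b}" using that cd by auto
    thus ?thesis using z[of t] z''[of t] by simp
  qed
  ultimately have "(?J has_integral 4 * u t0 * sqrt (2 * q (u t0)) * \<phi> t0) UNIV"
    by (intro has_integral_on_superset[of ?J _ "{c..d}" UNIV]) auto
  hence "4 * u t0 * sqrt (2 * q (u t0)) * \<phi> t0 = 0"
    using J has_integral_unique by blast
  moreover have "\<phi> t0 > 0" unfolding \<phi>_def by (rule bump_pos) (use ab in auto)
  ultimately show ?thesis using top by simp
qed

text \<open>All heights up to the crest are attained, so \<open>F\<close> is at most \<open>F 0\<close> there; equality at \<open>x\<close>
  would make \<open>x\<close> a local maximum of \<open>F\<close>, hence an equilibrium through which the wave passes.\<close>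

lemma no_rest_point_below_top:
  assumes F: "\<forall>x. real_analytic_at F x" and sol: "energy_solution F (F 0) S u"
    and nonneg: "\<And>t. 0 \<le> u t" and "t1 \<le> t0" "u t1 = 0" and x: "x \<in> {0<..<u t0}"
  shows "F x < F 0"
proof -
  have cont: "continuous_on {t1..t0} u" using sol continuous_on_subset by (auto simp: energy_solution_def)
  have attained: "\<exists>t. u t = y" if y: "y \<in> {0<..<u t0}" for y
    using IVT'[of u t1 y t0] cont y \<open>t1 \<le> t0\<close> \<open>u t1 = 0\<close> by auto
  have le: "F y \<le> F 0" if "y \<in> {0<..<u t0}" for y
    using attained[OF that] energy_solution_bound[OF sol F nonneg] by metis
  show ?thesis
  proof (rule ccontr)
    assume "\<not> F x < F 0"
    hence eq: "F x = F 0" using le[OF x] by simp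
    have "deriv F x = 0"
    proof (rule DERIV_local_max[OF real_analytic_DERIV[OF F]])
      show "0 < min x (u t0 - x)" using x by auto
      show "\<forall>y. \<bar>x - y\<bar> < min x (u t0 - x) \<longrightarrow> F y \<le> F x"
      proof (intro allI impI)
        fix y assume "\<bar>x - y\<bar> < min x (u t0 - x)"
        hence "y \<in> {0<..<u t0}" by auto
        thus "F y \<le> F x" using le eq by simp
      qed
    qed
    moreover obtain t where "u t = x" using attained[OF x] by blast
    ultimately have "u t1 = x"
      using equilibrium_is_isolated[of F x S u t t1] F sol x eq by simp
    thus False using \<open>u t1 = 0\<close> x by simp
  qed
qed

text \<open>If \<open>F'' 0 \<ge> 0\<close>, then \<open>F 0 - F y\<close> is at most of order \<open>y ^ 3\<close>, the slope is at most of
  order \<open>u\<close>, and by Gronwall the wave cannot leave zero. A compact support thus forces a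
  nondegenerate maximum of \<open>F\<close> at zero.\<close>

lemma hyperbolic_at_zero:
  assumes F: "\<forall>x. real_analytic_at F x" and sol: "energy_solution F (F 0) S u"
    and crit: "deriv F 0 = 0" and ab: "a < b" "u a = 0" and pos: "\<And>t. t \<in> {a<..<b} \<Longrightarrow> 0 < u t"
  shows "deriv (deriv F) 0 < 0"
proof (rule ccontr)
  assume degenerate: "\<not> deriv (deriv F) 0 < 0"
  define q where "q = gap_quotient F"
  have q: "\<forall>x. real_analytic_at q x" "q 0 = 0"
    using real_analytic_gap_quotient[OF F] gap_quotient_0[OF F] crit by (simp_all add: q_def)
  define g where "g = divided_diff 0 q"
  have g: "\<forall>x. real_analytic_at g x" using real_analytic_divided_diff[OF q] by (simp add: g_def)
  have gap: "F 0 - F x = x\<^sup>2 * g x" for x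
    using gap_quotient_eq[of F x] divided_diff_eq[of q 0 x] q(2)
    by (simp add: q_def g_def power2_eq_square)
  have g0: "g 0 \<le> 0"
    using deriv_gap_quotient_0[OF F] degenerate by (simp add: g_def divided_diff_def q_def)
  have g': "\<forall>x. real_analytic_at (\<lambda>x. g x - g 0) x"
    by (intro allI real_analytic_at_diff real_analytic_at_const) (use g in auto)
  define p where "p = divided_diff 0 (\<lambda>x. g x - g 0)"
  have p: "\<forall>x. real_analytic_at p x" using real_analytic_divided_diff[OF g'] by (simp add: p_def)
  have gp: "g x = g 0 + x * p x" for x
    using divided_diff_eq[of "\<lambda>x. g x - g 0" 0 x] by (simp add: p_def)
  have "isCont p 0" using real_analytic_DERIV[OF p] DERIV_isCont by blast
  then obtain d where d: "d > 0" "\<And>x. \<bar>x\<bar> < d \<Longrightarrow> \<bar>p x - p 0\<bar> < 1"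
    unfolding continuous_at_eps_delta dist_real_def by (metis diff_zero zero_less_one)
  define M where "M = \<bar>p 0\<bar> + 1"
  define K where "K = sqrt (2 * M)"
  have slope: "\<bar>D\<bar> \<le> K * \<bar>y\<bar>" if y: "0 < y" "y < d" "y * D\<^sup>2 / 2 + F y = F 0" for y D
  proof -
    have "p y \<le> M" using d(2)[of y] y by (auto simp: M_def)
    hence "y * p y \<le> y * M" using y(1) by (intro mult_left_mono) auto
    hence "g y \<le> y * M" using gp[of y] g0 by linarith
    hence "y\<^sup>2 * g y \<le> y\<^sup>2 * (y * M)" by (intro mult_left_mono) auto
    moreover have "y * D\<^sup>2 = 2 * (y\<^sup>2 * g y)" using y(3) gap[of y] by simp
    moreover have "2 * (y\<^sup>2 * (y * M)) = y * (2 * M * y\<^sup>2)" by simp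
    ultimately have "y * D\<^sup>2 \<le> y * (2 * M * y\<^sup>2)" by linarith
    hence "D\<^sup>2 \<le> 2 * M * y\<^sup>2" using y(1) by simp
    also have "\<dots> = (K * \<bar>y\<bar>)\<^sup>2" by (simp add: K_def M_def power_mult_distrib)
    finally have "\<bar>D\<bar> \<le> \<bar>K * \<bar>y\<bar>\<bar>" by (simp add: abs_le_square_iff)
    thus ?thesis by (simp add: K_def M_def abs_mult)
  qed
  have cont: "continuous_on UNIV u" using sol by (simp add: energy_solution_def)
  hence "isCont u a" by (simp add: continuous_on_eq_continuous_at)
  then obtain e where e: "e > 0" "\<And>t. \<bar>t - a\<bar> < e \<Longrightarrow> \<bar>u t\<bar> < d"
    using \<open>u a = 0\<close> d(1) unfolding continuous_at_eps_delta dist_real_def by (metis diff_zero)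
  define c where "c = a + min e (b - a) / 2"
  have c: "a < c" "c < b" "c < a + e" using e ab by (auto simp: c_def min_def field_simps)
  have "u c = 0"
  proof (rule gronwall_countable_exceptions[of a c u S K])
    show "continuous_on {a..c} u" using cont continuous_on_subset by blast
    show "countable S" using sol by (simp add: energy_solution_def)
    fix t assume t: "t \<in> {a<..<c} - S"
    then obtain D where D: "(u has_real_derivative D) (at t)" "u t * D\<^sup>2 / 2 + F (u t) = F 0"
      using sol unfolding energy_solution_def by blast
    have "0 < u t" "u t < d" using pos[of t] e(2)[of t] t c by auto
    thus "\<exists>D. (u has_real_derivative D) (at t) \<and> \<bar>D\<bar> \<le> K * \<bar>u t\<bar>"
      using slope[OF _ _ D(2)] D(1) by blast
  qed (use c ab in auto)
  thus False using pos[of c] c by simp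
qed

text \<open>The two halves are rising solutions, the second one after time reversal; each coincides with
  the profile and takes half the width. So up to translation there is only one solitary wave.\<close>

theorem compact_solitary_wave_classification:
  assumes F: "\<forall>x. real_analytic_at F x" and u: "compact_solitary_wave F u t1 t2"
  obtains m where "compacton_potential F m" "u = compacton_potential.wave F m {t1}"
    "t2 = t1 + compacton_potential.width F m"
proof -
  have sing: "singular_TWS F u" and cont: "continuous_on UNIV u"
    and supp: "constant_outside u t1 t2"
    and unique: "\<exists>!t. t \<in> {t1<..<t2} \<and> local_extremum u t"
    using u by (auto simp: compact_solitary_wave_def has_support_def)
  have tws: "TWS F u" "\<And>t. 0 \<le> u t"
    using sing by (auto simp: singular_TWS_def strong_singular_TWS_def weak_singular_TWS_def TWS_def)
  note rest = compact_solitary_wave_rests_at_zero[OF F u]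
  obtain S where sol: "energy_solution F (F 0) S u" using rest(1) by blast
  have crit: "deriv F 0 = 0" by (rule rest(2))
  have out: "\<And>t. t \<notin> {t1<..<t2} \<Longrightarrow> u t = 0" by (rule rest(3))
  have ends: "u t1 = 0" "u t2 = 0" by (auto intro: out)
  have nonconst: "\<not> u constant_on {t1..t2}" using supp by (simp add: constant_outside_def)
  obtain t0 where t0: "t0 \<in> {t1<..<t2}"
    and up: "\<And>s t. t1 \<le> s \<Longrightarrow> s < t \<Longrightarrow> t \<le> t0 \<Longrightarrow> u s < u t"
    and down: "\<And>s t. t0 \<le> s \<Longrightarrow> s < t \<Longrightarrow> t \<le> t2 \<Longrightarrow> u t < u s"
    using unique_extremum_imp_unimodal[OF cont ends tws(2) nonconst unique] by blast
  define m where "m = u t0"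
  define q where "q = gap_quotient F"
  have gap: "F 0 - F x = x * q x" for x
    using gap_quotient_eq[of F x] by (simp add: q_def)
  have m: "m > 0" using up[of t1 t0] t0 ends by (simp add: m_def)
  have left: "u t \<in> {0<..<m}" if "t \<in> {t1<..<t0}" for t
    using up[of t1 t] up[of t t0] that ends by (simp add: m_def)
  have right: "u t \<in> {0<..<m}" if "t \<in> {t0<..<t2}" for t
    using down[of t t2] down[of t0 t] that ends by (simp add: m_def)
  have below: "F x < F 0" if "x \<in> {0<..<m}" for x
    by (rule no_rest_point_below_top[OF F sol tws(2) _ ends(1), of t0]) (use that t0 m_def in auto)
  have q_pos: "q x > 0" if "x \<in> {0<..<m}" for x
  proof -
    have "0 < x * q x" using gap[of x] below[OF that] by simp
    thus ?thesis using that by (simp add: zero_less_mult_iff)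
  qed
  have slope_up: "(u has_real_derivative 1 * sqrt (2 * q (u t))) (at t)" if "t \<in> {t1<..<t0}" for t
    unfolding q_def
  proof (rule monotone_piece_slope[OF F sol _ _ _ that])
    fix t D assume t: "t \<in> {t1<..<t0}" "(u has_real_derivative D) (at t)"
    have "mono_on {t1<..<t0} u"
      by (rule mono_onI) (use up in \<open>auto simp: le_less\<close>)
    from mono_on_imp_deriv_nonneg[OF this t(2)] t(1) show "0 \<le> 1 * D" by simp
  qed (use left in auto)
  have slope_down: "(u has_real_derivative (- 1) * sqrt (2 * q (u t))) (at t)" if "t \<in> {t0<..<t2}" for t
    unfolding q_def
  proof (rule monotone_piece_slope[OF F sol _ _ _ that])
    fix t D assume t: "t \<in> {t0<..<t2}" "(u has_real_derivative D) (at t)"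
    have "((\<lambda>t. - u t) has_real_derivative - D) (at t)" using DERIV_minus[OF t(2)] .
    moreover have "mono_on {t0<..<t2} (\<lambda>t. - u t)"
      by (rule mono_onI) (use down in \<open>auto simp: le_less\<close>)
    ultimately show "0 \<le> - 1 * D" using mono_on_imp_deriv_nonneg t(1) by fastforce
  qed (use right in auto)
  have "q (u t0) = 0"
    unfolding q_def
    by (rule no_corner_at_top[OF F tws(1) cont t0])
       (use slope_up slope_down left right q_pos m in \<open>auto simp: q_def m_def\<close>)
  hence level: "F m = F 0" using gap[of m] by (simp add: m_def)
  have regular: "deriv F m \<noteq> 0"
  proof
    assume rest: "deriv F m = 0"
    have "energy_solution F (F m) S u" unfolding level by (rule sol)
    hence "u t1 = m"
      by (rule equilibrium_is_isolated[OF _ F m rest]) (rule m_def[symmetric])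
    thus False using ends m by simp
  qed
  have hyp: "deriv (deriv F) 0 < 0"
    by (rule hyperbolic_at_zero[OF F sol crit, of t1 t0]) (use t0 ends left in auto)
  interpret compacton_potential F m
    by unfold_locales (use F crit hyp m level below regular in auto)
  have energy: "u t * (sqrt (2 * q (u t)))\<^sup>2 / 2 + F (u t) = F 0" if "u t \<in> {0<..<m}" for t
    using q_pos[OF that] gap[of "u t"] by simp
  have L: "t0 - t1 = width / 2" "\<And>t. t \<in> {t1..t0} \<Longrightarrow> u t = profile (t - t1)"
  proof -
    have sol: "\<exists>D\<ge>0. (u has_real_derivative D) (at t) \<and> u t * D\<^sup>2 / 2 + F (u t) = F 0"
      if "t \<in> {t1<..<t0} - {}" for t
      using slope_up[of t] energy[of t] left[of t] q_pos[of "u t"] that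
      by (intro exI[of _ "sqrt (2 * q (u t))"]) auto
    have "continuous_on {t1..t0} u" using cont continuous_on_subset by blast
    note rise = rising_solution_is_profile[OF _ this countable_empty ends(1) m_def[symmetric] left sol]
    show "t0 - t1 = width / 2" "\<And>t. t \<in> {t1..t0} \<Longrightarrow> u t = profile (t - t1)"
      using rise t0 by auto
  qed
  have R: "t2 - t0 = width / 2" "\<And>t. t \<in> {t0..t2} \<Longrightarrow> u t = profile (t2 - t)"
  proof -
    let ?w = "\<lambda>t. u (- t)"
    have sol: "\<exists>D\<ge>0. (?w has_real_derivative D) (at t) \<and> ?w t * D\<^sup>2 / 2 + F (?w t) = F 0"
      if "t \<in> {- t2<..<- t0} - {}" for t
    proof -
      have t: "- t \<in> {t0<..<t2}" using that by auto
      have "(?w has_real_derivative (- 1 * sqrt (2 * q (u (- t)))) * (- 1)) (at t)"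
        by (rule DERIV_chain2[where g = uminus, OF slope_down[OF t]]) (auto intro!: derivative_eq_intros)
      thus ?thesis using energy[OF right[OF t]] q_pos[OF right[OF t]]
        by (intro exI[of _ "sqrt (2 * q (u (- t)))"]) auto
    qed
    have cont_w: "continuous_on {- t2..- t0} ?w"
      by (rule continuous_on_compose2[OF cont]) (auto intro!: continuous_intros)
    have left_w: "?w t \<in> {0<..<m}" if "t \<in> {- t2<..<- t0}" for t
      using right[of "- t"] that by auto
    have ends_w: "?w (- t2) = 0" "?w (- t0) = m" using ends by (auto simp: m_def)
    note rise = rising_solution_is_profile[OF _ cont_w countable_empty ends_w left_w sol]
    show "t2 - t0 = width / 2" using rise(1) t0 by auto
    fix t assume "t \<in> {t0..t2}"
    thus "u t = profile (t2 - t)" using rise(2)[of "- t"] t0 by auto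
  qed
  have t2: "t2 = t1 + width" using L(1) R(1) by (simp add: field_simps)
  have "u t = wave {t1} t" for t
  proof (cases "t \<in> {t1<..<t1 + width}")
    case True
    show ?thesis
    proof (cases "t \<le> t0")
      case True
      thus ?thesis using L(2)[of t] \<open>t \<in> {t1<..<t1 + width}\<close> by (simp add: wave_singleton)
    next
      case False
      hence "u t = profile (width - (t - t1))"
        using R(2)[of t] \<open>t \<in> {t1<..<t1 + width}\<close> t2 by (simp add: algebra_simps)
      thus ?thesis using \<open>t \<in> {t1<..<t1 + width}\<close> by (simp add: wave_singleton profile_reflect)
    qed
  next
    case False
    thus ?thesis using out[of t] t2 by (auto simp: wave_singleton)
  qed
  hence "u = wave {t1}" by blast
  thus ?thesis using that compacton_potential_axioms t2 by blast
qed

context compacton_potential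
begin

section \<open>Composite waves\<close>

definition starts :: "real \<Rightarrow> int set \<Rightarrow> (int \<Rightarrow> real) \<Rightarrow> real set" where
  "starts t1 K a = (\<lambda>k. t1 - a k * width) ` K"

lemma admissible_starts:
  assumes "admissible t1 (t1 + width) K a"
  shows "separated width (starts t1 K a)" "inj_on (\<lambda>k. t1 - a k * width) K" "starts t1 K a \<noteq> {}"
proof -
  have "disjoint_family_on (\<lambda>k. bump_interval t1 (t1 + width) (a k)) K" "K \<noteq> {}"
    using assms by (auto simp: admissible_def)
  with bump_intervals_separated[OF this(1)] width_pos
  show "separated width (starts t1 K a)" "inj_on (\<lambda>k. t1 - a k * width) K" "starts t1 K a \<noteq> {}"
    by (auto simp: starts_def)
qed

lemma admissibleI:
  assumes "K \<noteq> {}" "finite K \<or> K = UNIV"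
    and "\<And>k l. k \<in> K \<Longrightarrow> l \<in> K \<Longrightarrow> k \<noteq> l \<Longrightarrow> 1 \<le> \<bar>a k - a l\<bar>"
  shows "admissible t1 (t1 + width) K a"
  unfolding admissible_def disjoint_family_on_def
proof (intro conjI ballI impI assms(1,2))
  fix k l assume kl: "k \<in> K" "l \<in> K" "k \<noteq> l"
  have "width \<le> \<bar>a k * width - a l * width\<bar>"
    using mult_right_mono[OF assms(3)[OF kl], of width] width_pos
    by (simp add: abs_mult left_diff_distrib[symmetric])
  thus "bump_interval t1 (t1 + width) (a k) \<inter> bump_interval t1 (t1 + width) (a l) = {}"
    by (auto simp: bump_interval_def)
qed

lemma composite_wave_eq_wave:
  "composite_wave F (wave {t1}) t1 (t1 + width) K a v \<longleftrightarrow>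
     admissible t1 (t1 + width) K a \<and> v = wave (starts t1 K a)"
proof
  have interval: "bump_interval t1 (t1 + width) (a k) = {t1 - a k * width<..<t1 - a k * width + width}" for k
    by (auto simp: bump_interval_def)
  have piece: "wave {t1} (t + a k * width) = profile (t - (t1 - a k * width))"
    if "t \<in> bump_interval t1 (t1 + width) (a k)" for t k
    using that by (auto simp: wave_singleton bump_interval_def algebra_simps)
  {
    assume comp: "composite_wave F (wave {t1}) t1 (t1 + width) K a v"
    hence adm: "admissible t1 (t1 + width) K a" by (simp add: composite_wave_def)
    note sep = admissible_starts(1)[OF adm]
    have "v t = wave (starts t1 K a) t" for t
    proof (cases "\<exists>k\<in>K. t \<in> bump_interval t1 (t1 + width) (a k)")
      case True
      then obtain k where k: "k \<in> K" "t \<in> bump_interval t1 (t1 + width) (a k)" by blast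
      hence "v t = wave {t1} (t + a k * (t1 + width - t1))"
        using comp unfolding composite_wave_def by blast
      hence "v t = profile (t - (t1 - a k * width))" using piece[OF k(2)] by simp
      moreover have "wave (starts t1 K a) t = profile (t - (t1 - a k * width))"
        by (rule wave_inside[OF sep]) (use k in \<open>auto simp: starts_def interval\<close>)
      ultimately show ?thesis by simp
    next
      case False
      have "v t = 0" using comp False unfolding composite_wave_def by blast
      moreover have "wave (starts t1 K a) t = 0"
        by (rule wave_outside) (use False in \<open>auto simp: starts_def interval\<close>)
      ultimately show ?thesis by simp
    qed
    thus "admissible t1 (t1 + width) K a \<and> v = wave (starts t1 K a)" using adm by blast
  }
  {
    assume "admissible t1 (t1 + width) K a \<and> v = wave (starts t1 K a)"
    hence adm: "admissible t1 (t1 + width) K a" and v: "v = wave (starts t1 K a)" by auto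
    note sep = admissible_starts(1)[OF adm]
    show "composite_wave F (wave {t1}) t1 (t1 + width) K a v"
      unfolding composite_wave_def
    proof (intro conjI ballI allI impI)
      show "compact_solitary_wave F (wave {t1}) t1 (t1 + width)" by (rule wave_singleton_solitary)
      show "admissible t1 (t1 + width) K a" by (rule adm)
      show "singular_TWS F v"
        using wave_strong_singular[OF sep admissible_starts(3)[OF adm]] by (simp add: singular_TWS_def v)
      fix k t assume k: "k \<in> K" "t \<in> bump_interval t1 (t1 + width) (a k)"
      have "wave (starts t1 K a) t = profile (t - (t1 - a k * width))"
        by (rule wave_inside[OF sep]) (use k in \<open>auto simp: starts_def interval\<close>)
      thus "v t = wave {t1} (t + a k * (t1 + width - t1))" using piece[OF k(2)] by (simp add: v)
    next
      fix t assume "t \<notin> (\<Union>k\<in>K. bump_interval t1 (t1 + width) (a k))"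
      thus "v t = 0" unfolding v
        by (intro wave_outside) (auto simp: starts_def interval)
    qed
  }
qed

lemma solitary_wave_symmetric:
  "\<exists>t0\<in>{s<..<s + width}. (\<forall>t. t \<noteq> t0 \<longrightarrow> wave {s} t < wave {s} t0) \<and>
     (\<forall>r. wave {s} (t0 + r) = wave {s} (t0 - r))"
proof (intro bexI[of _ "s + width / 2"] conjI allI impI)
  show "s + width / 2 \<in> {s<..<s + width}" using width_pos by simp
  have top: "wave {s} (s + width / 2) = m" using width_pos by (simp add: wave_singleton profile_half)
  show "wave {s} t < wave {s} (s + width / 2)" if "t \<noteq> s + width / 2" for t
    using that profile_less_m[of "t - s"] m_pos unfolding top by (auto simp: wave_singleton)
  show "wave {s} (s + width / 2 + r) = wave {s} (s + width / 2 - r)" for r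
    using profile_reflect[of "width / 2 - r"] by (auto simp: wave_singleton)
qed

text \<open>A half-infinite train vanishes before its first bump, which a periodic nonzero function
  cannot do.\<close>

lemma wave_aperiodic: "aperiodic (wave (range (\<lambda>n. s + real n * width)))"
  unfolding aperiodic_def
proof
  let ?A = "range (\<lambda>n. s + real n * width)"
  assume "\<exists>T. has_period (wave ?A) T"
  then obtain T where T: "T > 0" "\<And>t. wave ?A (t + T) = wave ?A t"
    by (auto simp: has_period_def)
  have sep: "separated width ?A"
    unfolding separated_def
  proof (intro ballI impI, elim rangeE, hypsubst)
    fix i j :: nat assume "s + real i * width \<noteq> s + real j * width"
    hence "1 \<le> \<bar>real i - real j\<bar>" by auto
    from mult_right_mono[OF this, of width]
    show "width \<le> \<bar>s + real i * width - (s + real j * width)\<bar>"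
      using width_pos by (simp add: abs_mult left_diff_distrib[symmetric])
  qed
  have shift: "wave ?A (t + real n * T) = wave ?A t" for n t
  proof (induction n)
    case (Suc n)
    thus ?case using T(2)[of "t + real n * T"] by (simp add: algebra_simps)
  qed simp
  obtain n where n: "width < real n * T" using reals_Archimedean3[OF T(1)] by blast
  define t where "t = s + width / 2 - real n * T"
  have "\<forall>r\<in>?A. t \<notin> {r<..<r + width}"
  proof (intro ballI, elim rangeE, hypsubst)
    fix i :: nat
    have "t < s" using n width_pos by (simp add: t_def)
    moreover have "0 \<le> real i * width" using width_pos by simp
    ultimately show "t \<notin> {s + real i * width<..<s + real i * width + width}" by auto
  qed
  hence "wave ?A t = 0" by (rule wave_outside)
  moreover have "s \<in> ?A" by (rule range_eqI[of _ _ 0]) simp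
  hence "wave ?A (s + width / 2) > 0" using wave_at_middle[OF sep, of s] width_pos by simp
  ultimately show False using shift[of t n] by (simp add: t_def)
qed

text \<open>A period \<open>Q\<close> maps the bump at \<open>s\<close> onto a bump of the train: otherwise a starting point of the train,
  where the wave vanishes, would lie in the interior of a shifted bump or conversely.\<close>

lemma wave_least_period:
  assumes P: "width \<le> P"
  shows "has_least_period (wave (range (\<lambda>k::int. s + of_int k * P))) P"
proof -
  let ?A = "range (\<lambda>k::int. s + of_int k * P)"
  have P_pos: "P > 0" using P width_pos by simp
  have sep: "separated width ?A"
    unfolding separated_def
  proof (intro ballI impI, elim rangeE, hypsubst)
    fix i j :: int assume "s + of_int i * P \<noteq> s + of_int j * P"
    hence "1 \<le> \<bar>real_of_int i - of_int j\<bar>" by (auto simp flip: of_int_diff of_int_abs)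
    hence "1 * P \<le> \<bar>real_of_int i - of_int j\<bar> * P"
      using P_pos by (intro mult_right_mono) auto
    also have "\<dots> = \<bar>s + of_int i * P - (s + of_int j * P)\<bar>"
      using P_pos by (simp add: abs_mult left_diff_distrib[symmetric])
    finally show "width \<le> \<bar>s + of_int i * P - (s + of_int j * P)\<bar>"
      using P by simp
  qed
  have period: "wave ?A (t + P) = wave ?A t" for t
  proof (cases "\<exists>k::int. t \<in> {s + of_int k * P<..<s + of_int k * P + width}")
    case True
    then obtain k :: int where k: "t \<in> {s + of_int k * P<..<s + of_int k * P + width}" by blast
    have "wave ?A t = profile (t - (s + of_int k * P))"
      by (rule wave_inside[OF sep _ k]) blast
    moreover have "wave ?A (t + P) = profile (t + P - (s + of_int (k + 1) * P))"
    proof (rule wave_inside[OF sep])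
      show "t + P \<in> {s + of_int (k + 1) * P<..<s + of_int (k + 1) * P + width}"
        using k by (simp add: algebra_simps)
    qed blast
    ultimately show ?thesis by (simp add: algebra_simps)
  next
    case False
    hence "wave ?A t = 0" by (intro wave_outside) auto
    moreover have "t + P \<notin> {s + of_int k * P<..<s + of_int k * P + width}" for k :: int
      using False[simplified, rule_format, of "k - 1"] by (auto simp: algebra_simps)
    hence "wave ?A (t + P) = 0" by (intro wave_outside) auto
    ultimately show ?thesis by simp
  qed
  have "P \<le> Q" if Q: "has_period (wave ?A) Q" for Q
  proof -
    have Q_pos: "Q > 0" and per: "\<And>t. wave ?A (t + Q) = wave ?A t"
      using Q by (auto simp: has_period_def)
    have start: "s + of_int k * P \<in> ?A" for k :: int by blast
    have zero: "s \<in> ?A" by (rule range_eqI[of _ _ 0]) simp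
    have "wave ?A (s + width / 2 + Q) > 0"
      using per[of "s + width / 2"] wave_at_middle[OF sep zero, of "width / 2"] width_pos by simp
    then obtain k :: int where k: "of_int k * P < width / 2 + Q" "width / 2 + Q < of_int k * P + width"
      unfolding wave_pos_iff[OF sep] by auto
    have "Q = of_int k * P"
    proof (rule ccontr)
      assume "Q \<noteq> of_int k * P"
      then consider "Q < of_int k * P" | "of_int k * P < Q" by linarith
      thus False
      proof cases
        case 1
        have "wave ?A (s + (of_int k * P - Q)) > 0"
          by (rule wave_at_middle[OF sep zero]) (use 1 k width_pos in auto)
        thus False
          using per[of "s + (of_int k * P - Q)"] wave_at_start[OF sep start[of k]] by (simp add: algebra_simps)
      next
        case 2
        have "wave ?A (s + of_int k * P + (Q - of_int k * P)) > 0"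
          by (rule wave_at_middle[OF sep start]) (use 2 k width_pos in auto)
        thus False using per[of s] wave_at_start[OF sep zero] by simp
      qed
    qed
    moreover from this have "0 < of_int k * P" using Q_pos by simp
    hence "k \<ge> 1" using P_pos by (simp add: zero_less_mult_iff)
    hence "1 * P \<le> of_int k * P" using P_pos by (intro mult_right_mono) auto
    ultimately show ?thesis by simp
  qed
  thus ?thesis unfolding has_least_period_def has_period_def using period P_pos by blast
qed

lemma composite_wave_properties:
  assumes "composite_wave F (wave {t1}) t1 (t1 + width) K a v"
  shows "strong_singular_TWS F v \<and> v C1_differentiable_on UNIV \<and> piecewise_analytic v \<and>
    (card K = 1 \<longrightarrow> (\<exists>s1 s2. compact_solitary_wave F v s1 s2)) \<and>
    (finite K \<longrightarrow> has_compact_support v) \<and>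
    (infinite K \<longrightarrow> \<not> has_compact_support v) \<and>
    (\<forall>T. has_period v T \<longrightarrow> width \<le> T)"
proof -
  have adm: "admissible t1 (t1 + width) K a" and v: "v = wave (starts t1 K a)"
    using assms unfolding composite_wave_eq_wave by auto
  note sep = admissible_starts(1)[OF adm] and inj = admissible_starts(2)[OF adm]
    and ne = admissible_starts(3)[OF adm]
  have fin: "finite (starts t1 K a) \<longleftrightarrow> finite K"
    unfolding starts_def by (rule finite_image_iff[OF inj])
  have single: "\<exists>s1 s2. compact_solitary_wave F v s1 s2" if card1: "card K = 1"
  proof -
    obtain k where "K = {k}" using card1 card_1_singletonE by blast
    hence "v = wave {t1 - a k * width}" by (simp add: v starts_def)
    thus ?thesis using wave_singleton_solitary by blast
  qed
  show ?thesis
    unfolding v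
    using wave_strong_singular[OF sep ne] wave_C1[OF sep] wave_piecewise_analytic[OF sep]
      single[unfolded v] wave_compact_support[OF sep _ ne] wave_not_compact_support[OF sep]
      wave_period[OF sep ne] fin by blast
qed

text \<open>For the aperiodic wave the integers are enumerated by the natural numbers, because the index
  set is all of \<open>\<int>\<close> while the bumps occupy a half-line.\<close>

lemma composite_waves_exist:
  "admissible t1 (t1 + width) K a \<Longrightarrow> \<exists>v. composite_wave F (wave {t1}) t1 (t1 + width) K a v"
  "n \<ge> 1 \<Longrightarrow> \<exists>K a v. card K = n \<and> composite_wave F (wave {t1}) t1 (t1 + width) K a v"
  "\<exists>a v. composite_wave F (wave {t1}) t1 (t1 + width) UNIV a v \<and> aperiodic v"
  "T \<ge> width \<Longrightarrow> \<exists>a v. composite_wave F (wave {t1}) t1 (t1 + width) UNIV a v \<and> has_least_period v T"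
proof -
  show adm: "\<exists>v. composite_wave F (wave {t1}) t1 (t1 + width) K a v"
    if "admissible t1 (t1 + width) K a" for K a
    using that unfolding composite_wave_eq_wave by blast
  show "\<exists>K a v. card K = n \<and> composite_wave F (wave {t1}) t1 (t1 + width) K a v" if n: "n \<ge> 1"
  proof -
    have "admissible t1 (t1 + width) {1..int n} of_int"
      by (rule admissibleI) (use n in \<open>auto simp flip: of_int_diff of_int_abs\<close>)
    moreover have "card {1..int n} = n" by simp
    ultimately show ?thesis using adm by blast
  qed
  show "\<exists>a v. composite_wave F (wave {t1}) t1 (t1 + width) UNIV a v \<and> aperiodic v"
  proof -
    let ?a = "\<lambda>k. - real (int_encode k)"
    have "1 \<le> \<bar>?a k - ?a l\<bar>" if "k \<noteq> l" for k l
    proof -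
      have "int_encode k \<noteq> int_encode l" using that by (simp add: int_encode_eq)
      thus ?thesis by linarith
    qed
    hence "admissible t1 (t1 + width) UNIV ?a" by (intro admissibleI) auto
    moreover have "starts t1 UNIV ?a = range (\<lambda>n. t1 + real n * width)"
      unfolding starts_def using surj_int_encode by (auto simp: image_iff) (metis surjD)
    ultimately show ?thesis
      unfolding composite_wave_eq_wave using wave_aperiodic[of t1] by auto
  qed
  show "\<exists>a v. composite_wave F (wave {t1}) t1 (t1 + width) UNIV a v \<and> has_least_period v T"
    if T: "T \<ge> width"
  proof -
    let ?a = "\<lambda>k::int. - (of_int k * T / width)"
    have "1 \<le> \<bar>?a k - ?a l\<bar>" if "k \<noteq> l" for k l
    proof -
      have "1 \<le> \<bar>real_of_int k - of_int l\<bar>" using that by (simp flip: of_int_diff of_int_abs)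
      moreover have "1 \<le> T / width" using T width_pos by simp
      ultimately have "1 * 1 \<le> \<bar>real_of_int k - of_int l\<bar> * (T / width)"
        by (intro mult_mono) auto
      also have "\<dots> = \<bar>(real_of_int k - of_int l) * (T / width)\<bar>"
        using T width_pos by (simp add: abs_mult)
      also have "(real_of_int k - of_int l) * (T / width) = - (?a k - ?a l)"
        by (simp add: left_diff_distrib diff_divide_distrib)
      finally show ?thesis by simp
    qed
    hence "admissible t1 (t1 + width) UNIV ?a" by (intro admissibleI) auto
    moreover have "starts t1 UNIV ?a = range (\<lambda>k::int. t1 + of_int k * T)"
      unfolding starts_def using width_pos by simp
    ultimately show ?thesis
      unfolding composite_wave_eq_wave using wave_least_period[OF T, of t1] by auto
  qed
qed

end

theorem proposition7:
  fixes F :: "real \<Rightarrow> real"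
  assumes "\<forall>x. real_analytic_at F x"
  shows
    "((\<exists>u t1 t2. compact_solitary_wave F u t1 t2 \<and>
          (\<forall>K a. admissible t1 t2 K a \<longrightarrow> (\<exists>v. composite_wave F u t1 t2 K a v)))
       \<longleftrightarrow>
       deriv F 0 = 0 \<and> deriv (deriv F) 0 < 0 \<and>
       (\<exists>m>0. F m = F 0 \<and> (\<forall>x\<in>{0<..<m}. F x < F 0) \<and> deriv F m \<noteq> 0))
     \<and>
     (\<forall>u t1 t2. compact_solitary_wave F u t1 t2 \<longrightarrow>
        strong_singular_TWS F u \<and> u C1_differentiable_on UNIV \<and> piecewise_analytic u \<and>
        (\<exists>t0\<in>{t1<..<t2}. (\<forall>t. t \<noteq> t0 \<longrightarrow> u t < u t0) \<and> (\<forall>s. u (t0 + s) = u (t0 - s))) \<and>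
        (\<forall>K a. admissible t1 t2 K a \<longrightarrow> (\<exists>v. composite_wave F u t1 t2 K a v)) \<and>
        (\<forall>K a v. composite_wave F u t1 t2 K a v \<longrightarrow>
           strong_singular_TWS F v \<and> v C1_differentiable_on UNIV \<and> piecewise_analytic v \<and>
           (card K = 1 \<longrightarrow> (\<exists>s1 s2. compact_solitary_wave F v s1 s2)) \<and>
           (finite K \<longrightarrow> has_compact_support v) \<and>
           (infinite K \<longrightarrow> \<not> has_compact_support v) \<and>
           (\<forall>T. has_period v T \<longrightarrow> t2 - t1 \<le> T)) \<and>
        (\<forall>n\<ge>1. \<exists>K a v. card K = n \<and> composite_wave F u t1 t2 K a v) \<and>
        (\<exists>a v. composite_wave F u t1 t2 UNIV a v \<and> aperiodic v) \<and>
        (\<forall>T\<ge>t2 - t1. \<exists>a v. composite_wave F u t1 t2 UNIV a v \<and> has_least_period v T))"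
proof (rule conjI, rule iffI, goal_cases)
  case 1
  then obtain u t1 t2 where "compact_solitary_wave F u t1 t2" by blast
  then obtain m where "compacton_potential F m"
    by (rule compact_solitary_wave_classification[OF assms])
  then interpret compacton_potential F m .
  show ?case
    using critical hyperbolic m_pos level below regular by blast
next
  case 2
  then obtain m where "compacton_potential F m"
    using assms unfolding compacton_potential_def by blast
  then interpret compacton_potential F m .
  show ?case
    using wave_singleton_solitary[of 0] composite_waves_exist(1)[of 0] by blast
next
  case 3
  show ?case
  proof (intro allI impI, goal_cases)
    case (1 u t1 t2)
    obtain m where m: "compacton_potential F m" "u = compacton_potential.wave F m {t1}"
      "t2 = t1 + compacton_potential.width F m"
      by (rule compact_solitary_wave_classification[OF assms 1])
    interpret compacton_potential F m by (rule m(1))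
    have sep: "separated width {t1}" by (rule separated_singleton)
    have len: "t1 + width - t1 = width" by simp
    show ?case
      unfolding m(2,3) len
    proof (intro conjI)
      show "strong_singular_TWS F (wave {t1})" by (rule wave_strong_singular[OF sep]) simp
      show "wave {t1} C1_differentiable_on UNIV" by (rule wave_C1[OF sep])
      show "piecewise_analytic (wave {t1})" by (rule wave_piecewise_analytic[OF sep])
    qed (use solitary_wave_symmetric composite_waves_exist composite_wave_properties in blast)+
  qed
qed

end
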